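(* (a) Every closed flexible graphon property is testable. (b) Every robust flexible graph property is testable.
   Context: Graphs are finite and simple; a graph property is a class of graphs invariant under isomorphism. $\mathcal W_0$ is the set of symmetric measurable functions $W:[0,1]^2\to[0,1]$. For a graph $F$ on $[k]$, $t(F,W)=\int_{[0,1]^k}\prod_{ij\in E(F)}W(x_i,x_j)\,dx$, and $t(F,G)$ is the probability that a uniformly random map $V(F)\to V(G)$ preserves adjacency. Functions $W_1,W_2\in\mathcal W_0$ are isomorphic if $t(F,W_1)=t(F,W_2)$ for every graph $F$. A function property is a subset of $\mathcal W_0$; a graphon property is a function property invariant under isomorphism. A function property is closed if it is closed (in $\mathcal W_0$) in the cut norm $\|W\|_\square=\sup_{S,T\subseteq[0,1]}|\int_{S\times T}W|$ (sup over measurable $S,T$). $d_1(U,W)=\int_{[0,1]^2}|U-W|$, and $d_1(W,\mathcal R)=\inf_{U\in\mathcal R}d_1(W,U)$ ($\infty$ if $\mathcal R=\emptyset$). Flexibility: $U\in\mathcal W_0$ is a flexing of $W\in\mathcal W_0$ if $U(x,y)=W(x,y)$ for all $x,y$ with $W(x,y)\in\{0,1\}$. A function property is flexible if it contains every flexing of each of its members. The closure $\overline{\mathcal P}\subseteq\mathcal W_0$ of a graph property $\mathcal P$ is the set of all $W\in\mathcal W_0$ for which there are $G_n\in\mathcal P$ with $|V(G_n)|\to\infty$ and $t(F,G_n)\to t(F,W)$ for every graph $F$. A graph property is flexible if its closure is flexible. Robustness: for graphs $G_1,G_2$ on the same node set $V$, $d_1(G_1,G_2)=|E(G_1)\triangle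 E(G_2)|/|V|^2$; $d_1(G,\mathcal P)$ is the minimum of $d_1(G,H)$ over $H\in\mathcal P$ with $V(H)=V(G)$ ($\infty$ if there is none). For $G$ on $\{1,\dots,n\}$, $W_G(x,y)=1$ if $x\in((i-1)/n,i/n]$, $y\in((j-1)/n,j/n]$ with $ij\in E(G)$, and $0$ otherwise. $\mathcal P$ is robust if for every $\varepsilon>0$ there are $n(\varepsilon)>0$ and $\varepsilon'>0$ such that if $|V(G)|\ge n(\varepsilon)$ and $d_1(W_G,\overline{\mathcal P})\le\varepsilon'$, then $d_1(G,\mathcal P)\le\varepsilon$. Testability of function properties: $\mathbb G(k,W)$ is the random graph on $[k]$ obtained by choosing $X_1,\dots,X_k\in[0,1]$ independently and uniformly and connecting $i<j$, independently, with probability $W(X_i,X_j)$. $\mathcal R\subseteq\mathcal W_0$ is testable if there is a graph property $\mathcal R'$ such that $\Pr(\mathbb G(k,W)\in\mathcal R')\ge 2/3$ for every $W\in\mathcal R$, $k\ge1$, and for every $\varepsilon>0$ there is a $k_\varepsilon\ge1$ such that $\Pr(\mathbb G(k,W)\in\mathcal R')\le1/3$ for every $k\ge k_\varepsilon$ and every $W\in\mathcal W_0$ with $d_1(W,\mathcal R)\ge\varepsilon$. Testability of graph properties: $\mathcal P$ is testable if there is a graph property $\mathcal P'$ such that: if $G\in\mathcal P$, then for all $1\le k\le|V(G)|$ at least a fraction of $2/3$ of the $k$-node induced subgraphs of $G$ have property $\mathcal P'$; and for every $\varepsilon>0$ there is a $k_\varepsilon\ge1$ such that if $d_1(G,\mathcal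 P)\ge\varepsilon$, then for all $k_\varepsilon\le k\le|V(G)|$ at most a fraction of $1/3$ of the $k$-node induced subgraphs of $G$ have property $\mathcal P'$. *)

theory Defs
  imports "HOL-Probability.Probability"
begin

subsection \<open>Finite simple graphs\<close>

text \<open>
  A graph is a pair of a finite set of natural numbers (the nodes) and a set of two-element subsets
  of it (the edges). Since graph properties are invariant under isomorphism, nothing is lost by
  drawing the nodes from the natural numbers. The set \<open>[k]\<close> is \<open>{1..k}\<close>.
\<close>

type_synonym graph = "nat set \<times> nat set set"

abbreviation verts :: "graph \<Rightarrow> nat set" where "verts G \<equiv> fst G"
abbreviation edges :: "graph \<Rightarrow> nat set set" where "edges G \<equiv> snd G"

definition simple_graph :: "graph \<Rightarrow> bool" where
  "simple_graph G \<longleftrightarrow> finite (verts G) \<and> (\<forall>e\<in>edges G. e \<subseteq> verts G \<and> card e = 2)"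

definition graph_iso :: "graph \<Rightarrow> graph \<Rightarrow> bool" where
  "graph_iso G H \<longleftrightarrow>
     (\<exists>f. bij_betw f (verts G) (verts H) \<and>
          (\<forall>u\<in>verts G. \<forall>v\<in>verts G. {u, v} \<in> edges G \<longleftrightarrow> {f u, f v} \<in> edges H))"

definition graph_property :: "graph set \<Rightarrow> bool" where
  "graph_property P \<longleftrightarrow>
     (\<forall>G\<in>P. simple_graph G) \<and> (\<forall>G\<in>P. \<forall>H. simple_graph H \<and> graph_iso G H \<longrightarrow> H \<in> P)"

definition induced :: "graph \<Rightarrow> nat set \<Rightarrow> graph" where
  "induced G S = (S, {e \<in> edges G. e \<subseteq> S})"

definition hom_density :: "graph \<Rightarrow> graph \<Rightarrow> real" where
  "hom_density F G =
     real (card {f \<in> verts F \<rightarrow>\<^sub>E verts G. \<forall>u v. {u, v} \<in> edges F \<longrightarrow> {f u, f v} \<in> edges G})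
       / real (card (verts F \<rightarrow>\<^sub>E verts G))"

definition graph_dist :: "graph \<Rightarrow> graph \<Rightarrow> real" where
  "graph_dist G H = real (card (sym_diff (edges G) (edges H))) / real (card (verts G)) ^ 2"

text \<open>
  An infimum of extended reals over a finite set, hence a minimum, and \<open>\<infinity>\<close> if the set is empty.
\<close>

definition graph_dist_set :: "graph \<Rightarrow> graph set \<Rightarrow> ereal" where
  "graph_dist_set G P = (INF H\<in>{H \<in> P. verts H = verts G}. ereal (graph_dist G H))"


subsection \<open>Symmetric measurable functions on the unit square\<close>

abbreviation unit_square :: "(real \<times> real) set" where
  "unit_square \<equiv> {0..1} \<times> {0..1}"

text \<open>
  Measurable means Lebesgue measurable. Functions on the unit square are modelled as extensional
  functions, so that equality in HOL is equality on the unit square.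
\<close>

definition W0 :: "(real \<times> real \<Rightarrow> real) set" where
  "W0 = {W \<in> unit_square \<rightarrow>\<^sub>E {0..1}.
          W \<in> borel_measurable (lebesgue_on unit_square) \<and>
          (\<forall>x\<in>{0..1}. \<forall>y\<in>{0..1}. W (x, y) = W (y, x))}"

text \<open>
  The uniform distribution on \<open>[0,1]\<^sup>I\<close>. The completion is needed because \<open>W (x i, x j)\<close> is in general
  not measurable for the product \<open>\<sigma>\<close>-algebra when \<open>W\<close> is merely Lebesgue measurable.
\<close>

definition unit_cube :: "nat set \<Rightarrow> (nat \<Rightarrow> real) measure" where
  "unit_cube I = completion (\<Pi>\<^sub>M i\<in>I. restrict_space lborel {0..1})"

text \<open>Each edge occurs in the product exactly once, as the pair \<open>(i, j)\<close> with \<open>i < j\<close>.\<close>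

definition fun_density :: "graph \<Rightarrow> (real \<times> real \<Rightarrow> real) \<Rightarrow> real" where
  "fun_density F W =
     (LINT x|unit_cube (verts F). (\<Prod>(i, j)\<in>{(i, j). i < j \<and> {i, j} \<in> edges F}. W (x i, x j)))"

definition fun_iso :: "(real \<times> real \<Rightarrow> real) \<Rightarrow> (real \<times> real \<Rightarrow> real) \<Rightarrow> bool" where
  "fun_iso W1 W2 \<longleftrightarrow> (\<forall>F. simple_graph F \<longrightarrow> fun_density F W1 = fun_density F W2)"

definition function_property :: "(real \<times> real \<Rightarrow> real) set \<Rightarrow> bool" where
  "function_property R \<longleftrightarrow> R \<subseteq> W0"

definition graphon_property :: "(real \<times> real \<Rightarrow> real) set \<Rightarrow> bool" where
  "graphon_property R \<longleftrightarrow>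
     function_property R \<and> (\<forall>W1\<in>R. \<forall>W2\<in>W0. fun_iso W1 W2 \<longrightarrow> W2 \<in> R)"

definition cut_norm :: "(real \<times> real \<Rightarrow> real) \<Rightarrow> real" where
  "cut_norm W =
     (SUP (S, T)\<in>sets (lebesgue_on {0..1}) \<times> sets (lebesgue_on {0..1}).
        \<bar>LINT p:S \<times> T|lebesgue. W p\<bar>)"

text \<open>The complement in \<open>W0\<close> is open for the pseudometric induced by the cut norm.\<close>

definition cut_closed :: "(real \<times> real \<Rightarrow> real) set \<Rightarrow> bool" where
  "cut_closed R \<longleftrightarrow>
     (\<forall>W\<in>W0 - R. \<exists>\<epsilon>>0. \<forall>U\<in>W0. cut_norm (\<lambda>p. U p - W p) < \<epsilon> \<longrightarrow> U \<notin> R)"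

definition fun_dist :: "(real \<times> real \<Rightarrow> real) \<Rightarrow> (real \<times> real \<Rightarrow> real) \<Rightarrow> real" where
  "fun_dist U W = (LINT p|lebesgue_on unit_square. \<bar>U p - W p\<bar>)"

definition fun_dist_set :: "(real \<times> real \<Rightarrow> real) \<Rightarrow> (real \<times> real \<Rightarrow> real) set \<Rightarrow> ereal" where
  "fun_dist_set W R = (INF U\<in>R. ereal (fun_dist W U))"


subsection \<open>Flexibility\<close>

definition flexing :: "(real \<times> real \<Rightarrow> real) \<Rightarrow> (real \<times> real \<Rightarrow> real) \<Rightarrow> bool" where
  "flexing U W \<longleftrightarrow>
     U \<in> W0 \<and> W \<in> W0 \<and>
     (\<forall>x\<in>{0..1}. \<forall>y\<in>{0..1}. W (x, y) \<in> {0, 1} \<longrightarrow> U (x, y) = W (x, y))"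

definition flexible_fun :: "(real \<times> real \<Rightarrow> real) set \<Rightarrow> bool" where
  "flexible_fun R \<longleftrightarrow> (\<forall>W\<in>R. \<forall>U. flexing U W \<longrightarrow> U \<in> R)"

definition graph_closure :: "graph set \<Rightarrow> (real \<times> real \<Rightarrow> real) set" where
  "graph_closure P =
     {W \<in> W0. \<exists>G :: nat \<Rightarrow> graph.
        (\<forall>n. G n \<in> P) \<and>
        filterlim (\<lambda>n. card (verts (G n))) at_top sequentially \<and>
        (\<forall>F. simple_graph F \<longrightarrow> (\<lambda>n. hom_density F (G n)) \<longlonglongrightarrow> fun_density F W)}"

definition flexible_graph :: "graph set \<Rightarrow> bool" where
  "flexible_graph P \<longleftrightarrow> flexible_fun (graph_closure P)"


subsection \<open>Robustness\<close>

text \<open>Intended for graphs on \<open>{1..n}\<close>, so that \<open>n\<close> is the number of nodes.\<close>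

definition graph_fun :: "graph \<Rightarrow> real \<times> real \<Rightarrow> real" where
  "graph_fun G =
     (let n = real (card (verts G)) in
      restrict
        (\<lambda>(x, y). if \<exists>i j. {i, j} \<in> edges G \<and>
                          x \<in> {(real i - 1) / n<..real i / n} \<and>
                          y \<in> {(real j - 1) / n<..real j / n}
                  then 1 else 0)
        unit_square)"

text \<open>
  The function of a graph is only defined for node set \<open>{1..n}\<close>, so robustness is stated for such graphs.
  Since \<open>P\<close> is invariant under isomorphism, this covers all graphs with \<open>n\<close> nodes.
\<close>

definition robust :: "graph set \<Rightarrow> bool" where
  "robust P \<longleftrightarrow>
     (\<forall>\<epsilon>>0. \<exists>n0>0. \<exists>\<epsilon>'>0. \<forall>n\<ge>n0. \<forall>G.
        simple_graph G \<and> verts G = {1..n} \<and>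
        fun_dist_set (graph_fun G) (graph_closure P) \<le> ereal \<epsilon>' \<longrightarrow>
        graph_dist_set G P \<le> ereal \<epsilon>)"


subsection \<open>Testability\<close>

definition node_pairs :: "nat \<Rightarrow> (nat \<times> nat) set" where
  "node_pairs k = {(i, j). 1 \<le> i \<and> i < j \<and> j \<le> k}"

definition coin_graph :: "nat \<Rightarrow> (nat \<times> nat \<Rightarrow> real) \<Rightarrow> graph pmf" where
  "coin_graph k p =
     map_pmf (\<lambda>b. ({1..k}, {{i, j} | i j. (i, j) \<in> node_pairs k \<and> b (i, j)}))
       (Pi_pmf (node_pairs k) False (\<lambda>ij. bernoulli_pmf (p ij)))"

text \<open>
  First the points \<open>x i\<close> are drawn independently and uniformly; conditionally on them, each pair
  \<open>i < j\<close> is joined independently with probability \<open>W (x i, x j)\<close>.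
\<close>

definition sample_graph :: "nat \<Rightarrow> (real \<times> real \<Rightarrow> real) \<Rightarrow> graph measure" where
  "sample_graph k W =
     unit_cube {1..k} \<bind> (\<lambda>x. measure_pmf (coin_graph k (\<lambda>(i, j). W (x i, x j))))"

definition testable_fun :: "(real \<times> real \<Rightarrow> real) set \<Rightarrow> bool" where
  "testable_fun R \<longleftrightarrow>
     (\<exists>R'. graph_property R' \<and>
        (\<forall>W\<in>R. \<forall>k\<ge>1. measure (sample_graph k W) R' \<ge> 2 / 3) \<and>
        (\<forall>\<epsilon>>0. \<exists>k\<^sub>\<epsilon>\<ge>1. \<forall>k\<ge>k\<^sub>\<epsilon>. \<forall>W\<in>W0.
           fun_dist_set W R \<ge> ereal \<epsilon> \<longrightarrow> measure (sample_graph k W) R' \<le> 1 / 3))"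

definition induced_fraction :: "nat \<Rightarrow> graph \<Rightarrow> graph set \<Rightarrow> real" where
  "induced_fraction k G P =
     real (card {S. S \<subseteq> verts G \<and> card S = k \<and> induced G S \<in> P})
       / real (card {S. S \<subseteq> verts G \<and> card S = k})"

definition testable_graph :: "graph set \<Rightarrow> bool" where
  "testable_graph P \<longleftrightarrow>
     (\<exists>P'. graph_property P' \<and>
        (\<forall>G\<in>P. \<forall>k. 1 \<le> k \<and> k \<le> card (verts G) \<longrightarrow> induced_fraction k G P' \<ge> 2 / 3) \<and>
        (\<forall>\<epsilon>>0. \<exists>k\<^sub>\<epsilon>\<ge>1. \<forall>G. simple_graph G \<and> graph_dist_set G P \<ge> ereal \<epsilon> \<longrightarrow>
           (\<forall>k. k\<^sub>\<epsilon> \<le> k \<and> k \<le> card (verts G) \<longrightarrow> induced_fraction k G P' \<le> 1 / 3)))"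

end

theory Submission
  imports Defs
begin

text \<open>
  The tester accepts a sample if the homomorphism densities of the first few graphs in it are close to those of
  a member of \<open>R\<close>. Since densities concentrate uniformly (Chebyshev, because the square of the density of \<open>F\<close>
  is the density of two disjoint copies of \<open>F\<close>), it
  remains to see that \<open>W n\<close> in \<open>W0\<close> and \<open>V n\<close> in \<open>R\<close> with asymptotically equal densities have \<open>d\<^sub>1(W n, R)\<close> small
  for some \<open>n\<close>. By compactness of the space of graphons one may rearrange and pass to subsequences such that
  \<open>W n\<close> and \<open>V n\<close> converge in the cut norm to \<open>U\<close> and \<open>U'\<close>. Then \<open>U'\<close> is in \<open>R\<close> and has the same densities as \<open>U\<close>,
  so \<open>U\<close> is in \<open>R\<close>. Replacing \<open>U\<close> by \<open>W n\<close> where \<open>0 < U < 1\<close> gives a flexing of \<open>U\<close> whose \<open>L\<^sup>1\<close> distance from \<open>W n\<close> is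
  the integral of \<open>W n\<close> over \<open>U = 0\<close> plus that of \<open>1 - W n\<close> over \<open>U = 1\<close>, which tends to 0 by weak convergence.
  For graph properties the same argument applies to the closure, and robustness transfers \<open>d\<^sub>1\<close> back to graphs.
\<close>

subsection \<open>The unit interval and square\<close>

text \<open>The obstacle is compactness. The partitions of weak regularity depend on the precision,
  and those for different precisions must be aligned before limits can be taken. One rearrangement
  per function does this. The function is replaced by a step function on a dyadic grid, its greedy
  rectangles are listed once and for all, and the cells are sorted lexicographically by membership
  in the sides of the rectangles. The sides of the early rectangles become unions of few intervals,
  so averages over a fixed coarser dyadic grid approximate the function in the cut norm, with an
  error that depends on that grid and the number of rectangles, not on the function. Dyadic averages
  are nested, so their limits along a diagonal subsequence form a bounded martingale, whose limit is
  the graphon sought. The rearrangements merely permute cells and are invertible. Hence a flexing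
  found near the rearranged function can be carried back to a member of \<open>R\<close> near the
  original one, at the same L1 distance.\<close>

lemma restrict_space_completion:
  assumes S: "S \<in> sets M"
  shows "restrict_space (completion M) S = completion (restrict_space M S)"
proof (rule measure_eqI)
  have S': "S \<inter> space M \<in> sets M" "S \<inter> space (completion M) \<in> sets (completion M)"
    using S by auto
  \<comment> \<open>The two sigma-algebras have the same members: a measurable set together with a
    subset of a null set, all inside \<open>S\<close>. Bringing both to this one description
    (\<open>char\<close>, \<open>char2\<close>) makes their equality a rewriting, and either measure
    is that of the measurable part.\<close>
  have char: "A \<in> sets (restrict_space (completion M) S) \<longleftrightarrow>
     (\<exists>X N N'. A = X \<union> N \<and> X \<in> sets M \<and> X \<subseteq> S \<and> N \<subseteq> N' \<and> N' \<in> null_sets M \<and> N' \<subseteq> S)" for A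
  proof
    assume "A \<in> sets (restrict_space (completion M) S)"
    then obtain B where "A = S \<inter> B" "B \<in> sets (completion M)"
      by (auto simp: sets_restrict_space)
    from this(2) obtain X N N' where "B = X \<union> N" "N \<subseteq> N'" "N' \<in> null_sets M" "X \<in> sets M"
      by (rule sets_completionE) blast
    moreover have "S \<inter> N' \<in> null_sets M"
      using \<open>N' \<in> null_sets M\<close> S by (metis null_set_Int2 Int_commute)
    ultimately show "\<exists>X N N'. A = X \<union> N \<and> X \<in> sets M \<and> X \<subseteq> S \<and> N \<subseteq> N' \<and> N' \<in> null_sets M \<and> N' \<subseteq> S"
      using \<open>A = S \<inter> B\<close> S
      by (intro exI[of _ "S \<inter> X"] exI[of _ "S \<inter> N"] exI[of _ "S \<inter> N'"]) auto
  next
    assume "\<exists>X N N'. A = X \<union> N \<and> X \<in> sets M \<and> X \<subseteq> S \<and> N \<subseteq> N' \<and> N' \<in> null_sets M \<and> N' \<subseteq> S"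
    then obtain X N N' where "A = X \<union> N" "X \<in> sets M" "X \<subseteq> S" "N \<subseteq> N'" "N' \<in> null_sets M" "N' \<subseteq> S"
      by blast
    then have "A \<in> sets (completion M)" "A \<subseteq> S" by (auto intro: sets_completionI)
    then show "A \<in> sets (restrict_space (completion M) S)"
      by (subst sets_restrict_space_iff[OF S'(2)]) auto
  qed
  have null: "N' \<in> null_sets (restrict_space M S)" if "N' \<in> null_sets M" "N' \<subseteq> S" for N'
    using that S by (auto simp: null_sets_restrict_space)
  have char2: "A \<in> sets (completion (restrict_space M S)) \<longleftrightarrow>
     (\<exists>X N N'. A = X \<union> N \<and> X \<in> sets M \<and> X \<subseteq> S \<and> N \<subseteq> N' \<and> N' \<in> null_sets M \<and> N' \<subseteq> S)" for A
  proof
    assume "A \<in> sets (completion (restrict_space M S))"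
    then obtain X N N' where "A = X \<union> N" "N \<subseteq> N'" "N' \<in> null_sets (restrict_space M S)" "X \<in> sets (restrict_space M S)"
      by (rule sets_completionE) blast
    then show "\<exists>X N N'. A = X \<union> N \<and> X \<in> sets M \<and> X \<subseteq> S \<and> N \<subseteq> N' \<and> N' \<in> null_sets M \<and> N' \<subseteq> S"
      using S by (auto simp: null_sets_restrict_space sets_restrict_space_iff)
  next
    assume "\<exists>X N N'. A = X \<union> N \<and> X \<in> sets M \<and> X \<subseteq> S \<and> N \<subseteq> N' \<and> N' \<in> null_sets M \<and> N' \<subseteq> S"
    then obtain X N N' where *: "A = X \<union> N" "X \<in> sets M" "X \<subseteq> S" "N \<subseteq> N'" "N' \<in> null_sets M" "N' \<subseteq> S"
      by blast
    moreover have "X \<in> sets (restrict_space M S)"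
      using * S by (auto simp: sets_restrict_space_iff)
    ultimately show "A \<in> sets (completion (restrict_space M S))"
      by (intro sets_completionI[of A X N N' "restrict_space M S"] null) auto
  qed
  show "sets (restrict_space (completion M) S) = sets (completion (restrict_space M S))"
    by (intro set_eqI) (simp only: char char2)
  fix A assume A: "A \<in> sets (restrict_space (completion M) S)"
  then obtain X N N' where *: "A = X \<union> N" "X \<in> sets M" "X \<subseteq> S" "N \<subseteq> N'" "N' \<in> null_sets M" "N' \<subseteq> S"
    unfolding char by blast
  have X: "X \<in> sets (restrict_space M S)"
    using * S by (auto simp: sets_restrict_space_iff)
  have n1: "N \<in> null_sets (completion M)" 
    using * null_sets_completion_subset null_sets_completionI by blast
  have n2: "N \<in> null_sets (completion (restrict_space M S))"
    using * null null_sets_completion_subset null_sets_completionI by blast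
  have "emeasure (restrict_space (completion M) S) A = emeasure (completion M) (X \<union> N)"
    using * S'(2) by (subst emeasure_restrict_space) auto
  also have "\<dots> = emeasure M X"
    using n1 * by (subst emeasure_Un_null_set) auto
  also have "\<dots> = emeasure (restrict_space M S) X"
    using * S' by (subst emeasure_restrict_space) auto
  also have "\<dots> = emeasure (completion (restrict_space M S)) (X \<union> N)"
    using n2 X by (subst emeasure_Un_null_set) auto
  finally show "emeasure (restrict_space (completion M) S) A = emeasure (completion (restrict_space M S)) A"
    using * by simp
qed

abbreviation I01 :: "real measure" where
  "I01 \<equiv> restrict_space lborel {0..1}"

abbreviation sq :: "(real \<times> real) measure" where
  "sq \<equiv> I01 \<Otimes>\<^sub>M I01"

lemma prob_space_I01: "prob_space I01"
  by (rule prob_spaceI) (auto simp: emeasure_restrict_space space_restrict_space)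

interpretation I01: prob_space I01 by (rule prob_space_I01)
interpretation sq: pair_prob_space I01 I01 ..
lemma product_prob_space_I01: "product_prob_space (\<lambda>_. I01)"
  by unfold_locales

lemma space_I01 [simp]: "space I01 = {0..1}"
  by (simp add: space_restrict_space)

lemma space_sq [simp]: "space sq = unit_square"
  by (simp add: space_pair_measure)

text \<open>The product form gives Fubini; the restricted form gives access to
  \<open>lebesgue_on\<close> and to continuous functions on the plane.\<close>

lemma sq_eq: "sq = restrict_space lborel unit_square"
proof (rule pair_measure_eqI)
  show "sigma_finite_measure I01" "sigma_finite_measure I01" by unfold_locales
  have us: "unit_square \<in> sets (lborel :: (real \<times> real) measure)"
    by (simp add: borel_closed closed_Times)
  show "sets sq = sets (restrict_space lborel unit_square)"
  proof
    have "A \<times> B \<in> sets (restrict_space lborel unit_square)" if "A \<in> sets I01" "B \<in> sets I01" for A B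
    proof -
      from that have "A \<in> sets borel" "B \<in> sets borel" "A \<subseteq> {0..1}" "B \<subseteq> {0..1}"
        by (auto simp: sets_restrict_space_iff)
      then show ?thesis using us
        by (subst sets_restrict_space_iff) (auto simp flip: borel_prod)
    qed
    then show "sets sq \<subseteq> sets (restrict_space lborel unit_square)"
      unfolding sets_pair_measure
      by (intro sets.sigma_sets_subset') (auto simp: us sets_restrict_space_iff space_restrict_space)
    have id: "(\<lambda>x. x) \<in> sq \<rightarrow>\<^sub>M borel \<Otimes>\<^sub>M borel"
    proof -
      have "fst \<in> sq \<rightarrow>\<^sub>M borel" "snd \<in> sq \<rightarrow>\<^sub>M borel"
        by (rule measurable_compose[OF measurable_fst] measurable_compose[OF measurable_snd],
            rule measurable_restrict_space1, simp)+
      then show ?thesis by (intro measurable_Pair1' measurable_pair) (auto simp: comp_def)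
    qed
    show "sets (restrict_space lborel unit_square) \<subseteq> sets sq"
    proof
      fix X assume "X \<in> sets (restrict_space (lborel :: (real\<times>real) measure) unit_square)"
      then obtain Y where "X = unit_square \<inter> Y" "Y \<in> sets (borel :: (real\<times>real) measure)"
        by (auto simp: sets_restrict_space)
      then have "X = (\<lambda>x. x) -` Y \<inter> space sq" and "Y \<in> sets (borel \<Otimes>\<^sub>M borel)"
        by (auto simp only: borel_prod space_sq vimage_ident)
      with id show "X \<in> sets sq" by (metis measurable_sets)
    qed
  qed
  fix A B assume "A \<in> sets I01" "B \<in> sets I01"
  then have *: "A \<in> sets borel" "B \<in> sets borel" "A \<subseteq> {0..1}" "B \<subseteq> {0..1}"
    by (auto simp: sets_restrict_space_iff)
  then have "emeasure (restrict_space lborel unit_square) (A \<times> B) = emeasure (lborel \<Otimes>\<^sub>M lborel) (A \<times> B)"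
    using us by (subst emeasure_restrict_space) (auto simp: lborel_prod)
  also have "\<dots> = emeasure lborel A * emeasure lborel B"
    using * by (subst lborel.emeasure_pair_measure_Times) auto
  finally show "emeasure I01 A * emeasure I01 B = emeasure (restrict_space lborel unit_square) (A \<times> B)"
    using * by (subst (1 2) emeasure_restrict_space) auto
qed

lemma lebesgue_on_unit_square: "lebesgue_on unit_square = completion sq"
  unfolding sq_eq by (rule restrict_space_completion) (simp add: borel_closed closed_Times)

lemma lebesgue_on_unit_interval: "lebesgue_on {0..1} = completion I01"
  by (rule restrict_space_completion) simp

lemma I01_borel: "(\<lambda>x. x) \<in> I01 \<rightarrow>\<^sub>M borel"
  by (rule measurable_restrict_space1) simp

lemma W0_D:
  assumes "W \<in> W0"
  shows "W \<in> borel_measurable (completion sq)" "\<And>x y. x \<in> {0..1} \<Longrightarrow> y \<in> {0..1} \<Longrightarrow> W (x, y) \<in> {0..1}"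
    "\<And>x y. x \<in> {0..1} \<Longrightarrow> y \<in> {0..1} \<Longrightarrow> W (x, y) = W (y, x)" "W \<in> extensional unit_square"
  using assms by (auto simp: W0_def lebesgue_on_unit_square PiE_iff)

text \<open>Fubini and product measures need functions measurable for the product sigma-algebra,
  while members of \<open>W0\<close> are measurable only for its completion. The bounds are demanded
  at every point, so that later estimates need no almost-everywhere reasoning.\<close>

definition borel_version :: "(real \<times> real \<Rightarrow> real) \<Rightarrow> (real \<times> real \<Rightarrow> real) \<Rightarrow> bool" where
  "borel_version W V \<longleftrightarrow>
     V \<in> borel_measurable sq \<and> (\<forall>p. V p \<in> {0..1}) \<and> (AE p in sq. W p = V p)"

lemma borel_versionD [measurable_dest]:
  "borel_version W V \<Longrightarrow> V \<in> borel_measurable sq"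
  by (simp add: borel_version_def)

lemma borel_version_bounds:
  assumes "borel_version W V"
  shows "0 \<le> V p" "V p \<le> 1"
  using assms unfolding borel_version_def by (metis atLeastAtMost_iff)+

lemma borel_version_AE: "borel_version W V \<Longrightarrow> AE p in sq. W p = V p"
  by (simp add: borel_version_def)

lemma borel_version_exists:
  assumes "W \<in> W0"
  obtains V where "borel_version W V"
proof -
  obtain V where V: "V \<in> borel_measurable sq" "AE p in sq. W p = V p"
    using completion_ex_borel_measurable_real[OF W0_D(1)[OF assms]] by auto
  have "AE p in sq. W p = max 0 (min 1 (V p))"
    using V(2) AE_space
  proof eventually_elim
    case (elim p)
    then show ?case using W0_D(2)[OF assms, of "fst p" "snd p"] by (cases p) auto
  qed
  with V(1) have "borel_version W (\<lambda>p. max 0 (min 1 (V p)))"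
    by (auto simp: borel_version_def)
  then show ?thesis by (rule that)
qed

lemma AE_eq_imp_measurable_completion:
  fixes f g :: "'a \<Rightarrow> real"
  assumes "g \<in> borel_measurable M" "AE x in M. f x = g x"
  shows "f \<in> borel_measurable (completion M)"
proof (rule measurableI)
  interpret completion: complete_measure "completion M" ..
  fix A :: "real set" assume "A \<in> sets borel"
  show "f -` A \<inter> space (completion M) \<in> sets (completion M)"
  proof (rule completion.in_sets_AE)
    show "g -` A \<inter> space (completion M) \<in> sets (completion M)"
      using measurable_sets[OF measurable_completion[OF assms(1)] \<open>A \<in> sets borel\<close>] .
    show "AE x in completion M. x \<in> g -` A \<inter> space (completion M) \<longleftrightarrow> x \<in> f -` A \<inter> space (completion M)"
      using assms(2)[THEN AE_completion] by eventually_elim auto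
  qed auto
qed auto

lemma W0_I:
  assumes "borel_version W V" "\<And>x y. x \<in> {0..1} \<Longrightarrow> y \<in> {0..1} \<Longrightarrow> W (x, y) \<in> {0..1}"
    "\<And>x y. x \<in> {0..1} \<Longrightarrow> y \<in> {0..1} \<Longrightarrow> W (x, y) = W (y, x)" "W \<in> extensional unit_square"
  shows "W \<in> W0"
  using assms AE_eq_imp_measurable_completion[of V sq W]
  by (auto simp: W0_def lebesgue_on_unit_square PiE_iff borel_version_def)

lemma fun_dist_borel_version:
  assumes "borel_version U Z" "borel_version W V"
  shows "fun_dist U W = (LINT p|sq. \<bar>Z p - V p\<bar>)"
proof -
  note [measurable] = assms
  have "fun_dist U W = (LINT p|completion sq. \<bar>U p - W p\<bar>)"
    by (simp add: fun_dist_def lebesgue_on_unit_square)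
  also have "\<dots> = (LINT p|completion sq. \<bar>Z p - V p\<bar>)"
  proof (rule integral_cong_AE)
    show "(\<lambda>p. \<bar>U p - W p\<bar>) \<in> borel_measurable (completion sq)"
      using AE_eq_imp_measurable_completion[OF borel_versionD borel_version_AE, OF assms(1) assms(1)]
        AE_eq_imp_measurable_completion[OF borel_versionD borel_version_AE, OF assms(2) assms(2)]
      by (intro borel_measurable_abs borel_measurable_diff)
    show "AE p in completion sq. \<bar>U p - W p\<bar> = \<bar>Z p - V p\<bar>"
      using assms[THEN borel_version_AE, THEN AE_completion] by eventually_elim auto
  qed (rule measurable_completion, measurable)
  also have "\<dots> = (LINT p|sq. \<bar>Z p - V p\<bar>)"
    by (rule integral_completion) measurable
  finally show ?thesis .
qed

lemma integrable_sq_bounded: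
  fixes f :: "real \<times> real \<Rightarrow> real"
  assumes "f \<in> borel_measurable sq" "\<And>p. \<bar>f p\<bar> \<le> B"
  shows "integrable sq f"
  using assms by (intro sq.P.integrable_const_bound[where B=B]) auto

text \<open>A bound over rectangles with sides in \<open>I01\<close>, instead of the supremum over
  Lebesgue sets: such bounds add up and weaken without conditions of boundedness. On differences of
  Borel versions, \<open>cut_norm_le\<close> and \<open>cut_bound_cut_norm\<close> translate between
  this and \<open>cut_norm\<close>.\<close>

definition cut_bound :: "(real \<times> real \<Rightarrow> real) \<Rightarrow> real \<Rightarrow> bool" where
  "cut_bound D c \<longleftrightarrow>
     (\<forall>S\<in>sets I01. \<forall>T\<in>sets I01. \<bar>LINT p|sq. D p * indicator S (fst p) * indicator T (snd p)\<bar> \<le> c)"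

lemma AE_sq_fst: "AE x in I01. P x \<Longrightarrow> AE p in sq. P (fst p)"
  by (rule AE_distrD[OF measurable_fst]) (simp only: I01.distr_pair_fst)

lemma distr_sq_snd: "distr sq I01 snd = I01"
proof (rule measure_eqI)
  fix A assume "A \<in> sets (distr sq I01 snd)"
  then have A: "A \<in> sets I01" by simp
  then have "snd -` A \<inter> space sq = {0..1} \<times> A"
    using sets.sets_into_space[OF A] by auto
  then show "emeasure (distr sq I01 snd) A = emeasure I01 A"
    using A I01.emeasure_space_1 sets.top[of I01]
    by (simp add: emeasure_distr I01.emeasure_pair_measure_Times del: sets.top)
qed simp

lemma AE_sq_snd: "AE x in I01. P x \<Longrightarrow> AE p in sq. P (snd p)"
  by (rule AE_distrD[OF measurable_snd]) (simp only: distr_sq_snd)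

text \<open>A Lebesgue set agrees almost everywhere with a set of \<open>I01\<close>, and a null set
  of one coordinate is null in the square. So rectangles and functions in the cut norm can be made
  Borel at the same time.\<close>

lemma cut_integral_borel_version:
  assumes "borel_version U Z" "borel_version W V" and S: "S \<in> sets I01" and T: "T \<in> sets I01"
    and S': "AE x in I01. x \<in> S' \<longleftrightarrow> x \<in> S" "S' \<subseteq> {0..1}" and T': "AE x in I01. x \<in> T' \<longleftrightarrow> x \<in> T" "T' \<subseteq> {0..1}"
  shows "(LINT p:S' \<times> T'|lebesgue. U p - W p) = (LINT p|sq. (Z p - V p) * indicator S (fst p) * indicator T (snd p))"
    (is "_ = integral\<^sup>L sq ?g")
proof -
  note [measurable] = assms(1,2) S T
  have g [measurable]: "?g \<in> borel_measurable sq" by measurable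
  have "(LINT p:S' \<times> T'|lebesgue. U p - W p) = (LINT p|lebesgue. indicator (S' \<times> T') p *\<^sub>R (U p - W p))"
    by (simp add: set_lebesgue_integral_def)
  also have "\<dots> = (LINT p|lebesgue. indicator unit_square p *\<^sub>R (indicator (S' \<times> T') p *\<^sub>R (U p - W p)))"
    using S'(2) T'(2) by (intro Bochner_Integration.integral_cong) (auto split: split_indicator)
  also have "\<dots> = (LINT p|lebesgue_on unit_square. indicator (S' \<times> T') p *\<^sub>R (U p - W p))"
    by (subst integral_restrict_space) (auto simp: borel_closed closed_Times)
  also have "\<dots> = (LINT p|completion sq. indicator (S' \<times> T') p *\<^sub>R (U p - W p))"
    by (simp add: lebesgue_on_unit_square)
  also have "\<dots> = (LINT p|completion sq. ?g p)"
  proof (rule integral_cong_AE)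
    have "AE p in sq. fst p \<in> S' \<longleftrightarrow> fst p \<in> S"
      using S'(1) by (rule AE_sq_fst)
    moreover have "AE p in sq. snd p \<in> T' \<longleftrightarrow> snd p \<in> T"
      using T'(1) by (rule AE_sq_snd)
    ultimately have *: "AE p in sq. indicator (S' \<times> T') p *\<^sub>R (U p - W p) = ?g p"
      using assms(1,2)[THEN borel_version_AE] 
      by eventually_elim (auto split: split_indicator)
    then show "AE p in completion sq. indicator (S' \<times> T') p *\<^sub>R (U p - W p) = ?g p"
      by (rule AE_completion)
    show "(\<lambda>p. indicator (S' \<times> T') p *\<^sub>R (U p - W p)) \<in> borel_measurable (completion sq)"
      using g * by (rule AE_eq_imp_measurable_completion)
  qed (rule measurable_completion, measurable)
  also have "\<dots> = integral\<^sup>L sq ?g"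
    by (rule integral_completion) measurable
  finally show ?thesis .
qed

lemma completion_I01_version:
  fixes S' :: "real set"
  assumes "S' \<in> sets (completion I01)"
  obtains S where "S \<in> sets I01" "AE x in I01. x \<in> S' \<longleftrightarrow> x \<in> S" "S' \<subseteq> {0..1}"
proof
  show "AE x in I01. x \<in> S' \<longleftrightarrow> x \<in> main_part I01 S'"
    using AE_in_main_part[OF assms] by (simp add: AE_completion_iff eq_commute)
  show "S' \<subseteq> {0..1}" using sets.sets_into_space[OF assms] by simp
qed (use assms in auto)

lemma cut_norm_le:
  assumes "borel_version U Z" "borel_version W V" "cut_bound (\<lambda>p. Z p - V p) c"
  shows "cut_norm (\<lambda>p. U p - W p) \<le> c"
  unfolding cut_norm_def
proof (rule cSUP_least)
  fix ST assume ST: "ST \<in> sets (lebesgue_on {0..1::real}) \<times> sets (lebesgue_on {0..1::real})"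
  then obtain S' T' where [simp]: "ST = (S', T')"
    and ST': "S' \<in> sets (completion I01)" "T' \<in> sets (completion I01)"
    unfolding lebesgue_on_unit_interval by blast
  obtain S where S: "S \<in> sets I01" "AE x in I01. x \<in> S' \<longleftrightarrow> x \<in> S" "S' \<subseteq> {0..1}"
    using completion_I01_version[OF ST'(1)] .
  obtain T where T: "T \<in> sets I01" "AE x in I01. x \<in> T' \<longleftrightarrow> x \<in> T" "T' \<subseteq> {0..1}"
    using completion_I01_version[OF ST'(2)] .
  show "(case ST of (S, T) \<Rightarrow> \<bar>LINT p:S \<times> T|lebesgue. U p - W p\<bar>) \<le> c"
    using assms(3) S(1) T(1) 
    by (simp add: cut_integral_borel_version[OF assms(1,2) S(1) T(1) S(2,3) T(2,3)] cut_bound_def)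
qed auto

lemma cut_bound_L1:
  assumes "integrable sq D" 
  shows "cut_bound D (LINT p|sq. \<bar>D p\<bar>)"
  unfolding cut_bound_def
proof (intro ballI)
  fix S T assume [measurable]: "S \<in> sets I01" "T \<in> sets I01"
  have [measurable]: "D \<in> borel_measurable sq" using assms by auto
  have "\<bar>LINT p|sq. D p * indicator S (fst p) * indicator T (snd p)\<bar>
      \<le> (LINT p|sq. \<bar>D p * indicator S (fst p) * indicator T (snd p)\<bar>)"
    by (rule integral_abs_bound)
  also have "\<dots> \<le> (LINT p|sq. \<bar>D p\<bar>)"
    using assms by (intro integral_mono_AE' integrable_abs) (auto split: split_indicator)
  finally show "\<bar>LINT p|sq. D p * indicator S (fst p) * indicator T (snd p)\<bar> \<le> (LINT p|sq. \<bar>D p\<bar>)" .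
qed

lemma borel_version_diff_integrable:
  assumes "borel_version U Z" "borel_version W V"
  shows "integrable sq (\<lambda>p. Z p - V p)"
proof (rule integrable_sq_bounded)
  note [measurable] = assms
  show "(\<lambda>p. Z p - V p) \<in> borel_measurable sq" by measurable
  show "\<bar>Z p - V p\<bar> \<le> 1" for p
    using borel_version_bounds[OF assms(1), of p] borel_version_bounds[OF assms(2), of p] by auto
qed

lemma cut_bound_cut_norm:
  assumes "borel_version U Z" "borel_version W V"
  shows "cut_bound (\<lambda>p. Z p - V p) (cut_norm (\<lambda>p. U p - W p))"
  unfolding cut_bound_def
proof (intro ballI)
  fix S T assume ST: "S \<in> sets I01" "T \<in> sets I01"
  then have sub: "S \<subseteq> {0..1}" "T \<subseteq> {0..1}"
    using sets.sets_into_space[of _ I01] by auto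
  let ?f = "\<lambda>(S, T). \<bar>LINT p:S \<times> T|lebesgue. U p - W p\<bar>"
  let ?A = "sets (lebesgue_on {0..1::real}) \<times> sets (lebesgue_on {0..1::real})"
  \<comment> \<open>The supremum in \<open>cut_norm\<close> bounds its members only if they are
    bounded above; the L1 norm of the difference provides this.\<close>
  obtain c where c: "cut_bound (\<lambda>p. Z p - V p) c"
    using cut_bound_L1[OF borel_version_diff_integrable[OF assms]] by auto
  have "?f ST \<le> c" if ST': "ST \<in> ?A" for ST
  proof -
    obtain S T where ST: "ST = (S, T)" "S \<in> sets (completion I01)" "T \<in> sets (completion I01)"
      using ST' unfolding lebesgue_on_unit_interval by blast
    obtain S' where S': "S' \<in> sets I01" "AE x in I01. x \<in> S \<longleftrightarrow> x \<in> S'" "S \<subseteq> {0..1}"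
      using completion_I01_version[OF ST(2)] .
    obtain T' where T': "T' \<in> sets I01" "AE x in I01. x \<in> T \<longleftrightarrow> x \<in> T'" "T \<subseteq> {0..1}"
      using completion_I01_version[OF ST(3)] .
    show ?thesis
      using c S'(1) T'(1) cut_integral_borel_version[OF assms S'(1) T'(1) S'(2,3) T'(2,3)]
      by (simp add: ST(1) cut_bound_def)
  qed
  then have "bdd_above (?f ` ?A)"
    by (rule bdd_aboveI2)
  moreover have "(S, T) \<in> ?A"
    using ST by (auto simp: lebesgue_on_unit_interval)
  ultimately have "?f (S, T) \<le> cut_norm (\<lambda>p. U p - W p)"
    unfolding cut_norm_def by (rule cSUP_upper2) simp
  then show "\<bar>LINT p|sq. (Z p - V p) * indicator S (fst p) * indicator T (snd p)\<bar> \<le> cut_norm (\<lambda>p. U p - W p)"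
    using cut_integral_borel_version[OF assms ST, of S T] sub by simp
qed

subsection \<open>Densities, the cut norm and rearrangements\<close>

abbreviation cube :: "nat set \<Rightarrow> (nat \<Rightarrow> real) measure" where
  "cube V \<equiv> Pi\<^sub>M V (\<lambda>_. I01)"

definition ordered_edges :: "graph \<Rightarrow> (nat \<times> nat) set" where
  "ordered_edges F = {(i, j). i < j \<and> {i, j} \<in> edges F}"

lemma prob_space_cube: "prob_space (cube V)"
  by (intro prob_space_PiM prob_space_I01)

lemma ordered_edges_subset:
  "simple_graph F \<Longrightarrow> ordered_edges F \<subseteq> verts F \<times> verts F"
  by (fastforce simp: simple_graph_def ordered_edges_def)

lemma finite_ordered_edges: "simple_graph F \<Longrightarrow> finite (ordered_edges F)"
  using ordered_edges_subset[of F] by (auto simp: simple_graph_def intro: finite_subset)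

lemma sq_eqI:
  assumes "sets M = sets sq"
    and "\<And>A B. A \<in> sets I01 \<Longrightarrow> B \<in> sets I01 \<Longrightarrow> emeasure M (A \<times> B) = emeasure I01 A * emeasure I01 B"
  shows "M = sq"
  using assms by (intro pair_measure_eqI[symmetric] I01.sigma_finite_measure_axioms) auto

lemma measurable_cube_pair:
  assumes "i \<in> V" "j \<in> V"
  shows "(\<lambda>x. (x i, x j)) \<in> cube V \<rightarrow>\<^sub>M sq"
  using assms by (intro measurable_Pair measurable_component_singleton)

lemma distr_cube_pair:
  assumes V: "finite V" "i \<in> V" "j \<in> V" "i \<noteq> j"
  shows "distr (cube V) sq (\<lambda>x. (x i, x j)) = sq"
proof (rule sq_eqI)
  interpret P: product_prob_space "\<lambda>_. I01" V by (rule product_prob_space_I01)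
  fix A B assume A: "A \<in> sets I01" and B: "B \<in> sets I01"
  let ?C = "\<lambda>k. if k = i then A else if k = j then B else {0..1}"
  have sub: "A \<subseteq> {0..1}" "B \<subseteq> {0..1}" using sets.sets_into_space[of _ I01] A B by auto
  have top: "{0..1} \<in> sets I01" using sets.top[of I01] by simp
  have "(\<lambda>x. (x i, x j)) -` (A \<times> B) \<inter> space (cube V) = Pi\<^sub>E V ?C"
  proof (intro set_eqI iffI)
    fix x assume x: "x \<in> Pi\<^sub>E V ?C"
    have "Pi\<^sub>E V ?C \<subseteq> Pi\<^sub>E V (\<lambda>_. {0..1})"
      using sub by (intro PiE_mono) auto
    with x have "x \<in> space (cube V)" by (auto simp: space_PiM)
    moreover have "x i \<in> A" "x j \<in> B"
      using PiE_mem[OF x V(2)] PiE_mem[OF x V(3)] V(4) by auto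
    ultimately show "x \<in> (\<lambda>x. (x i, x j)) -` (A \<times> B) \<inter> space (cube V)" by simp
  qed (auto simp: space_PiM PiE_iff)
  then have "emeasure (distr (cube V) sq (\<lambda>x. (x i, x j))) (A \<times> B) = emeasure (cube V) (Pi\<^sub>E V ?C)"
    using A B V(2,3) by (subst emeasure_distr) auto
  also have "\<dots> = (\<Prod>k\<in>V. emeasure I01 (?C k))"
    using V(1) A B top by (intro P.emeasure_PiM) auto
  also have "\<dots> = emeasure I01 A * (emeasure I01 B * (\<Prod>k\<in>V-{i}-{j}. 1))"
    using V I01.emeasure_space_1
    by (subst prod.remove[of _ i], simp, simp, subst prod.remove[of _ j]) auto
  finally show "emeasure (distr (cube V) sq (\<lambda>x. (x i, x j))) (A \<times> B) = emeasure I01 A * emeasure I01 B"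
    by simp
qed simp

lemma AE_cube_pair:
  assumes V: "finite V" "i \<in> V" "j \<in> V" "i \<noteq> j" and P: "AE p in sq. P p"
  shows "AE x in cube V. P (x i, x j)"
proof (rule AE_distrD[OF measurable_cube_pair[OF V(2,3)]])
  show "AE p in distr (cube V) sq (\<lambda>x. (x i, x j)). P p"
    unfolding distr_cube_pair[OF V] by (rule P)
qed

definition edge_prod :: "graph \<Rightarrow> (real \<times> real \<Rightarrow> real) \<Rightarrow> (nat \<Rightarrow> real) \<Rightarrow> real" where
  "edge_prod F W x = (\<Prod>(i, j)\<in>ordered_edges F. W (x i, x j))"

lemma edge_prod_measurable [measurable]:
  assumes "simple_graph F" "V \<in> borel_measurable sq"
  shows "edge_prod F V \<in> borel_measurable (cube (verts F))"
proof -
  have "(\<lambda>x. V (x (fst e), x (snd e))) \<in> borel_measurable (cube (verts F))" if "e \<in> ordered_edges F" for e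
    using ordered_edges_subset[OF assms(1)] that
    by (intro measurable_compose[OF measurable_cube_pair assms(2)]) auto
  then show ?thesis
    unfolding edge_prod_def case_prod_beta by (intro borel_measurable_prod)
qed

lemma edge_prod_AE:
  assumes F: "simple_graph F" and "borel_version W V"
  shows "AE x in cube (verts F). edge_prod F W x = edge_prod F V x"
proof -
  have "AE x in cube (verts F). \<forall>e\<in>ordered_edges F. W (x (fst e), x (snd e)) = V (x (fst e), x (snd e))"
  proof (intro AE_finite_allI finite_ordered_edges F)
    fix e assume e: "e \<in> ordered_edges F"
    then have "fst e \<in> verts F" "snd e \<in> verts F" "fst e \<noteq> snd e"
      using ordered_edges_subset[OF F] by (auto simp: ordered_edges_def)
    then show "AE x in cube (verts F). W (x (fst e), x (snd e)) = V (x (fst e), x (snd e))"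
      using F by (intro AE_cube_pair borel_version_AE assms) (auto simp: simple_graph_def)
  qed
  then show ?thesis
    by eventually_elim (auto simp: edge_prod_def case_prod_beta)
qed

lemma fun_density_borel_version:
  assumes F: "simple_graph F" and V: "borel_version W V"
  shows "fun_density F W = (LINT x|cube (verts F). edge_prod F V x)"
proof -
  note [measurable] = V F
  have "fun_density F W = (LINT x|completion (cube (verts F)). edge_prod F W x)"
    by (simp add: fun_density_def unit_cube_def edge_prod_def ordered_edges_def)
  also have "\<dots> = (LINT x|completion (cube (verts F)). edge_prod F V x)"
  proof (rule integral_cong_AE)
    have V': "edge_prod F V \<in> borel_measurable (cube (verts F))" by measurable
    show "edge_prod F W \<in> borel_measurable (completion (cube (verts F)))"
      using V' edge_prod_AE[OF F V] by (rule AE_eq_imp_measurable_completion)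
    show "edge_prod F V \<in> borel_measurable (completion (cube (verts F)))"
      using V' by (rule measurable_completion)
    show "AE x in completion (cube (verts F)). edge_prod F W x = edge_prod F V x"
      using edge_prod_AE[OF F V] by (rule AE_completion)
  qed
  also have "\<dots> = (LINT x|cube (verts F). edge_prod F V x)"
    by (rule integral_completion) measurable
  finally show ?thesis .
qed

section \<open>Densities are Lipschitz in the cut norm\<close>

lemma integral_abs_le_const:
  fixes f :: "'a \<Rightarrow> real"
  assumes "prob_space M" "\<And>x. x \<in> space M \<Longrightarrow> \<bar>f x\<bar> \<le> c" "0 \<le> c"
  shows "\<bar>LINT x|M. f x\<bar> \<le> c"
proof (cases "integrable M f")
  case True
  interpret prob_space M by fact
  have "\<bar>LINT x|M. f x\<bar> \<le> (LINT x|M. \<bar>f x\<bar>)" by (rule integral_abs_bound)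
  also have "\<dots> \<le> (LINT x|M. c)"
    using True assms(2) by (intro integral_mono) auto
  finally show ?thesis by (simp add: prob_space)
qed (use assms in \<open>simp add: not_integrable_integral_eq\<close>)

text \<open>The value \<open>h p\<close> is the average over \<open>s\<close> in the unit interval
  of the indicator of \<open>s < h p\<close>. By Fubini the integral of \<open>D * h\<close> is then
  an average of integrals of \<open>D\<close> over superlevel sets.\<close>

lemma layer_cake_bound:
  fixes D h :: "'a \<Rightarrow> real"
  assumes M: "prob_space M" and D: "integrable M D" and h [measurable]: "h \<in> borel_measurable M"
    and h01: "\<And>p. p \<in> space M \<Longrightarrow> h p \<in> {0..1}" and c: "0 \<le> c"
    and bound: "\<And>s. \<bar>LINT p|M. D p * indicator {p \<in> space M. s < h p} p\<bar> \<le> c"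
  shows "\<bar>LINT p|M. D p * h p\<bar> \<le> c"
proof -
  interpret M: prob_space M by fact
  interpret MI: pair_prob_space M I01 ..
  have [measurable]: "D \<in> borel_measurable M" using D by auto
  let ?f = "\<lambda>(p, s). D p * (if s < h p then 1 else 0)"
  have int: "integrable (M \<Otimes>\<^sub>M I01) ?f"
  proof (rule Bochner_Integration.integrable_bound)
    have "integrable (distr (M \<Otimes>\<^sub>M I01) M fst) D" using D by (simp add: I01.distr_pair_fst)
    then show "integrable (M \<Otimes>\<^sub>M I01) (\<lambda>x. D (fst x))"
      by (subst (asm) integrable_distr_eq) auto
    have [measurable]: "(\<lambda>w. snd w) \<in> M \<Otimes>\<^sub>M I01 \<rightarrow>\<^sub>M borel"
      by (rule measurable_compose[OF measurable_snd I01_borel])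
    show "?f \<in> borel_measurable (M \<Otimes>\<^sub>M I01)" by measurable
  qed auto
  have "(LINT p|M. D p * h p) = (LINT p|M. LINT s|I01. ?f (p, s))"
  proof (intro Bochner_Integration.integral_cong refl)
    fix p assume p: "p \<in> space M"
    have "(LINT s|I01. ?f (p, s)) = D p * (LINT s|I01. indicator {0..<h p} s)"
    proof (subst integral_mult_right_zero[symmetric], intro Bochner_Integration.integral_cong refl)
      fix s assume "s \<in> space I01"
      then show "?f (p, s) = D p * indicator {0..<h p} s" by auto
    qed
    also have "(LINT s|I01. indicator {0..<h p} s) = measure I01 {0..<h p}"
      using h01[OF p] by (simp add: Int_absorb2 subset_eq)
    also have "\<dots> = h p"
      using h01[OF p] by (subst measure_restrict_space) auto
    finally show "D p * h p = (LINT s|I01. ?f (p, s))" ..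
  qed
  also have "\<dots> = (LINT s|I01. LINT p|M. ?f (p, s))"
    using MI.Fubini_integral[OF int] by simp
  also have "\<bar>\<dots>\<bar> \<le> c"
  proof (rule integral_abs_le_const[OF prob_space_I01 _ c])
    fix s
    have "(LINT p|M. ?f (p, s)) = (LINT p|M. D p * indicator {p \<in> space M. s < h p} p)"
      by (intro Bochner_Integration.integral_cong) (auto split: split_indicator)
    then show "\<bar>LINT p|M. ?f (p, s)\<bar> \<le> c" using bound by simp
  qed
  finally show ?thesis .
qed

lemma cut_bound_nonneg: "cut_bound D c \<Longrightarrow> 0 \<le> c"
  unfolding cut_bound_def by (meson abs_ge_zero order_trans sets.empty_sets)

text \<open>The layer cake argument in each of the two variables passes from indicators of
  rectangles to products of functions with values in the unit interval.\<close>

lemma cut_bound_bilinear: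
  assumes cut: "cut_bound D c" and D: "integrable sq D"
    and f [measurable]: "f \<in> borel_measurable I01" and f01: "\<And>x. x \<in> {0..1} \<Longrightarrow> f x \<in> {0..1}"
    and g [measurable]: "g \<in> borel_measurable I01" and g01: "\<And>x. x \<in> {0..1} \<Longrightarrow> g x \<in> {0..1}"
  shows "\<bar>LINT p|sq. D p * f (fst p) * g (snd p)\<bar> \<le> c"
proof (rule layer_cake_bound)
  note c = cut_bound_nonneg[OF cut]
  have D' [measurable]: "D \<in> borel_measurable sq" using D by auto
  show "prob_space sq" by unfold_locales
  show "0 \<le> c" by (rule c)
  show "integrable sq (\<lambda>p. D p * f (fst p))"
  proof (rule Bochner_Integration.integrable_bound[OF D])
    show "AE p in sq. norm (D p * f (fst p)) \<le> norm (D p)"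
    proof (rule AE_I2)
      fix p assume "p \<in> space sq"
      then have "0 \<le> f (fst p)" "f (fst p) \<le> 1" using f01[of "fst p"] by auto
      then show "norm (D p * f (fst p)) \<le> norm (D p)"
        using mult_left_mono[of "f (fst p)" 1 "\<bar>D p\<bar>"] by (simp add: abs_mult)
    qed
    show "(\<lambda>p. D p * f (fst p)) \<in> borel_measurable sq"
      by (intro borel_measurable_times D' measurable_compose[OF measurable_fst f])
  qed
  show "(\<lambda>p. g (snd p)) \<in> borel_measurable sq" by measurable
  show "g (snd p) \<in> {0..1}" if "p \<in> space sq" for p using g01[of "snd p"] that by auto
  fix t
  let ?T = "{y \<in> space I01. t < g y}"
  have T: "?T \<in> sets I01" by measurable
  have "\<bar>LINT p|sq. (D p * indicator ?T (snd p)) * f (fst p)\<bar> \<le> c"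
  proof (rule layer_cake_bound[OF \<open>prob_space sq\<close> _ _ _ c])
    show "integrable sq (\<lambda>p. D p * indicator ?T (snd p))"
      by (rule Bochner_Integration.integrable_bound[OF D]) (use T in \<open>auto split: split_indicator\<close>)
    show "(\<lambda>p. f (fst p)) \<in> borel_measurable sq" by measurable
    show "f (fst p) \<in> {0..1}" if "p \<in> space sq" for p using f01[of "fst p"] that by auto
    fix s
    let ?S = "{x \<in> space I01. s < f x}"
    have "?S \<in> sets I01" by measurable
    then have "\<bar>LINT p|sq. D p * indicator ?S (fst p) * indicator ?T (snd p)\<bar> \<le> c"
      using cut T unfolding cut_bound_def by blast
    also have "(LINT p|sq. D p * indicator ?S (fst p) * indicator ?T (snd p)) =
       (LINT p|sq. D p * indicator ?T (snd p) * indicator {p \<in> space sq. s < f (fst p)} p)"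
      by (intro Bochner_Integration.integral_cong) (auto split: split_indicator)
    finally show "\<bar>LINT p|sq. D p * indicator ?T (snd p) * indicator {p \<in> space sq. s < f (fst p)} p\<bar> \<le> c" .
  qed
  also have "(LINT p|sq. (D p * indicator ?T (snd p)) * f (fst p)) =
      (LINT p|sq. D p * f (fst p) * indicator {p \<in> space sq. t < g (snd p)} p)"
    by (intro Bochner_Integration.integral_cong) (auto split: split_indicator)
  finally show "\<bar>LINT p|sq. D p * f (fst p) * indicator {p \<in> space sq. t < g (snd p)} p\<bar> \<le> c" .
qed

text \<open>Fix all coordinates except \<open>i\<close> and \<open>j\<close>. No factor of the
  product involves both of them, so it splits into a function of \<open>x i\<close> times a function
  of \<open>x j\<close>, and \<open>cut_bound_bilinear\<close> bounds the double integral for every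
  choice of the other coordinates.\<close>

lemma cube_abs_edge_bound:
  assumes V: "finite V" "i \<in> V" "j \<in> V" "i \<noteq> j"
    and E: "finite E" "E \<subseteq> {(a, b). a \<in> V \<and> b \<in> V \<and> \<not> {i, j} \<subseteq> {a, b}}"
    and K [measurable]: "\<And>e. K e \<in> borel_measurable sq" and K01: "\<And>e p. K e p \<in> {0..1}"
    and cut: "cut_bound D c" and D [measurable]: "D \<in> borel_measurable sq" and DB: "\<And>p. \<bar>D p\<bar> \<le> B"
  shows "\<bar>LINT x|cube V. D (x i, x j) * (\<Prod>(a, b)\<in>E. K (a, b) (x a, x b))\<bar> \<le> c"
proof -
  interpret P: product_prob_space "\<lambda>_. I01" UNIV by (rule product_prob_space_I01)
  define J where "J = V - {i, j}"
  have Veq: "V = insert i (insert j J)" using V by (auto simp: J_def)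
  have J: "finite J" "j \<notin> J" "i \<notin> insert j J" "finite (insert j J)" using V by (auto simp: J_def)
  define Q where "Q x = (\<Prod>(a, b)\<in>E. K (a, b) (x a, x b))" for x :: "nat \<Rightarrow> real"
  have B: "0 \<le> B" using DB[of undefined] by simp
  have Q01: "0 \<le> Q x" "Q x \<le> 1" for x
    unfolding Q_def case_prod_beta using K01 by (auto intro!: prod_nonneg prod_le_1)
  have Q_meas: "Q \<in> borel_measurable (cube V)"
  proof -
    have "(\<lambda>x. K e (x (fst e), x (snd e))) \<in> borel_measurable (cube V)" if "e \<in> E" for e
      using E(2) that by (intro measurable_compose[OF measurable_cube_pair K]) auto
    then show ?thesis unfolding Q_def case_prod_beta by (intro borel_measurable_prod) auto
  qed
  have D_meas: "(\<lambda>x. D (x i, x j)) \<in> borel_measurable (cube V)"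
    using V(2,3) by (intro measurable_compose[OF measurable_cube_pair D])
  let ?f = "\<lambda>x. D (x i, x j) * Q x"
  have f_meas: "?f \<in> borel_measurable (cube V)"
    using Q_meas D_meas by (rule borel_measurable_times[rotated])
  have f_bound: "\<bar>?f x\<bar> \<le> B" for x
    using mult_mono[OF DB[of "(x i, x j)"] Q01(2)[of x]] Q01(1)[of x] B by (simp add: abs_mult)
  interpret cV: prob_space "cube V" by (rule prob_space_cube)
  have "integrable (cube V) ?f"
    using f_bound f_meas by (intro cV.integrable_const_bound[where B=B]) auto
  then have "(LINT x|cube V. ?f x) = (LINT x|cube (insert j J). LINT y|I01. ?f (x(i := y)))"
    unfolding Veq by (rule P.product_integral_insert[OF J(4,3)])
  also have "\<dots> = (LINT x|cube J. LINT z|I01. LINT y|I01. ?f (x(j := z, i := y)))"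
  proof (rule P.product_integral_insert[OF J(1,2)])
    interpret cJ: prob_space "cube (insert j J)" by (rule prob_space_cube)
    show "integrable (cube (insert j J)) (\<lambda>x. LINT y|I01. ?f (x(i := y)))"
    proof (rule cJ.integrable_const_bound[where B=B])
      show "AE x in cube (insert j J). norm (LINT y|I01. ?f (x(i := y))) \<le> B"
        unfolding real_norm_def by (intro AE_I2 integral_abs_le_const prob_space_I01 f_bound B)
      have m: "(\<lambda>p. (fst p)(i := snd p)) \<in> cube (insert j J) \<Otimes>\<^sub>M I01 \<rightarrow>\<^sub>M cube V"
        using measurable_add_dim[of i "insert j J" "\<lambda>_. I01"] unfolding Veq case_prod_beta .
      have "(\<lambda>(x, y). ?f (x(i := y))) \<in> borel_measurable (cube (insert j J) \<Otimes>\<^sub>M I01)"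
        unfolding case_prod_beta by (rule measurable_compose[OF m f_meas])
      then show "(\<lambda>x. LINT y|I01. ?f (x(i := y))) \<in> borel_measurable (cube (insert j J))"
        by (rule I01.borel_measurable_lebesgue_integral)
    qed
  qed
  also have "\<bar>\<dots>\<bar> \<le> c"
  proof (rule integral_abs_le_const[OF prob_space_cube _ cut_bound_nonneg[OF cut]])
    fix x assume x: "x \<in> space (cube J)"
    let ?x = "\<lambda>z y. x(j := z, i := y)"
    \<comment> \<open>Factors that contain \<open>i\<close> do not contain \<open>j\<close>, so the
      dummy value 0 given to coordinate \<open>j\<close> is never read. In \<open>g\<close> the same
      holds for coordinate \<open>i\<close>.\<close>
    define f where "f y = (\<Prod>(a, b)\<in>{(a, b)\<in>E. i \<in> {a, b}}. K (a, b) (?x 0 y a, ?x 0 y b))" for y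
    define g where "g z = (\<Prod>(a, b)\<in>{(a, b)\<in>E. i \<notin> {a, b}}. K (a, b) (?x z 0 a, ?x z 0 b))" for z
    have Q: "Q (?x z y) = f y * g z" for y z
    proof -
      have "Q (?x z y) = (\<Prod>(a, b)\<in>{(a, b)\<in>E. i \<in> {a, b}}. K (a, b) (?x z y a, ?x z y b)) *
         (\<Prod>(a, b)\<in>{(a, b)\<in>E. i \<notin> {a, b}}. K (a, b) (?x z y a, ?x z y b))"
        unfolding Q_def using E(1)
        by (subst prod.union_disjoint[symmetric]) (auto intro!: prod.cong finite_subset[OF _ E(1)])
      also have "(\<Prod>(a, b)\<in>{(a, b)\<in>E. i \<in> {a, b}}. K (a, b) (?x z y a, ?x z y b)) = f y"
        unfolding f_def using E(2) V(4) by (intro prod.cong) auto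
      also have "(\<Prod>(a, b)\<in>{(a, b)\<in>E. i \<notin> {a, b}}. K (a, b) (?x z y a, ?x z y b)) = g z"
        unfolding g_def by (intro prod.cong) auto
      finally show ?thesis .
    qed
    have xmem: "x a \<in> {0..1}" if "a \<in> J" for a using x that by (auto simp: space_PiM)
    have comp_i: "(\<lambda>y. (?x 0 y) a) \<in> I01 \<rightarrow>\<^sub>M I01" if "a \<in> V" for a
      using that xmem[of a] by (auto simp: Veq fun_upd_def)
    have comp_j: "(\<lambda>z. (?x z 0) a) \<in> I01 \<rightarrow>\<^sub>M I01" if "a \<in> V" for a
      using that xmem[of a] V(4) by (cases "a = j"; cases "a = i") (auto simp: Veq)
    have f_meas: "f \<in> borel_measurable I01"
      unfolding f_def case_prod_beta using E(2)
      by (intro borel_measurable_prod measurable_compose[OF measurable_Pair K] comp_i) auto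
    have g_meas: "g \<in> borel_measurable I01"
      unfolding g_def case_prod_beta using E(2)
      by (intro borel_measurable_prod measurable_compose[OF measurable_Pair K] comp_j) auto
    have f01: "f y \<in> {0..1}" "g y \<in> {0..1}" for y
      unfolding f_def g_def case_prod_beta using K01 by (auto intro!: prod_nonneg prod_le_1)
    have int: "integrable sq (\<lambda>p. D p * f (fst p) * g (snd p))"
    proof (rule integrable_sq_bounded[where B=B])
      show "(\<lambda>p. D p * f (fst p) * g (snd p)) \<in> borel_measurable sq"
        using f_meas g_meas by measurable
      fix p
      have "f (fst p) * g (snd p) \<le> 1" "0 \<le> f (fst p) * g (snd p)"
        using f01 by (auto intro: mult_le_one)
      then show "\<bar>D p * f (fst p) * g (snd p)\<bar> \<le> B"
        using mult_mono[OF DB[of p], of "f (fst p) * g (snd p)" 1] B f01 by (simp add: abs_mult mult.assoc)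
    qed
    have "(LINT z|I01. LINT y|I01. ?f (?x z y)) = (LINT z|I01. LINT y|I01. D (y, z) * f y * g z)"
      using V(4) by (simp add: Q mult.assoc)
    also have "\<dots> = (LINT p|sq. D p * f (fst p) * g (snd p))"
      using sq.integral_snd[of "\<lambda>y z. D (y, z) * f y * g z"] int by (simp add: case_prod_beta')
    finally show "\<bar>LINT z|I01. LINT y|I01. ?f (?x z y)\<bar> \<le> c"
      using cut_bound_bilinear[OF cut integrable_sq_bounded[OF D DB] f_meas _ g_meas] f01 by simp
  qed
  finally show ?thesis by (simp add: Q_def)
qed

text \<open>Telescoping: \<open>V\<close> is replaced by \<open>Z\<close> one edge at a time, with
  \<open>A\<close> the set of edges already replaced. Two consecutive integrals differ by an
  integral of \<open>Z - V\<close> on one edge against the product over the other edges, which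
  \<open>cube_abs_edge_bound\<close> bounds by \<open>c\<close>.\<close>

lemma density_cut_bound:
  assumes F: "simple_graph F" and U: "borel_version U Z" and W: "borel_version W V"
    and cut: "cut_bound (\<lambda>p. Z p - V p) c"
  shows "\<bar>fun_density F U - fun_density F W\<bar> \<le> real (card (ordered_edges F)) * c"
proof -
  let ?E = "ordered_edges F" and ?n = "verts F"
  note [measurable] = U W
  have ZV: "Z \<in> borel_measurable sq" "V \<in> borel_measurable sq" by measurable
  define H where "H A e = (if e \<in> A then Z else V)" for A and e :: "nat \<times> nat"
  define t where "t A = (LINT x|cube ?n. (\<Prod>(i, j)\<in>?E. H A (i, j) (x i, x j)))" for A
  have H: "H A e \<in> borel_measurable sq" "H A e p \<in> {0..1}" for A e p
    using ZV borel_version_bounds[OF U] borel_version_bounds[OF W] by (auto simp: H_def)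
  have V: "finite ?n" using F by (simp add: simple_graph_def)
  have int: "integrable (cube ?n) (\<lambda>x. \<Prod>(i, j)\<in>?E. H A (i, j) (x i, x j))" for A
  proof (rule finite_measure.integrable_const_bound[where B=1])
    show "finite_measure (cube ?n)" using prob_space_cube by (rule prob_space.finite_measure)
    show "AE x in cube ?n. norm (\<Prod>(i, j)\<in>?E. H A (i, j) (x i, x j)) \<le> 1"
      unfolding case_prod_beta using H(2)
      by (intro AE_I2) (auto simp: abs_prod intro!: prod_le_1)
    show "(\<lambda>x. \<Prod>(i, j)\<in>?E. H A (i, j) (x i, x j)) \<in> borel_measurable (cube ?n)"
      unfolding case_prod_beta using ordered_edges_subset[OF F]
      by (intro borel_measurable_prod measurable_compose[OF measurable_cube_pair H(1)]) auto
  qed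
  have "\<bar>t A - t {}\<bar> \<le> real (card A) * c" if "finite A" "A \<subseteq> ?E" for A
    using that
  proof (induction A)
    case (insert e A)
    obtain i j where e: "e = (i, j)" by fastforce
    have ij: "(i, j) \<in> ?E" "i < j" "i \<in> ?n" "j \<in> ?n"
      using insert.prems ordered_edges_subset[OF F] by (auto simp: e ordered_edges_def)
    have *: "(\<Prod>(i, j)\<in>?E. H A (i, j) (x i, x j)) =
       H A (i, j) (x i, x j) * (\<Prod>(i, j)\<in>?E-{e}. H A (i, j) (x i, x j))" for A and x :: "nat \<Rightarrow> real"
      using ij by (subst prod.remove[OF finite_ordered_edges[OF F], of e]) (auto simp: e)
    have **: "(\<Prod>(i, j)\<in>?E-{e}. H (insert e A) (i, j) (x i, x j)) =
       (\<Prod>(i, j)\<in>?E-{e}. H A (i, j) (x i, x j))" for x :: "nat \<Rightarrow> real"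
      by (intro prod.cong) (auto simp: H_def)
    have "t (insert e A) - t A = (LINT x|cube ?n. (\<Prod>(i, j)\<in>?E. H (insert e A) (i, j) (x i, x j)) -
        (\<Prod>(i, j)\<in>?E. H A (i, j) (x i, x j)))"
      unfolding t_def by (rule Bochner_Integration.integral_diff[symmetric, OF int int])
    also have "\<dots> = (LINT x|cube ?n. (Z (x i, x j) - V (x i, x j)) * (\<Prod>(i, j)\<in>?E-{e}. H A (i, j) (x i, x j)))"
      using insert.hyps(2)
      by (intro Bochner_Integration.integral_cong refl) (subst (1 2) *, subst **, simp add: H_def e left_diff_distrib)
    also have "\<bar>\<dots>\<bar> \<le> c"
    proof (rule cube_abs_edge_bound[OF V ij(3,4) _ _ _ H cut])
      show "?E - {e} \<subseteq> {(a, b). a \<in> ?n \<and> b \<in> ?n \<and> \<not> {i, j} \<subseteq> {a, b}}"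
        using ordered_edges_subset[OF F] ij(2) by (auto simp: e ordered_edges_def)
      show "(\<lambda>p. Z p - V p) \<in> borel_measurable sq" by measurable
      show "\<bar>Z p - V p\<bar> \<le> 1" for p
        using borel_version_bounds[OF U, of p] borel_version_bounds[OF W, of p] by auto
    qed (use ij finite_ordered_edges[OF F] in auto)
    finally show ?case using insert by (auto simp: algebra_simps)
  qed simp
  from this[of ?E] have "\<bar>t ?E - t {}\<bar> \<le> real (card ?E) * c"
    using finite_ordered_edges[OF F] by simp
  moreover have "t ?E = fun_density F U"
    unfolding fun_density_borel_version[OF F U] t_def edge_prod_def
    by (intro Bochner_Integration.integral_cong prod.cong refl) (auto simp: H_def)
  moreover have "t {} = fun_density F W"
    unfolding fun_density_borel_version[OF F W] t_def edge_prod_def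
    by (intro Bochner_Integration.integral_cong prod.cong refl) (auto simp: H_def)
  ultimately show ?thesis by simp
qed

lemma density_cut_norm:
  assumes F: "simple_graph F" and U: "U \<in> W0" and W: "W \<in> W0"
  shows "\<bar>fun_density F U - fun_density F W\<bar> \<le> real (card (ordered_edges F)) * cut_norm (\<lambda>p. U p - W p)"
proof -
  obtain Z V where "borel_version U Z" "borel_version W V"
    using borel_version_exists U W by metis
  then show ?thesis using density_cut_bound[OF F _ _ cut_bound_cut_norm] by blast
qed

section \<open>Measure preserving maps of the unit interval and pullbacks along them\<close>

definition measure_preserving :: "(real \<Rightarrow> real) \<Rightarrow> bool" where
  "measure_preserving \<phi> \<longleftrightarrow> \<phi> \<in> I01 \<rightarrow>\<^sub>M I01 \<and> distr I01 I01 \<phi> = I01"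

definition pullback :: "(real \<Rightarrow> real) \<Rightarrow> (real \<times> real \<Rightarrow> real) \<Rightarrow> real \<times> real \<Rightarrow> real" where
  "pullback \<phi> W = restrict (\<lambda>(x, y). W (\<phi> x, \<phi> y)) unit_square"

lemma measure_preserving_sq:
  assumes "measure_preserving \<phi>"
  shows "(\<lambda>(x, y). (\<phi> x, \<phi> y)) \<in> sq \<rightarrow>\<^sub>M sq" "distr sq sq (\<lambda>(x, y). (\<phi> x, \<phi> y)) = sq"
proof -
  have \<phi>: "\<phi> \<in> I01 \<rightarrow>\<^sub>M I01" "distr I01 I01 \<phi> = I01"
    using assms by (auto simp: measure_preserving_def)
  show "(\<lambda>(x, y). (\<phi> x, \<phi> y)) \<in> sq \<rightarrow>\<^sub>M sq"
    using \<phi>(1) by measurable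
  show "distr sq sq (\<lambda>(x, y). (\<phi> x, \<phi> y)) = sq"
    using pair_measure_distr[OF \<phi>(1) \<phi>(1)] I01.sigma_finite_measure_axioms by (simp add: \<phi>(2))
qed

lemma borel_version_pullback:
  assumes \<phi>: "measure_preserving \<phi>" and W: "borel_version W V"
  shows "borel_version (pullback \<phi> W) (\<lambda>(x, y). V (\<phi> x, \<phi> y))"
  unfolding borel_version_def
proof (intro conjI allI)
  note m = measure_preserving_sq[OF \<phi>]
  show "(\<lambda>(x, y). V (\<phi> x, \<phi> y)) \<in> borel_measurable sq"
    using measurable_compose[OF m(1) borel_versionD[OF W]] by (simp add: case_prod_beta')
  show "(case p of (x, y) \<Rightarrow> V (\<phi> x, \<phi> y)) \<in> {0..1}" for p
    using borel_version_bounds[OF W] by (auto split: prod.split)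
  have "AE p in sq. W (case p of (x, y) \<Rightarrow> (\<phi> x, \<phi> y)) = V (case p of (x, y) \<Rightarrow> (\<phi> x, \<phi> y))"
    by (rule AE_distrD[OF m(1)], unfold m(2)) (rule borel_version_AE[OF W])
  then show "AE p in sq. pullback \<phi> W p = (case p of (x, y) \<Rightarrow> V (\<phi> x, \<phi> y))"
    using AE_space by eventually_elim (auto simp: pullback_def)
qed

lemma measure_preserving_mem:
  "measure_preserving \<phi> \<Longrightarrow> x \<in> {0..1} \<Longrightarrow> \<phi> x \<in> {0..1}"
  using measurable_space[of \<phi> I01 I01 x] by (simp add: measure_preserving_def)

lemma pullback_W0:
  assumes \<phi>: "measure_preserving \<phi>" and W: "W \<in> W0"
  shows "pullback \<phi> W \<in> W0"
proof -
  obtain V where V: "borel_version W V" using borel_version_exists[OF W] .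
  show ?thesis
    using measure_preserving_mem[OF \<phi>] W0_D(2,3)[OF W]
    by (intro W0_I[OF borel_version_pullback[OF \<phi> V]]) (auto simp: pullback_def)
qed

lemma fun_dist_pullback:
  assumes \<phi>: "measure_preserving \<phi>" and U: "U \<in> W0" and W: "W \<in> W0"
  shows "fun_dist (pullback \<phi> U) (pullback \<phi> W) = fun_dist U W"
proof -
  note m = measure_preserving_sq[OF \<phi>]
  obtain Z V where ZV: "borel_version U Z" "borel_version W V"
    using borel_version_exists U W by metis
  note [measurable] = ZV
  have "fun_dist U W = (LINT p|distr sq sq (\<lambda>(x, y). (\<phi> x, \<phi> y)). \<bar>Z p - V p\<bar>)"
    by (simp add: fun_dist_borel_version[OF ZV] m(2))
  also have "\<dots> = (LINT p|sq. \<bar>Z (case p of (x, y) \<Rightarrow> (\<phi> x, \<phi> y)) - V (case p of (x, y) \<Rightarrow> (\<phi> x, \<phi> y))\<bar>)"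
    by (rule integral_distr[OF m(1)]) measurable
  also have "\<dots> = fun_dist (pullback \<phi> U) (pullback \<phi> W)"
    unfolding fun_dist_borel_version[OF ZV[THEN borel_version_pullback[OF \<phi>]]]
    by (intro Bochner_Integration.integral_cong) auto
  finally show ?thesis ..
qed

lemma fun_density_pullback:
  assumes \<phi>: "measure_preserving \<phi>" and W: "W \<in> W0" and F: "simple_graph F"
  shows "fun_density F (pullback \<phi> W) = fun_density F W"
proof -
  obtain V where V: "borel_version W V" using borel_version_exists[OF W] .
  note [measurable] = V F
  have fin: "finite (verts F)" using F by (simp add: simple_graph_def)
  have \<phi>': "\<phi> \<in> I01 \<rightarrow>\<^sub>M I01" "distr I01 I01 \<phi> = I01"
    using \<phi> by (auto simp: measure_preserving_def)
  have c: "compose (verts F) \<phi> \<in> cube (verts F) \<rightarrow>\<^sub>M cube (verts F)"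
    unfolding compose_def using \<phi>'(1) by measurable
  have d: "distr (cube (verts F)) (cube (verts F)) (compose (verts F) \<phi>) = cube (verts F)"
    using distr_PiM_finite_prob_space'[OF fin, of "\<lambda>_. I01" "\<lambda>_. I01" \<phi>] \<phi>' prob_space_I01 by simp
  have "fun_density F W = (LINT x|distr (cube (verts F)) (cube (verts F)) (compose (verts F) \<phi>). edge_prod F V x)"
    by (simp add: fun_density_borel_version[OF F V] d)
  also have "\<dots> = (LINT x|cube (verts F). edge_prod F V (compose (verts F) \<phi> x))"
    by (rule integral_distr[OF c]) measurable
  also have "\<dots> = (LINT x|cube (verts F). edge_prod F (\<lambda>(x, y). V (\<phi> x, \<phi> y)) x)"
    using ordered_edges_subset[OF F]
    by (intro Bochner_Integration.integral_cong refl) (auto simp: edge_prod_def compose_def intro!: prod.cong)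
  also have "\<dots> = fun_density F (pullback \<phi> W)"
    using fun_density_borel_version[OF F borel_version_pullback[OF \<phi> V]] ..
  finally show ?thesis ..
qed

subsection \<open>Step functions on dyadic grids\<close>

text \<open>The dyadic cells are closed on the left and open on the right, so the point 1 falls into
  a cell of its own, with index \<open>2 ^ p\<close>. This cell is null, but it has to be kept in
  mind wherever cells are enumerated.\<close>

definition idx :: "nat \<Rightarrow> real \<Rightarrow> nat" where
  "idx p x = nat \<lfloor>2 ^ p * x\<rfloor>"

definition stepfun :: "nat \<Rightarrow> (nat \<Rightarrow> nat \<Rightarrow> real) \<Rightarrow> real \<times> real \<Rightarrow> real" where
  "stepfun p A = (\<lambda>(x, y). A (idx p x) (idx p y))"

definition step :: "nat \<Rightarrow> (nat \<Rightarrow> nat \<Rightarrow> real) \<Rightarrow> real \<times> real \<Rightarrow> real" where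
  "step p A = restrict (stepfun p A) unit_square"

text \<open>Imposed at all indices and not only below \<open>2 ^ p\<close>, because the values of a
  step function on the lines where a coordinate equals 1 are the entries with index
  \<open>2 ^ p\<close>.\<close>

definition mat01 :: "(nat \<Rightarrow> nat \<Rightarrow> real) \<Rightarrow> bool" where
  "mat01 A \<longleftrightarrow> (\<forall>a b. A a b \<in> {0..1} \<and> A a b = A b a)"

definition cell :: "nat \<Rightarrow> nat \<Rightarrow> real set" where
  "cell p a = {x \<in> {0..1}. idx p x = a}"

lemma power2_mult_le_iff: "2 ^ p * x \<le> 2 ^ p * y \<longleftrightarrow> x \<le> (y :: real)"
  by (simp add: mult_le_cancel_left_pos)

lemma idx_eq_iff: "0 \<le> x \<Longrightarrow> idx p x = a \<longleftrightarrow> real a \<le> 2 ^ p * x \<and> 2 ^ p * x < real a + 1"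
  unfolding idx_def by (auto simp: nat_eq_iff floor_eq_iff)

lemma idx_bounds: "0 \<le> x \<Longrightarrow> real (idx p x) \<le> 2 ^ p * x \<and> 2 ^ p * x < real (idx p x) + 1"
  using idx_eq_iff[of x p "idx p x"] by simp

lemma idx_less: "0 \<le> x \<Longrightarrow> x < 1 \<Longrightarrow> idx p x < 2 ^ p"
proof -
  assume "0 \<le> x" "x < 1"
  then have "2 ^ p * x < 2 ^ p" by simp
  then have "real (idx p x) < 2 ^ p"
    using idx_bounds[OF \<open>0 \<le> x\<close>] by (meson order_le_less_trans)
  then show ?thesis by (metis of_nat_less_iff of_nat_numeral of_nat_power)
qed

lemma idx_1: "idx p 1 = 2 ^ p"
  by (subst idx_eq_iff) auto

lemma idx_measurable [measurable]: "idx p \<in> I01 \<rightarrow>\<^sub>M count_space UNIV"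
  unfolding idx_def by (rule measurable_restrict_space1) measurable

lemma stepfun_measurable [measurable]: "stepfun p A \<in> borel_measurable sq"
proof -
  have "(\<lambda>q. idx p (fst q)) \<in> sq \<rightarrow>\<^sub>M count_space UNIV" "(\<lambda>q. idx p (snd q)) \<in> sq \<rightarrow>\<^sub>M count_space UNIV"
    by (rule measurable_compose[OF _ idx_measurable], simp)+
  then show ?thesis unfolding stepfun_def case_prod_beta' by measurable
qed

lemma borel_version_step: "mat01 A \<Longrightarrow> borel_version (step p A) (stepfun p A)"
  by (auto simp: borel_version_def step_def mat01_def stepfun_def split: prod.split intro!: AE_I2)

lemma step_W0: "mat01 A \<Longrightarrow> step p A \<in> W0"
  by (rule W0_I[OF borel_version_step]) (auto simp: step_def stepfun_def mat01_def)

lemma cell_sets [measurable]: "cell p a \<in> sets I01"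
proof -
  have "cell p a = idx p -` {a} \<inter> space I01" by (auto simp: cell_def)
  then show ?thesis using measurable_sets[OF idx_measurable, of "{a}" p] by simp
qed

lemma AE_I01_less_1: "AE x in I01. x < 1"
proof -
  have "AE x in lborel. x \<noteq> (1::real)" by (rule AE_lborel_singleton)
  then show ?thesis by (subst AE_restrict_space_iff) auto
qed

text \<open>Each cell is translated onto the cell that \<open>\<pi>\<close> assigns to it. The
  inverse has the same form, and step functions on the grid stay step functions on the grid. A
  permutation of the indices below \<open>2 ^ p\<close> fixes \<open>2 ^ p\<close>, hence the point
  1.\<close>

definition perm_map :: "nat \<Rightarrow> (nat \<Rightarrow> nat) \<Rightarrow> real \<Rightarrow> real" where
  "perm_map p \<pi> x = x + (real (\<pi> (idx p x)) - real (idx p x)) / 2 ^ p"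

lemma permutes_top: "\<pi> permutes {..<2 ^ p} \<Longrightarrow> \<pi> (2 ^ p) = (2 ^ p :: nat)"
  by (simp add: permutes_not_in)

lemma perm_map_mem:
  assumes \<pi>: "\<pi> permutes {..<2 ^ p}" and x: "x \<in> {0..1}"
  shows "perm_map p \<pi> x \<in> {0..1}" "idx p (perm_map p \<pi> x) = \<pi> (idx p x)"
proof -
  let ?a = "idx p x"
  have a: "real ?a \<le> 2 ^ p * x" "2 ^ p * x < real ?a + 1"
    using idx_bounds[of x p] x by auto
  have eq: "2 ^ p * perm_map p \<pi> x = 2 ^ p * x + real (\<pi> ?a) - real ?a"
    by (simp add: perm_map_def field_simps)
  then have b: "real (\<pi> ?a) \<le> 2 ^ p * perm_map p \<pi> x" "2 ^ p * perm_map p \<pi> x < real (\<pi> ?a) + 1"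
    using a by auto
  then have "2 ^ p * 0 \<le> 2 ^ p * perm_map p \<pi> x" by (metis mult_zero_right of_nat_0_le_iff order_trans)
  then have nn: "0 \<le> perm_map p \<pi> x" by (simp only: power2_mult_le_iff)
  show "idx p (perm_map p \<pi> x) = \<pi> ?a"
    using b nn by (simp add: idx_eq_iff)
  show "perm_map p \<pi> x \<in> {0..1}"
  proof (cases "x = 1")
    case True
    then show ?thesis using permutes_top[OF \<pi>] by (simp add: perm_map_def idx_1)
  next
    case False
    then have "?a < 2 ^ p" using x by (intro idx_less) auto
    then have "\<pi> ?a < 2 ^ p" using permutes_in_image[OF \<pi>, of ?a] by simp
    then have "real (\<pi> ?a) + 1 \<le> 2 ^ p"
      by (metis Suc_leI add.commute of_nat_Suc of_nat_le_iff of_nat_numeral of_nat_power)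
    with b(2) have "2 ^ p * perm_map p \<pi> x \<le> 2 ^ p * 1" by linarith
    then show ?thesis using nn unfolding power2_mult_le_iff by simp
  qed
qed

lemma perm_map_inverse:
  assumes \<pi>: "\<pi> permutes {..<2 ^ p}" and x: "x \<in> {0..1}"
  shows "perm_map p (inv \<pi>) (perm_map p \<pi> x) = x"
  unfolding perm_map_def[of p "inv \<pi>" "perm_map p \<pi> x"] perm_map_mem(2)[OF \<pi> x] permutes_inverses(2)[OF \<pi>]
  by (simp add: perm_map_def field_simps)

lemma perm_map_measurable: 
  assumes \<pi>: "\<pi> permutes {..<2 ^ p}"
  shows "perm_map p \<pi> \<in> I01 \<rightarrow>\<^sub>M I01"
proof (rule measurable_restrict_space2)
  show "perm_map p \<pi> \<in> space I01 \<rightarrow> {0..1}" using perm_map_mem(1)[OF \<pi>] by simp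
  have "(\<lambda>x. (real (\<pi> (idx p x)) - real (idx p x)) / 2 ^ p) \<in> borel_measurable I01"
    by (rule measurable_compose[OF idx_measurable]) simp
  then show "perm_map p \<pi> \<in> I01 \<rightarrow>\<^sub>M lborel"
    unfolding perm_map_def measurable_lborel1 by (intro borel_measurable_add I01_borel)
qed

lemma emeasure_I01: "B \<in> sets I01 \<Longrightarrow> emeasure I01 B = emeasure lborel B"
  using sets.sets_into_space[of B I01] by (subst emeasure_restrict_space) auto

lemma emeasure_lborel_shift:
  fixes B :: "real set"
  assumes "B \<in> sets borel"
  shows "emeasure lborel {x. x + d \<in> B} = emeasure lborel B"
proof -
  have "emeasure lborel B = emeasure (distr lborel borel ((+) d)) B"
    by (simp add: lborel_distr_plus)
  also have "\<dots> = emeasure lborel ((+) d -` B \<inter> space lborel)"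
    using assms by (intro emeasure_distr) auto
  finally show ?thesis by (simp add: vimage_def add.commute)
qed

lemma measure_preserving_perm_map:
  assumes \<pi>: "\<pi> permutes {..<2 ^ p}"
  shows "measure_preserving (perm_map p \<pi>)"
  unfolding measure_preserving_def
proof
  show m: "perm_map p \<pi> \<in> I01 \<rightarrow>\<^sub>M I01" by (rule perm_map_measurable[OF \<pi>])
  show "distr I01 I01 (perm_map p \<pi>) = I01"
  proof (rule measure_eqI)
    fix B assume "B \<in> sets (distr I01 I01 (perm_map p \<pi>))"
    then have B: "B \<in> sets I01" by simp
    let ?d = "\<lambda>a. (real (\<pi> a) - real a) / 2 ^ p"
    \<comment> \<open>The index \<open>2 ^ p\<close> is included: the cells must cover the whole
      interval, and the cell of the point 1 is mapped to itself.\<close>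
    let ?N = "{..2 ^ p}"
    have Bb: "B \<subseteq> {0..1}" using sets.sets_into_space[OF B] by simp
    have idx_le: "idx p x \<le> 2 ^ p" if "x \<in> {0..1}" for x
      using idx_less[of x p] idx_1[of p] that by (cases "x = 1") auto
    have part: "perm_map p \<pi> -` B \<inter> space I01 \<inter> cell p a = {x. x + ?d a \<in> B \<inter> cell p (\<pi> a)}" for a
    proof (intro set_eqI iffI)
      fix x assume "x \<in> perm_map p \<pi> -` B \<inter> space I01 \<inter> cell p a"
      then have "x \<in> {0..1}" "idx p x = a" "perm_map p \<pi> x \<in> B" by (auto simp: cell_def)
      then show "x \<in> {x. x + ?d a \<in> B \<inter> cell p (\<pi> a)}"
        using perm_map_mem[OF \<pi>, of x] by (auto simp: cell_def perm_map_def)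
    next
      fix x assume "x \<in> {x. x + ?d a \<in> B \<inter> cell p (\<pi> a)}"
      then have y: "x + ?d a \<in> B" "x + ?d a \<in> {0..1}" "idx p (x + ?d a) = \<pi> a" by (auto simp: cell_def)
      have "x = perm_map p (inv \<pi>) (x + ?d a)"
        using y(3) by (simp add: perm_map_def permutes_inverses[OF \<pi>] field_simps)
      then have "x \<in> {0..1}" "idx p x = a"
        using perm_map_mem[OF permutes_inv[OF \<pi>] y(2)] y(3) by (simp_all add: permutes_inverses[OF \<pi>])
      with y(1) show "x \<in> perm_map p \<pi> -` B \<inter> space I01 \<inter> cell p a"
        by (simp add: cell_def perm_map_def)
    qed
    have sum: "emeasure I01 X = (\<Sum>a\<in>?N. emeasure I01 (X \<inter> cell p a))" if X: "X \<in> sets I01" for X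
    proof -
      have "X = (\<Union>a\<in>?N. X \<inter> cell p a)"
        using sets.sets_into_space[OF X] idx_le by (auto simp: cell_def)
      then have "emeasure I01 X = emeasure I01 (\<Union>a\<in>?N. X \<inter> cell p a)" by simp
      also have "\<dots> = (\<Sum>a\<in>?N. emeasure I01 (X \<inter> cell p a))"
        using X by (intro sum_emeasure[symmetric]) (auto simp: disjoint_family_on_def, simp add: cell_def)
      finally show ?thesis .
    qed
    have pm: "perm_map p \<pi> -` B \<inter> space I01 \<in> sets I01" using m B by (rule measurable_sets)
    have "emeasure (distr I01 I01 (perm_map p \<pi>)) B = emeasure I01 (perm_map p \<pi> -` B \<inter> space I01)"
      using m B by (rule emeasure_distr)
    also have "\<dots> = (\<Sum>a\<in>?N. emeasure I01 (perm_map p \<pi> -` B \<inter> space I01 \<inter> cell p a))"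
      by (rule sum[OF pm])
    also have "\<dots> = (\<Sum>a\<in>?N. emeasure I01 (B \<inter> cell p (\<pi> a)))"
    proof (rule sum.cong[OF refl])
      fix a
      have "B \<inter> cell p (\<pi> a) \<in> sets I01" using B by auto
      then have bor: "B \<inter> cell p (\<pi> a) \<in> sets borel" by (auto simp: sets_restrict_space_iff)
      have "emeasure I01 (perm_map p \<pi> -` B \<inter> space I01 \<inter> cell p a) = 
          emeasure lborel (perm_map p \<pi> -` B \<inter> space I01 \<inter> cell p a)"
        using pm by (intro emeasure_I01) auto
      also have "\<dots> = emeasure lborel (B \<inter> cell p (\<pi> a))"
        unfolding part using bor by (rule emeasure_lborel_shift)
      also have "\<dots> = emeasure I01 (B \<inter> cell p (\<pi> a))"
        using B by (intro emeasure_I01[symmetric]) auto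
      finally show "emeasure I01 (perm_map p \<pi> -` B \<inter> space I01 \<inter> cell p a) = emeasure I01 (B \<inter> cell p (\<pi> a))" .
    qed
    also have "\<dots> = (\<Sum>a\<in>?N. emeasure I01 (B \<inter> cell p a))"
    proof -
      have "\<pi> permutes ?N" by (rule permutes_subset[OF \<pi>]) auto
      from sum.permute[OF this, of "\<lambda>a. emeasure I01 (B \<inter> cell p a)"]
      show ?thesis by (simp add: comp_def)
    qed
    also have "\<dots> = emeasure I01 B" by (rule sum[OF B, symmetric])
    finally show "emeasure (distr I01 I01 (perm_map p \<pi>)) B = emeasure I01 B" .
  qed simp
qed

lemma pullback_inverse:
  assumes \<pi>: "\<pi> permutes {..<2 ^ p}" and W: "W \<in> W0"
  shows "pullback (perm_map p (inv \<pi>)) (pullback (perm_map p \<pi>) W) = W"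
proof (rule extensionalityI)
  show "W \<in> extensional unit_square" by (rule W0_D(4)[OF W])
  fix q assume q: "q \<in> unit_square"
  note inv = perm_map_inverse[OF permutes_inv[OF \<pi>], unfolded permutes_inv_inv[OF \<pi>]]
  show "pullback (perm_map p (inv \<pi>)) (pullback (perm_map p \<pi>) W) q = W q"
    using q perm_map_mem(1)[OF permutes_inv[OF \<pi>]] inv by (auto simp: pullback_def)
qed (simp add: pullback_def)

lemma pullback_step:
  assumes "\<pi> permutes {..<2 ^ p}"
  shows "pullback (perm_map p \<pi>) (step p A) = step p (\<lambda>a b. A (\<pi> a) (\<pi> b))"
  using perm_map_mem[OF assms] by (auto simp: fun_eq_iff pullback_def step_def stepfun_def)

section \<open>Integrals of step functions over rectangles\<close>

lemma measure_cell:
  assumes "a < 2 ^ p"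
  shows "measure I01 (cell p a) = 1 / 2 ^ p"
proof -
  have a: "real a + 1 \<le> 2 ^ p"
    using assms by (metis Suc_leI add.commute of_nat_Suc of_nat_le_iff of_nat_numeral of_nat_power)
  have "cell p a = {real a / 2 ^ p..<(real a + 1) / 2 ^ p}"
  proof (intro set_eqI iffI)
    fix x assume "x \<in> {real a / 2 ^ p..<(real a + 1) / 2 ^ p}"
    then have x: "real a \<le> 2 ^ p * x" "2 ^ p * x < real a + 1"
      by (auto simp: field_simps)
    then have "2 ^ p * 0 \<le> 2 ^ p * x" "2 ^ p * x \<le> 2 ^ p * 1"
      using a by linarith+
    then have "x \<in> {0..1}" unfolding power2_mult_le_iff by simp
    then show "x \<in> cell p a" using x by (simp add: cell_def idx_eq_iff)
  next
    fix x assume "x \<in> cell p a"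
    then have "real a \<le> 2 ^ p * x" "2 ^ p * x < real a + 1" using idx_bounds[of x p] by (auto simp: cell_def)
    then show "x \<in> {real a / 2 ^ p..<(real a + 1) / 2 ^ p}" by (simp add: field_simps)
  qed
  moreover have "measure I01 (cell p a) = measure lborel (cell p a)"
    using emeasure_I01[OF cell_sets] by (simp add: measure_def)
  ultimately show ?thesis by (simp add: divide_simps)
qed

text \<open>Only almost everywhere, since the sums omit the index \<open>2 ^ p\<close> and so vanish
  where a coordinate is 1.\<close>

lemma stepfun_AE:
  "AE q in sq. stepfun p A q =
    (\<Sum>a<2 ^ p. \<Sum>b<2 ^ p. A a b * indicator (cell p a) (fst q) * indicator (cell p b) (snd q))"
  using AE_sq_fst[OF AE_I01_less_1] AE_sq_snd[OF AE_I01_less_1] AE_space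
proof eventually_elim
  case (elim q)
  obtain x y where q: "q = (x, y)" by fastforce
  have xy: "x \<in> {0..1}" "y \<in> {0..1}" "idx p x < 2 ^ p" "idx p y < 2 ^ p"
    using elim by (auto simp: q idx_less)
  have "(\<Sum>a<2 ^ p. \<Sum>b<2 ^ p. A a b * indicator (cell p a) x * indicator (cell p b) y) =
     (\<Sum>a<2 ^ p. if a = idx p x then (\<Sum>b<2 ^ p. if b = idx p y then A a b else 0) else 0)"
    using xy(1,2) by (intro sum.cong refl) (simp add: cell_def indicator_def if_distrib sum.neutral cong: if_cong)
  also have "\<dots> = A (idx p x) (idx p y)"
    using xy(3,4) by (simp add: sum.delta)
  finally show ?case by (simp add: q stepfun_def)
qed

lemma stepfun_integral:
  assumes S: "S \<in> sets I01" and T: "T \<in> sets I01"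
  shows "(LINT q|sq. stepfun p A q * indicator S (fst q) * indicator T (snd q)) =
    (\<Sum>a<2 ^ p. \<Sum>b<2 ^ p. A a b * measure I01 (S \<inter> cell p a) * measure I01 (T \<inter> cell p b))"
proof -
  let ?R = "\<lambda>a b. (S \<inter> cell p a) \<times> (T \<inter> cell p b)"
  have R: "?R a b \<in> sets sq" for a b using S T by auto
  have "(LINT q|sq. stepfun p A q * indicator S (fst q) * indicator T (snd q)) =
      (LINT q|sq. (\<Sum>a<2 ^ p. \<Sum>b<2 ^ p. A a b * indicator (?R a b) q))"
  proof (rule integral_cong_AE)
    show "(\<lambda>q. stepfun p A q * indicator S (fst q) * indicator T (snd q)) \<in> borel_measurable sq"
      using S T by measurable
    show "(\<lambda>q. \<Sum>a<2 ^ p. \<Sum>b<2 ^ p. A a b * indicator (?R a b) q) \<in> borel_measurable sq"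
      using R by (intro borel_measurable_sum borel_measurable_times borel_measurable_const borel_measurable_indicator)
    show "AE q in sq. stepfun p A q * indicator S (fst q) * indicator T (snd q) =
       (\<Sum>a<2 ^ p. \<Sum>b<2 ^ p. A a b * indicator (?R a b) q)"
      using stepfun_AE[of p A]
    proof eventually_elim
      case (elim q)
      show ?case unfolding elim sum_distrib_right
        by (intro sum.cong refl) (auto simp: indicator_def mem_Times_iff)
    qed
  qed
  also have "\<dots> = (\<Sum>a<2 ^ p. \<Sum>b<2 ^ p. A a b * measure sq (?R a b))"
  proof -
    have int: "integrable sq (\<lambda>q. A a b * indicator (?R a b) q)" for a b
      using R by (intro integrable_sq_bounded[where B="\<bar>A a b\<bar>"]) (auto split: split_indicator)
    have "measure sq (?R a b \<inter> space sq) = measure sq (?R a b)" for a b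
      using sets.sets_into_space[OF R, of a b] by (simp only: Int_absorb2)
    then have val: "(LINT q|sq. A a b * indicator (?R a b) q) = A a b * measure sq (?R a b)" for a b
      by (simp only: integral_mult_right_zero Bochner_Integration.integral_indicator)
    have "(LINT q|sq. (\<Sum>a<2 ^ p. \<Sum>b<2 ^ p. A a b * indicator (?R a b) q)) =
       (\<Sum>a<2 ^ p. (LINT q|sq. (\<Sum>b<2 ^ p. A a b * indicator (?R a b) q)))"
      by (intro Bochner_Integration.integral_sum Bochner_Integration.integrable_sum int)
    also have "\<dots> = (\<Sum>a<2 ^ p. \<Sum>b<2 ^ p. (LINT q|sq. A a b * indicator (?R a b) q))"
      by (intro sum.cong refl Bochner_Integration.integral_sum int)
    finally show ?thesis by (simp only: val)
  qed
  also have "\<dots> = (\<Sum>a<2 ^ p. \<Sum>b<2 ^ p. A a b * measure I01 (S \<inter> cell p a) * measure I01 (T \<inter> cell p b))"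
    using S T by (intro sum.cong refl) (auto simp: measure_def I01.emeasure_pair_measure_Times enn2real_mult)
  finally show ?thesis .
qed

text \<open>A linear form on weights in the unit interval is largest when exactly the indices with
  positive coefficient get weight 1. Applied to both variables and to both signs, this reduces all
  weights to 0 and 1; it is the discrete counterpart of \<open>cut_bound_bilinear\<close>.\<close>

lemma bilinear_weights:
  fixes A :: "'a \<Rightarrow> 'b \<Rightarrow> real"
  assumes fin: "finite I" "finite J"
    and bound: "\<And>S T. S \<subseteq> I \<Longrightarrow> T \<subseteq> J \<Longrightarrow> \<bar>\<Sum>a\<in>S. \<Sum>b\<in>T. A a b\<bar> \<le> c"
    and s: "\<And>a. a \<in> I \<Longrightarrow> s a \<in> {0..1}" and t: "\<And>b. b \<in> J \<Longrightarrow> t b \<in> {0..1}"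
  shows "\<bar>\<Sum>a\<in>I. \<Sum>b\<in>J. A a b * s a * t b\<bar> \<le> c"
proof -
  have one: "\<bar>\<Sum>a\<in>I. f a * s a\<bar> \<le> c" if "finite I" "\<And>S. S \<subseteq> I \<Longrightarrow> \<bar>\<Sum>a\<in>S. f a\<bar> \<le> c" "\<And>a. a \<in> I \<Longrightarrow> s a \<in> {0..1}"
    for f s :: "'c \<Rightarrow> real" and I
  proof -
    have up: "(\<Sum>a\<in>I. f a * s a) \<le> c" if *: "\<And>S. S \<subseteq> I \<Longrightarrow> (\<Sum>a\<in>S. f a) \<le> c" for f
    proof -
      have "(\<Sum>a\<in>I. f a * s a) \<le> (\<Sum>a\<in>I. if 0 < f a then f a else 0)"
        using \<open>\<And>a. a \<in> I \<Longrightarrow> s a \<in> {0..1}\<close>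
        by (intro sum_mono) (auto simp: mult_left_le mult_nonpos_nonneg)
      also have "\<dots> = (\<Sum>a\<in>{a \<in> I. 0 < f a}. f a)"
        using \<open>finite I\<close> by (simp add: sum.inter_filter)
      also have "\<dots> \<le> c" by (rule *) auto
      finally show ?thesis .
    qed
    have "(\<Sum>a\<in>I. f a * s a) \<le> c"
      using that(2) by (intro up) (meson abs_le_D1)
    moreover have "(\<Sum>a\<in>I. - f a * s a) \<le> c"
      using that(2) by (intro up) (metis abs_le_D2 sum_negf)
    ultimately show ?thesis by (simp add: sum_negf)
  qed
  have "\<bar>\<Sum>a\<in>I. (\<Sum>b\<in>J. A a b * t b) * s a\<bar> \<le> c"
  proof (rule one[OF fin(1) _ s])
    fix S assume S: "S \<subseteq> I"
    have "\<bar>\<Sum>b\<in>J. (\<Sum>a\<in>S. A a b) * t b\<bar> \<le> c"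
    proof (rule one[OF fin(2) _ t])
      fix T assume "T \<subseteq> J"
      then show "\<bar>\<Sum>b\<in>T. \<Sum>a\<in>S. A a b\<bar> \<le> c"
        using bound[OF S] by (subst sum.swap)
    qed
    also have "(\<Sum>b\<in>J. (\<Sum>a\<in>S. A a b) * t b) = (\<Sum>a\<in>S. \<Sum>b\<in>J. A a b * t b)"
      by (subst sum.swap) (simp add: sum_distrib_right)
    finally show "\<bar>\<Sum>a\<in>S. \<Sum>b\<in>J. A a b * t b\<bar> \<le> c" .
  qed
  also have "(\<Sum>a\<in>I. (\<Sum>b\<in>J. A a b * t b) * s a) = (\<Sum>a\<in>I. \<Sum>b\<in>J. A a b * s a * t b)"
    unfolding sum_distrib_right by (intro sum.cong refl) (simp add: mult_ac)
  finally show ?thesis .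
qed

text \<open>An arbitrary side \<open>S\<close> meets each cell in some fraction of its length. These
  fractions act as weights, and \<open>bilinear_weights\<close> reduces them to unions of whole
  cells. The factor \<open>4 ^ p\<close> is the number of squares of the grid.\<close>

lemma cut_bound_stepfun:
  assumes "\<And>S T. S \<subseteq> {..<2 ^ p} \<Longrightarrow> T \<subseteq> {..<2 ^ p} \<Longrightarrow> \<bar>\<Sum>a\<in>S. \<Sum>b\<in>T. A a b\<bar> \<le> c * 4 ^ p"
  shows "cut_bound (stepfun p A) c"
  unfolding cut_bound_def
proof (intro ballI)
  fix S T assume ST: "S \<in> sets I01" "T \<in> sets I01"
  define w where "w S a = 2 ^ p * measure I01 (S \<inter> cell p a)" for S a
  have w: "w S a \<in> {0..1}" if "a < 2 ^ p" for S a
  proof -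
    have "measure I01 (S \<inter> cell p a) \<le> measure I01 (cell p a)"
      by (intro I01.finite_measure_mono) auto
    then show ?thesis using measure_cell[OF that] by (simp add: w_def field_simps)
  qed
  have "(LINT q|sq. stepfun p A q * indicator S (fst q) * indicator T (snd q)) =
      (\<Sum>a<2 ^ p. \<Sum>b<2 ^ p. A a b * w S a * w T b) / 4 ^ p"
  proof -
    have four: "(4 :: real) ^ p = 2 ^ p * 2 ^ p" by (simp flip: power_mult_distrib)
    show ?thesis unfolding stepfun_integral[OF ST]
      by (simp add: w_def sum_divide_distrib four mult.assoc)
  qed
  moreover have "\<bar>\<Sum>a<2 ^ p. \<Sum>b<2 ^ p. A a b * w S a * w T b\<bar> \<le> c * 4 ^ p"
    by (intro bilinear_weights assms w) auto
  ultimately show "\<bar>LINT q|sq. stepfun p A q * indicator S (fst q) * indicator T (snd q)\<bar> \<le> c"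
    by (simp add: divide_le_eq)
qed

lemma stepfun_integral_total:
  "(LINT q|sq. stepfun p A q) = (\<Sum>a<2 ^ p. \<Sum>b<2 ^ p. A a b) / 4 ^ p"
proof -
  have top: "{0..1} \<in> sets I01" using sets.top[of I01] by simp
  have "(LINT q|sq. stepfun p A q) = (LINT q|sq. stepfun p A q * indicator {0..1} (fst q) * indicator {0..1} (snd q))"
    by (intro Bochner_Integration.integral_cong) auto
  also have "\<dots> = (\<Sum>a<2 ^ p. \<Sum>b<2 ^ p. A a b * (1 / 2 ^ p) * (1 / 2 ^ p))"
  proof -
    have "{0..1} \<inter> cell p a = cell p a" for a by (auto simp: cell_def)
    then show ?thesis unfolding stepfun_integral[OF top top]
      by (intro sum.cong refl) (simp add: measure_cell)
  qed
  also have "\<dots> = (\<Sum>a<2 ^ p. \<Sum>b<2 ^ p. A a b) / 4 ^ p"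
    by (simp add: sum_divide_distrib flip: power_mult_distrib)
  finally show ?thesis .
qed

section \<open>Approximation in L1 by continuous functions and by step functions\<close>

lemma AE_sq_swap:
  assumes "AE p in sq. P p"
  shows "AE p in sq. P (snd p, fst p)"
proof -
  have m: "(\<lambda>p. (snd p, fst p)) \<in> sq \<rightarrow>\<^sub>M sq" by measurable
  have "distr sq sq (\<lambda>p. (snd p, fst p)) = sq"
    using sq.distr_pair_swap by (simp add: case_prod_beta')
  then show ?thesis using AE_distrD[OF m, of P] assms by argo
qed

text \<open>A Lebesgue measurable function is an almost everywhere limit of continuous functions.
  Averaging these with their transposes and clamping keeps the limit and makes them symmetric with
  values in the unit interval; dominated convergence does the rest. The exceptional set
  \<open>N\<close> may be asymmetric, so both a point and its mirror image must avoid it.\<close>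

lemma W0_continuous_approx:
  assumes W: "W \<in> W0" and V: "borel_version W V" and e: "0 < e"
  obtains h where "continuous_on UNIV h" "\<And>p. h p \<in> {0..1}" "\<And>x y. h (x, y) = h (y, x)"
    "(LINT p|sq. \<bar>V p - h p\<bar>) < e"
proof -
  note [measurable] = V
  have us: "unit_square \<in> sets lebesgue" by (simp add: borel_closed closed_Times)
  have "W \<in> borel_measurable (lebesgue_on unit_square)" using W by (simp add: W0_def)
  then have "W measurable_on unit_square"
    using measurable_on_iff_borel_measurable[OF us] by blast
  then obtain N g where N: "negligible N" and g: "\<And>n. continuous_on UNIV (g n)"
    and lim: "\<And>p. p \<notin> N \<Longrightarrow> (\<lambda>n. g n p) \<longlonglongrightarrow> (if p \<in> unit_square then W p else 0)"
    unfolding measurable_on_def by blast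
  define h where "h n p = max 0 (min 1 ((g n p + g n (snd p, fst p)) / 2))" for n p
  have h_cont: "continuous_on UNIV (h n)" for n
  proof -
    have "continuous_on UNIV (\<lambda>p. g n (snd p, fst p))"
      by (rule continuous_on_compose2[OF g]) (auto intro!: continuous_intros)
    then show ?thesis unfolding h_def by (intro continuous_intros g) auto
  qed
  have h01: "h n p \<in> {0..1}" for n p by (simp add: h_def)
  have h_meas: "h n \<in> borel_measurable sq" for n
  proof -
    have "h n \<in> borel_measurable borel" using h_cont by (rule borel_measurable_continuous_onI)
    then show ?thesis unfolding sq_eq by (intro measurable_restrict_space1) simp
  qed
  have N_AE: "AE p in sq. p \<notin> N"
  proof -
    have "AE p in lebesgue. p \<notin> N"
      using N by (simp add: negligible_iff_null_sets AE_not_in)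
    then have "AE p in lebesgue_on unit_square. p \<notin> N"
      using us by (subst AE_restrict_space_iff) auto
    then show ?thesis unfolding lebesgue_on_unit_square AE_completion_iff .
  qed
  have "(\<lambda>n. LINT p|sq. \<bar>V p - h n p\<bar>) \<longlonglongrightarrow> (LINT p|sq. 0)"
  proof (rule integral_dominated_convergence[where w="\<lambda>_. 1"])
    show "(\<lambda>p. \<bar>V p - h i p\<bar>) \<in> borel_measurable sq" for i
      using h_meas by measurable
    show "AE p in sq. norm \<bar>V p - h i p\<bar> \<le> 1" for i
    proof (rule AE_I2)
      fix p show "norm \<bar>V p - h i p\<bar> \<le> 1"
        using borel_version_bounds[OF V, of p] h01[of i p] by auto
    qed
    show "AE p in sq. (\<lambda>n. \<bar>V p - h n p\<bar>) \<longlonglongrightarrow> 0"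
      using N_AE AE_sq_swap[OF N_AE] borel_version_AE[OF V] AE_space
    proof eventually_elim
      case (elim p)
      obtain x y where p: "p = (x, y)" by fastforce
      have xy: "x \<in> {0..1}" "y \<in> {0..1}" using elim by (auto simp: p)
      have "(\<lambda>n. g n p) \<longlonglongrightarrow> W p" "(\<lambda>n. g n (y, x)) \<longlonglongrightarrow> W p"
        using lim[of "(x, y)"] lim[of "(y, x)"] elim W0_D(3)[OF W xy] xy by (auto simp: p)
      then have "(\<lambda>n. \<bar>V p - max 0 (min 1 ((g n p + g n (y, x)) / 2))\<bar>) \<longlonglongrightarrow> \<bar>V p - max 0 (min 1 ((W p + W p) / 2))\<bar>"
        by (intro tendsto_intros) auto
      moreover have "\<bar>V p - max 0 (min 1 ((W p + W p) / 2))\<bar> = 0"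
        using elim(3) borel_version_bounds[OF V, of p] by simp
      ultimately show ?case by (simp add: h_def p)
    qed
  qed (auto simp: sq.P.integrable_const)
  then have "(\<lambda>n. LINT p|sq. \<bar>V p - h n p\<bar>) \<longlonglongrightarrow> 0" by simp
  from order_tendstoD(2)[OF this e] obtain n where "(LINT p|sq. \<bar>V p - h n p\<bar>) < e"
    by (auto simp: eventually_sequentially)
  moreover have "h n (x, y) = h n (y, x)" for x y by (simp add: h_def add.commute)
  ultimately show ?thesis using that[of "h n"] h_cont h01 by blast
qed

text \<open>By uniform continuity, the continuous approximation is close to the step function of its
  values at the corners of the cells. All large \<open>p\<close> are offered so that
  \<open>graphon_compactness\<close> can take for \<open>W n\<close> a grid at least as fine as
  \<open>n\<close>.\<close>

lemma step_approx:
  assumes W: "W \<in> W0" and e: "0 < e"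
  shows "\<exists>p0. \<forall>p\<ge>p0. \<exists>A. mat01 A \<and> fun_dist W (step p A) < e"
proof -
  obtain V where V: "borel_version W V" using borel_version_exists[OF W] .
  note [measurable] = V
  obtain h where h: "continuous_on UNIV h" "\<And>p. h p \<in> {0..1}" "\<And>x y. h (x, y) = h (y, x)"
    "(LINT p|sq. \<bar>V p - h p\<bar>) < e / 2"
    using W0_continuous_approx[OF W V, of "e / 2"] e by auto
  have h_meas [measurable]: "h \<in> borel_measurable sq"
  proof -
    have "h \<in> borel_measurable borel" using h(1) by (rule borel_measurable_continuous_onI)
    then show ?thesis unfolding sq_eq by (intro measurable_restrict_space1) simp
  qed
  have "uniformly_continuous_on unit_square h"
    using h(1) by (intro compact_uniformly_continuous compact_Times compact_Icc) (auto intro: continuous_on_subset)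
  then obtain d where d: "d > 0" "\<And>p q. p \<in> unit_square \<Longrightarrow> q \<in> unit_square \<Longrightarrow> dist q p < d \<Longrightarrow> dist (h q) (h p) < e / 2"
    unfolding uniformly_continuous_on_def using e by (metis half_gt_zero)
  \<comment> \<open>Passing to the corner moves each of the two coordinates by at most
    \<open>(1 / 2) ^ p\<close>.\<close>
  obtain p0 where p0: "(1 / 2) ^ p0 < d / 2" using real_arch_pow_inv[of "d / 2" "1 / 2"] d(1) by auto
  show ?thesis
  proof (intro exI[of _ p0] allI impI)
    fix p assume p: "p0 \<le> p"
    define A where "A a b = h (real a / 2 ^ p, real b / 2 ^ p)" for a b
    have A: "mat01 A" using h(2,3) by (auto simp: mat01_def A_def)
    have close: "\<bar>h q - stepfun p A q\<bar> \<le> e / 2" if q: "q \<in> unit_square" for q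
    proof -
      obtain x y where xy: "q = (x, y)" "x \<in> {0..1}" "y \<in> {0..1}" using q by auto
      have *: "real (idx p z) / 2 ^ p \<in> {0..1} \<and> dist z (real (idx p z) / 2 ^ p) \<le> (1 / 2) ^ p" if "z \<in> {0..1}" for z
      proof -
        have b: "real (idx p z) \<le> 2 ^ p * z" "2 ^ p * z < real (idx p z) + 1" using idx_bounds[of z p] that by auto
        then have b2: "real (idx p z) / 2 ^ p \<le> z" "z \<le> real (idx p z) / 2 ^ p + 1 / 2 ^ p"
          by (simp_all add: field_simps)
        have "0 \<le> real (idx p z) / 2 ^ p" by simp
        moreover have "real (idx p z) / 2 ^ p \<le> 1" using b2(1) that by (meson atLeastAtMost_iff order_trans)
        ultimately show ?thesis using b2 that by (auto simp: dist_real_def power_one_over)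
      qed
      have "dist q (real (idx p x) / 2 ^ p, real (idx p y) / 2 ^ p) \<le> dist x (real (idx p x) / 2 ^ p) + dist y (real (idx p y) / 2 ^ p)"
        unfolding xy(1) dist_Pair_Pair by (rule sqrt_sum_squares_le_sum) auto
      also have "\<dots> \<le> 2 * (1 / 2) ^ p" using *[OF xy(2)] *[OF xy(3)] by simp
      also have "\<dots> \<le> 2 * (1 / 2) ^ p0" using p by (intro mult_left_mono power_decreasing) auto
      also have "\<dots> < d" using p0 by simp
      finally have "dist (h q) (h (real (idx p x) / 2 ^ p, real (idx p y) / 2 ^ p)) < e / 2"
        using q *[OF xy(2)] *[OF xy(3)] by (intro d(2)) auto
      then show ?thesis by (simp add: xy(1) stepfun_def A_def dist_real_def)
    qed
    have int: "integrable sq (\<lambda>q. \<bar>V q - h q\<bar>)" "integrable sq (\<lambda>q. \<bar>V q - stepfun p A q\<bar>)"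
    proof -
      have "\<bar>V q - h q\<bar> \<le> 1" for q using borel_version_bounds[OF V, of q] h(2)[of q] by auto
      then show "integrable sq (\<lambda>q. \<bar>V q - h q\<bar>)" by (intro integrable_sq_bounded[where B=1]) auto
      show "integrable sq (\<lambda>q. \<bar>V q - stepfun p A q\<bar>)"
        using borel_version_diff_integrable[OF V borel_version_step[OF A]] by (rule integrable_abs)
    qed
    have "fun_dist W (step p A) = (LINT q|sq. \<bar>V q - stepfun p A q\<bar>)"
      by (rule fun_dist_borel_version[OF V borel_version_step[OF A]])
    also have "\<dots> \<le> (LINT q|sq. \<bar>V q - h q\<bar> + e / 2)"
    proof (rule integral_mono[OF int(2)])
      show "integrable sq (\<lambda>q. \<bar>V q - h q\<bar> + e / 2)"
        by (rule Bochner_Integration.integrable_add[OF int(1) sq.P.integrable_const])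
      fix q assume "q \<in> space sq"
      then have "\<bar>h q - stepfun p A q\<bar> \<le> e / 2" using close[of q] by (simp only: space_sq)
      then show "\<bar>V q - stepfun p A q\<bar> \<le> \<bar>V q - h q\<bar> + e / 2" by linarith
    qed
    also have "\<dots> = (LINT q|sq. \<bar>V q - h q\<bar>) + e / 2"
      using int sq.P.prob_space by (subst Bochner_Integration.integral_add) auto
    also have "\<dots> < e" using h(4) by simp
    finally show "\<exists>A. mat01 A \<and> fun_dist W (step p A) < e" using A by blast
  qed
qed

subsection \<open>Weak regularity and sorting\<close>

definition rect_sum :: "(nat \<Rightarrow> nat \<Rightarrow> real) \<Rightarrow> nat set \<Rightarrow> nat set \<Rightarrow> real" where
  "rect_sum A S T = (\<Sum>a\<in>S. \<Sum>b\<in>T. A a b)"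

lemma rect_sum_indicator:
  assumes "S \<subseteq> {..<N}" "T \<subseteq> {..<N}"
  shows "rect_sum X S T = (\<Sum>a<N. \<Sum>b<N. X a b * indicator S a * indicator T b)"
proof -
  have "rect_sum X S T = (\<Sum>a\<in>S. \<Sum>b\<in>T. X a b * indicator S a * indicator T b)"
    unfolding rect_sum_def by (intro sum.cong refl) simp
  also have "\<dots> = (\<Sum>a\<in>S. \<Sum>b<N. X a b * indicator S a * indicator T b)"
    using assms by (intro sum.cong refl sum.mono_neutral_left) auto
  also have "\<dots> = (\<Sum>a<N. \<Sum>b<N. X a b * indicator S a * indicator T b)"
    using assms by (intro sum.mono_neutral_left) auto
  finally show ?thesis .
qed

text \<open>Expanding the square, the cross term contributes \<open>- 2 * c * (c * N ^ 2)\<close>,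
  while the new square contributes \<open>c ^ 2\<close> times the area of the rectangle, at most
  \<open>c ^ 2 * N ^ 2\<close>. Normalising \<open>c\<close> by \<open>N ^ 2\<close> and not by the
  area makes the gain exactly the square of the normalised rectangle sum.\<close>

lemma rect_sum_step:
  fixes D :: "nat \<Rightarrow> nat \<Rightarrow> real"
  assumes N: "0 < N" and ST: "S \<subseteq> {..<N}" "T \<subseteq> {..<N}"
    and c: "c = rect_sum D S T / real N ^ 2"
  shows "(\<Sum>a<N. \<Sum>b<N. (D a b - c * indicator S a * indicator T b)\<^sup>2) / real N ^ 2 \<le>
    (\<Sum>a<N. \<Sum>b<N. (D a b)\<^sup>2) / real N ^ 2 - c\<^sup>2"
proof -
  have fin: "finite S" "finite T" using ST by (auto intro: finite_subset)
  note r = rect_sum_indicator[OF ST, of D]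
  have s: "(\<Sum>a<N. \<Sum>b<N. indicator S a * indicator T b) = real (card S) * real (card T)"
    using rect_sum_indicator[OF ST, of "\<lambda>_ _. 1"] by (simp add: rect_sum_def)
  have card: "real (card S) * real (card T) \<le> real N ^ 2"
    using card_mono[OF _ ST(1)] card_mono[OF _ ST(2)] by (simp add: power2_eq_square mult_mono)
  have "(\<Sum>a<N. \<Sum>b<N. (D a b - c * indicator S a * indicator T b)\<^sup>2) =
     (\<Sum>a<N. \<Sum>b<N. (D a b)\<^sup>2 - 2 * c * (D a b * indicator S a * indicator T b) + c\<^sup>2 * (indicator S a * indicator T b))"
    by (intro sum.cong refl) (auto simp: power2_eq_square algebra_simps split: split_indicator)
  also have "\<dots> = (\<Sum>a<N. \<Sum>b<N. (D a b)\<^sup>2) - 2 * c * rect_sum D S T + c\<^sup>2 * (real (card S) * real (card T))"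
  proof -
    have gen: "(\<Sum>a<N. \<Sum>b<N. x a b - k * y a b + k' * z a b) =
      (\<Sum>a<N. \<Sum>b<N. x a b) - k * (\<Sum>a<N. \<Sum>b<N. y a b) + k' * (\<Sum>a<N. \<Sum>b<N. z a b)"
      for x y z :: "nat \<Rightarrow> nat \<Rightarrow> real" and k k'
      by (simp add: sum.distrib sum_subtractf sum_distrib_left)
    show ?thesis unfolding gen r s ..
  qed
  also have "\<dots> \<le> (\<Sum>a<N. \<Sum>b<N. (D a b)\<^sup>2) - 2 * c * (c * real N ^ 2) + c\<^sup>2 * real N ^ 2"
    using N card by (simp add: c mult_left_mono)
  also have "\<dots> = (\<Sum>a<N. \<Sum>b<N. (D a b)\<^sup>2) - c\<^sup>2 * real N ^ 2"
    by (simp add: power2_eq_square algebra_simps)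
  finally show ?thesis
    using N divide_right_mono[of _ _ "(real N)\<^sup>2"] by (fastforce simp: diff_divide_distrib)
qed

text \<open>
  The greedy form of the Frieze--Kannan weak regularity lemma: one sequence of rectangles serves all
  precisions at once, so that sorting by it handles all of them simultaneously.
\<close>

lemma greedy_regularity:
  assumes N: "0 < N" and A: "\<And>a b. A a b \<in> {0..1}"
  obtains S T :: "nat \<Rightarrow> nat set" and c :: "nat \<Rightarrow> real" where
    "\<And>l. \<bar>c l\<bar> \<le> 1"
    "\<And>m. 0 < m \<Longrightarrow> \<exists>l<m. \<forall>S' T'. S' \<subseteq> {..<N} \<longrightarrow> T' \<subseteq> {..<N} \<longrightarrow>
       \<bar>rect_sum (\<lambda>a b. A a b - (\<Sum>i<l. c i * indicator (S i) a * indicator (T i) b)) S' T'\<bar> \<le> real N ^ 2 / sqrt (real m)"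
proof -
  define best where "best D ST \<longleftrightarrow> fst ST \<subseteq> {..<N} \<and> snd ST \<subseteq> {..<N} \<and>
    (\<forall>S' T'. S' \<subseteq> {..<N} \<longrightarrow> T' \<subseteq> {..<N} \<longrightarrow> \<bar>rect_sum D S' T'\<bar> \<le> \<bar>rect_sum D (fst ST) (snd ST)\<bar>)"
    for D :: "nat \<Rightarrow> nat \<Rightarrow> real" and ST :: "nat set \<times> nat set"
  have "\<exists>ST. best D ST" for D
  proof -
    let ?X = "Pow {..<N} \<times> Pow {..<N}"
    let ?f = "\<lambda>ST. \<bar>rect_sum D (fst ST) (snd ST)\<bar>"
    have fin: "finite (?f ` ?X)" "?f ` ?X \<noteq> {}" by auto
    obtain ST where ST: "ST \<in> ?X" "?f ST = Max (?f ` ?X)" using Max_in[OF fin] by auto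
    have "\<bar>rect_sum D S' T'\<bar> \<le> ?f ST" if "S' \<subseteq> {..<N}" "T' \<subseteq> {..<N}" for S' T'
      unfolding ST(2) using that by (intro Max_ge[OF fin(1)]) force
    then show ?thesis using ST(1) by (intro exI[of _ ST]) (auto simp: best_def)
  qed
  then obtain B where B: "best D (B D)" for D by metis
  define C where "C D = rect_sum D (fst (B D)) (snd (B D)) / real N ^ 2" for D
  define R where "R D = (\<lambda>a b. D a b - C D * indicator (fst (B D)) a * indicator (snd (B D)) b)" for D
  define D where "D l = (R ^^ l) A" for l
  define S where "S l = fst (B (D l))" for l
  define T where "T l = snd (B (D l))" for l
  define c where "c l = C (D l)" for l
  have D_Suc: "D (Suc l) = (\<lambda>a b. D l a b - c l * indicator (S l) a * indicator (T l) b)" for l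
    by (simp add: D_def c_def S_def T_def R_def)
  have D_eq: "D l = (\<lambda>a b. A a b - (\<Sum>i<l. c i * indicator (S i) a * indicator (T i) b))" for l
  proof (induction l)
    case (Suc l)
    then show ?case by (simp add: D_Suc fun_eq_iff)
  qed (simp add: D_def)
  have ST: "S l \<subseteq> {..<N}" "T l \<subseteq> {..<N}" for l
    using B[of "D l"] by (auto simp: best_def S_def T_def)
  define en where "en l = (\<Sum>a<N. \<Sum>b<N. (D l a b)\<^sup>2) / real N ^ 2" for l
  have en_Suc: "en (Suc l) \<le> en l - (c l)\<^sup>2" for l
    unfolding en_def D_Suc by (rule rect_sum_step[OF N ST]) (simp add: c_def C_def S_def T_def)
  have en_nonneg: "0 \<le> en l" for l by (simp add: en_def sum_nonneg)
  have en_0: "en 0 \<le> 1"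
  proof -
    have "(A a b)\<^sup>2 \<le> 1" for a b using A[of a b] by (simp add: power_le_one)
    then have "(\<Sum>a<N. \<Sum>b<N. (A a b)\<^sup>2) \<le> (\<Sum>a<N. \<Sum>b<N. 1)" by (intro sum_mono) auto
    then show ?thesis using N by (simp add: en_def D_def divide_le_eq power2_eq_square)
  qed
  have c_sum: "(\<Sum>i<l. (c i)\<^sup>2) \<le> 1 - en l" for l
  proof (induction l)
    case (Suc l)
    then show ?case using en_Suc[of l] by simp
  qed (use en_0 in simp)
  have c_sum1: "(\<Sum>i<l. (c i)\<^sup>2) \<le> 1" for l using c_sum[of l] en_nonneg[of l] by simp
  show ?thesis
  proof
    show "\<bar>c l\<bar> \<le> 1" for l
    proof -
      have "(c l)\<^sup>2 \<le> (\<Sum>i<Suc l. (c i)\<^sup>2)" by (simp add: sum_nonneg)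
      also have "\<dots> \<le> 1" by (rule c_sum1)
      finally show ?thesis by (simp only: abs_square_le_1)
    qed
    fix m :: nat assume m: "0 < m"
    \<comment> \<open>The squared coefficients add up to at most the initial energy, hence to at
      most 1, so one of the first \<open>m\<close> is at most \<open>1 / m\<close>. At that moment
      even the best rectangle has a small sum, and so has every other.\<close>
    have "\<exists>l<m. (c l)\<^sup>2 \<le> 1 / m"
    proof (rule ccontr)
      assume "\<not> (\<exists>l<m. (c l)\<^sup>2 \<le> 1 / m)"
      then have "(\<Sum>l<m. 1 / real m) < (\<Sum>l<m. (c l)\<^sup>2)" using m by (intro sum_strict_mono) auto
      then show False using c_sum1[of m] m by simp
    qed
    then obtain l where l: "l < m" "(c l)\<^sup>2 \<le> 1 / m" by blast
    have "\<bar>c l\<bar> \<le> 1 / sqrt (real m)"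
      using real_sqrt_le_mono[OF l(2)] by (simp add: real_sqrt_divide)
    then have "\<bar>rect_sum (D l) (S l) (T l)\<bar> \<le> real N ^ 2 / sqrt (real m)"
      using N by (simp add: c_def C_def S_def T_def abs_divide divide_le_eq)
    moreover have "\<bar>rect_sum (D l) S' T'\<bar> \<le> \<bar>rect_sum (D l) (S l) (T l)\<bar>" if "S' \<subseteq> {..<N}" "T' \<subseteq> {..<N}" for S' T'
      using B[of "D l"] that by (simp add: best_def S_def T_def)
    ultimately have "\<forall>S' T'. S' \<subseteq> {..<N} \<longrightarrow> T' \<subseteq> {..<N} \<longrightarrow> \<bar>rect_sum (D l) S' T'\<bar> \<le> real N ^ 2 / sqrt (real m)"
      by (meson order_trans)
    then show "\<exists>l<m. \<forall>S' T'. S' \<subseteq> {..<N} \<longrightarrow> T' \<subseteq> {..<N} \<longrightarrow>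
       \<bar>rect_sum (\<lambda>a b. A a b - (\<Sum>i<l. c i * indicator (S i) a * indicator (T i) b)) S' T'\<bar> \<le> real N ^ 2 / sqrt (real m)"
      using l(1) unfolding D_eq by blast
  qed
qed

text \<open>The binary number that records membership in \<open>Q 0\<close>, \<open>Q 1\<close> and
  so on, the first set giving the leading bit. Sorting by it is sorting lexicographically, and every
  shorter code is a quotient of the longer ones.\<close>

fun code :: "(nat \<Rightarrow> nat set) \<Rightarrow> nat \<Rightarrow> nat \<Rightarrow> nat" where
  "code Q 0 v = 0"
| "code Q (Suc l) v = 2 * code Q l v + (if v \<in> Q l then 1 else 0)"

lemma code_less: "code Q l v < 2 ^ l"
  by (induction l) auto

lemma code_prefix: "code Q l v = code Q (l + d) v div 2 ^ d"
proof (induction d)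
  case (Suc d)
  have "code Q (l + Suc d) v div 2 ^ Suc d = code Q (l + Suc d) v div 2 div 2 ^ d"
    by (simp add: div_mult2_eq)
  also have "code Q (l + Suc d) v div 2 = code Q (l + d) v" by simp
  finally show ?case using Suc by simp
qed simp

lemma sort_permutation:
  fixes \<kappa> :: "nat \<Rightarrow> nat"
  obtains \<pi> where "\<pi> permutes {..<N}" "mono_on {..<N} (\<kappa> \<circ> \<pi>)"
proof -
  define xs where "xs = sort_key \<kappa> [0..<N]"
  have xs: "length xs = N" "set xs = {..<N}" "distinct xs" "sorted (map \<kappa> xs)"
    by (auto simp: xs_def)
  define \<pi> where "\<pi> a = (if a < N then xs ! a else a)" for a
  have "bij_betw (\<lambda>a. xs ! a) {..<N} {..<N}"
    using xs by (intro bij_betw_nth) auto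
  then have "bij_betw \<pi> {..<N} {..<N}"
    by (rule bij_betw_cong[THEN iffD1, rotated]) (simp add: \<pi>_def)
  then have "\<pi> permutes {..<N}"
    by (rule bij_imp_permutes) (simp add: \<pi>_def)
  moreover have "mono_on {..<N} (\<kappa> \<circ> \<pi>)"
    using xs sorted_nth_mono[OF xs(4)] by (auto simp: mono_on_def \<pi>_def)
  ultimately show ?thesis by (rule that)
qed

text \<open>After sorting by the full code, the code \<open>g\<close> of the first
  \<open>l + 1\<close> sets is still monotone, being a quotient of it by a power of 2. It has fewer
  than \<open>2 ^ Suc l\<close> jumps, and its last bit tells membership in \<open>Q l\<close>. So
  the rearranged \<open>Q l\<close> is a union of few intervals, whatever \<open>L\<close>
  is.\<close>

lemma sort_sets:
  fixes Q :: "nat \<Rightarrow> nat set"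
  obtains \<pi> where "\<pi> permutes {..<N}"
    "\<And>l. l < L \<Longrightarrow> \<exists>g :: nat \<Rightarrow> nat. mono_on {..<N} g \<and> (\<forall>a. g a < 2 ^ Suc l) \<and> (\<forall>a. \<pi> a \<in> Q l \<longleftrightarrow> odd (g a))"
proof -
  obtain \<pi> where \<pi>: "\<pi> permutes {..<N}" "mono_on {..<N} (code Q L \<circ> \<pi>)"
    by (rule sort_permutation)
  have "\<exists>g :: nat \<Rightarrow> nat. mono_on {..<N} g \<and> (\<forall>a. g a < 2 ^ Suc l) \<and> (\<forall>a. \<pi> a \<in> Q l \<longleftrightarrow> odd (g a))" if l: "l < L" for l
  proof (intro exI[of _ "\<lambda>a. code Q (Suc l) (\<pi> a)"] conjI allI)
    have eq: "code Q (Suc l) v = code Q L v div 2 ^ (L - Suc l)" for v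
      using code_prefix[of Q "Suc l" v "L - Suc l"] l by simp
    show "mono_on {..<N} (\<lambda>a. code Q (Suc l) (\<pi> a))"
      unfolding eq using \<pi>(2) by (auto simp: mono_on_def div_le_mono)
    show "code Q (Suc l) (\<pi> a) < 2 ^ Suc l" for a by (rule code_less)
    show "\<pi> a \<in> Q l \<longleftrightarrow> odd (code Q (Suc l) (\<pi> a))" for a by simp
  qed
  with \<pi>(1) show ?thesis by (rule that)
qed

section \<open>Averages of a matrix over square blocks\<close>

definition block_avg :: "nat \<Rightarrow> (nat \<Rightarrow> nat \<Rightarrow> real) \<Rightarrow> nat \<Rightarrow> nat \<Rightarrow> real" where
  "block_avg q A a b = (\<Sum>i<q. \<Sum>j<q. A (a * q + i) (b * q + j)) / real q ^ 2"

lemma sum_blocks: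
  fixes f :: "nat \<Rightarrow> 'a :: comm_monoid_add"
  shows "(\<Sum>a<M * q. f a) = (\<Sum>\<alpha><M. \<Sum>i<q. f (\<alpha> * q + i))"
proof (induction M)
  case (Suc M)
  have "(\<Sum>a<Suc M * q. f a) = (\<Sum>a<M * q. f a) + (\<Sum>a=M * q..<M * q + q. f a)"
    using sum.atLeastLessThan_concat[of 0 "M * q" "M * q + q" f] by (simp add: atLeast0LessThan add.commute)
  also have "(\<Sum>a=M * q..<M * q + q. f a) = (\<Sum>i<q. f (M * q + i))"
    using sum.shift_bounds_nat_ivl[of f 0 "M * q" q] by (simp add: atLeast0LessThan add.commute)
  finally show ?case using Suc by simp
qed simp

lemma block_avg_bounds:
  assumes "\<And>a b. A a b \<in> {0..1}"
  shows "block_avg q A a b \<in> {0..1}"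
proof -
  have "(\<Sum>i<q. \<Sum>j<q. A (a * q + i) (b * q + j)) \<le> (\<Sum>i<q. \<Sum>j<q. 1)"
    using assms by (intro sum_mono) auto
  moreover have "0 \<le> (\<Sum>i<q. \<Sum>j<q. A (a * q + i) (b * q + j))"
    using assms by (intro sum_nonneg) auto
  ultimately show ?thesis by (auto simp: block_avg_def divide_le_eq power2_eq_square)
qed

lemma block_avg_mat01: "mat01 A \<Longrightarrow> mat01 (block_avg q A)"
  unfolding mat01_def using block_avg_bounds[of A q]
  by (auto simp: block_avg_def) (subst sum.swap, simp)

lemma block_avg_diff:
  "block_avg q (\<lambda>a b. X a b - Y a b) a b = block_avg q X a b - block_avg q Y a b"
  by (simp add: block_avg_def sum_subtractf diff_divide_distrib)

lemma block_avg_sum: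
  "block_avg q (\<lambda>a b. \<Sum>l\<in>I. X l a b) a b = (\<Sum>l\<in>I. block_avg q (X l) a b)"
proof -
  have "(\<Sum>i<q. \<Sum>j<q. \<Sum>l\<in>I. X l (a * q + i) (b * q + j)) = (\<Sum>l\<in>I. \<Sum>i<q. \<Sum>j<q. X l (a * q + i) (b * q + j))"
    by (subst sum.swap[of _ I], intro sum.cong refl sum.swap)
  then show ?thesis by (simp add: block_avg_def sum_divide_distrib)
qed

lemma block_avg_cmult: "block_avg q (\<lambda>a b. c * X a b) a b = c * block_avg q X a b"
  by (simp add: block_avg_def sum_distrib_left)

lemma block_avg_block_avg:
  "block_avg q (block_avg r A) a b = block_avg (q * r) A a b"
proof -
  have "(\<Sum>i<q * r. \<Sum>j<q * r. A (a * (q * r) + i) (b * (q * r) + j)) =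
     (\<Sum>i<q. \<Sum>i'<r. \<Sum>j<q. \<Sum>j'<r. A ((a * q + i) * r + i') ((b * q + j) * r + j'))"
    by (simp add: sum_blocks algebra_simps)
  also have "\<dots> = (\<Sum>i<q. \<Sum>j<q. \<Sum>i'<r. \<Sum>j'<r. A ((a * q + i) * r + i') ((b * q + j) * r + j'))"
    by (intro sum.cong refl sum.swap)
  finally show ?thesis
    by (simp add: block_avg_def sum_divide_distrib[symmetric] power_mult_distrib mult.commute)
qed

lemma mod_block: "0 < q \<Longrightarrow> (a::nat) div q * q + a mod q = a"
  by simp

text \<open>Averaging can be moved from the matrix to the rectangle: summing the averaged matrix
  over \<open>S\<close> and \<open>T\<close> is summing \<open>A\<close> itself with weights
  \<open>w\<close>, the fraction of each block that lies in the side. Such weights reduce to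
  rectangles by \<open>bilinear_weights\<close>, so averaging does not increase the cut
  norm.\<close>

lemma rect_sum_blowup:
  assumes q: "0 < q" and S: "S \<subseteq> {..<M * q}" and T: "T \<subseteq> {..<M * q}"
    and bound: "\<And>S T. S \<subseteq> {..<M * q} \<Longrightarrow> T \<subseteq> {..<M * q} \<Longrightarrow> \<bar>rect_sum A S T\<bar> \<le> c"
  shows "\<bar>rect_sum (\<lambda>a b. block_avg q A (a div q) (b div q)) S T\<bar> \<le> c"
proof -
  define w where "w S a = real (card (S \<inter> {b. b div q = a div q})) / q" for S a
  note ind = rect_sum_indicator[OF S T]
  have card_w: "(\<Sum>i<q. indicator S (\<alpha> * q + i)) = real q * w S (\<alpha> * q + k)" if "k < q" for S :: "nat set" and \<alpha> k
  proof -
    have "S \<inter> {b. b div q = \<alpha>} = (\<lambda>i. \<alpha> * q + i) ` {i. i < q \<and> \<alpha> * q + i \<in> S}"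
    proof (intro set_eqI iffI)
      fix b assume "b \<in> S \<inter> {b. b div q = \<alpha>}"
      then have "b = \<alpha> * q + b mod q" "b mod q < q" "b \<in> S" using q mod_block[OF q, of b] by auto
      then show "b \<in> (\<lambda>i. \<alpha> * q + i) ` {i. i < q \<and> \<alpha> * q + i \<in> S}"
        by (intro image_eqI[of _ _ "b mod q"]) auto
    qed auto
    then have "card (S \<inter> {b. b div q = \<alpha>}) = card {i. i < q \<and> \<alpha> * q + i \<in> S}"
      by (simp add: card_image inj_on_def)
    moreover have "(\<Sum>i<q. indicator S (\<alpha> * q + i)) = real (card {i. i < q \<and> \<alpha> * q + i \<in> S})"
      by (simp add: indicator_def sum.If_cases Int_def lessThan_def)
    ultimately show ?thesis using q that by (simp add: w_def)
  qed
  have w01: "w S a \<in> {0..1}" for S a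
  proof -
    have "S \<inter> {b. b div q = a div q} \<subseteq> (\<lambda>i. a div q * q + i) ` {..<q}"
    proof
      fix b assume "b \<in> S \<inter> {b. b div q = a div q}"
      then have "b = a div q * q + b mod q" "b mod q < q" using q mod_block[OF q, of b] by auto
      then show "b \<in> (\<lambda>i. a div q * q + i) ` {..<q}"
        by (intro image_eqI[of _ _ "b mod q"]) auto
    qed
    from card_mono[OF _ this] have "card (S \<inter> {b. b div q = a div q}) \<le> q"
      by (simp add: card_image inj_on_def)
    then show ?thesis using q by (simp add: w_def)
  qed
  have "rect_sum (\<lambda>a b. block_avg q A (a div q) (b div q)) S T =
     (\<Sum>\<alpha><M. \<Sum>\<beta><M. \<Sum>i<q. \<Sum>j<q. block_avg q A \<alpha> \<beta> * indicator S (\<alpha> * q + i) * indicator T (\<beta> * q + j))"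
  proof -
    have "rect_sum (\<lambda>a b. block_avg q A (a div q) (b div q)) S T =
      (\<Sum>\<alpha><M. \<Sum>i<q. \<Sum>\<beta><M. \<Sum>j<q. block_avg q A \<alpha> \<beta> * indicator S (\<alpha> * q + i) * indicator T (\<beta> * q + j))"
      unfolding ind sum_blocks by (intro sum.cong refl) simp
    then show ?thesis by (simp only: sum.swap[of _ "{..<M}" "{..<q}"])
  qed
  also have "\<dots> = (\<Sum>\<alpha><M. \<Sum>\<beta><M. block_avg q A \<alpha> \<beta> * (\<Sum>i<q. indicator S (\<alpha> * q + i)) * (\<Sum>j<q. indicator T (\<beta> * q + j)))"
  proof -
    have "(\<Sum>i<q. \<Sum>j<q. k * x i * y j) = k * (\<Sum>i<q. x i) * (\<Sum>j<q. y j)" for k :: real and x y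
    proof -
      have "k * (\<Sum>i<q. x i) * (\<Sum>j<q. y j) = k * (\<Sum>i<q. \<Sum>j<q. x i * y j)"
        by (simp only: mult.assoc sum_product)
      then show ?thesis by (simp add: sum_distrib_left mult.assoc)
    qed
    then show ?thesis by (intro sum.cong refl)
  qed
  also have "\<dots> = (\<Sum>\<alpha><M. \<Sum>\<beta><M. \<Sum>i<q. \<Sum>j<q. A (\<alpha> * q + i) (\<beta> * q + j) * w S (\<alpha> * q + i) * w T (\<beta> * q + j))"
  proof (intro sum.cong refl)
    fix \<alpha> \<beta>
    have "(\<Sum>i<q. \<Sum>j<q. A (\<alpha> * q + i) (\<beta> * q + j) * w S (\<alpha> * q + i) * w T (\<beta> * q + j)) =
       (\<Sum>i<q. \<Sum>j<q. A (\<alpha> * q + i) (\<beta> * q + j)) * (w S (\<alpha> * q) * w T (\<beta> * q))"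
      unfolding sum_distrib_right by (intro sum.cong refl) (auto simp: w_def)
    then show "block_avg q A \<alpha> \<beta> * (\<Sum>i<q. indicator S (\<alpha> * q + i)) * (\<Sum>j<q. indicator T (\<beta> * q + j)) =
       (\<Sum>i<q. \<Sum>j<q. A (\<alpha> * q + i) (\<beta> * q + j) * w S (\<alpha> * q + i) * w T (\<beta> * q + j))"
      using q card_w[OF q, of S \<alpha>] card_w[OF q, of T \<beta>] by (simp add: block_avg_def power2_eq_square)
  qed
  also have "\<dots> = (\<Sum>a<M * q. \<Sum>b<M * q. A a b * w S a * w T b)"
    unfolding sum_blocks by (intro sum.cong refl sum.swap)
  also have "\<bar>\<dots>\<bar> \<le> c"
    using bound unfolding rect_sum_def by (intro bilinear_weights w01) auto
  finally show ?thesis .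
qed

text \<open>If \<open>g\<close> is not constant on a block, it has strictly increased by the start
  of any later block. So the values of \<open>g\<close> at the starts of the non-constant blocks are
  distinct, and there are at most \<open>K\<close> of them.\<close>

lemma bad_blocks:
  fixes g :: "nat \<Rightarrow> nat"
  assumes q: "0 < q" and mono: "mono_on {..<M * q} g" and bound: "\<And>a. g a < K"
  shows "card {\<alpha>. \<alpha> < M \<and> (\<exists>i<q. g (\<alpha> * q + i) \<noteq> g (\<alpha> * q))} \<le> K"
proof -
  let ?B = "{\<alpha>. \<alpha> < M \<and> (\<exists>i<q. g (\<alpha> * q + i) \<noteq> g (\<alpha> * q))}"
  have lt: "g (\<alpha> * q) < g (\<beta> * q)" if \<alpha>: "\<alpha> \<in> ?B" and \<beta>: "\<beta> < M" "\<alpha> < \<beta>" for \<alpha> \<beta>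
  proof -
    obtain i where i: "i < q" "g (\<alpha> * q + i) \<noteq> g (\<alpha> * q)" using \<alpha> by auto
    have le: "(\<alpha> + 1) * q \<le> \<beta> * q" "(\<beta> + 1) * q \<le> M * q"
      using \<beta> by (intro mult_right_mono; simp)+
    then have *: "\<alpha> * q + i < M * q" "\<alpha> * q < M * q" "\<beta> * q < M * q" "\<alpha> * q + i \<le> \<beta> * q"
      using i(1) q unfolding add_mult_distrib mult_1 by linarith+
    have "g (\<alpha> * q) \<le> g (\<alpha> * q + i)"
      by (rule mono_onD[OF mono]) (use *(1,2) in \<open>simp_all only: lessThan_iff le_add1\<close>)
    moreover have "g (\<alpha> * q + i) \<le> g (\<beta> * q)"
      by (rule mono_onD[OF mono]) (use * in \<open>simp_all only: lessThan_iff\<close>)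
    ultimately show ?thesis using i(2) by simp
  qed
  have "inj_on (\<lambda>\<alpha>. g (\<alpha> * q)) ?B"
  proof (rule inj_onI)
    fix \<alpha> \<beta> assume "\<alpha> \<in> ?B" "\<beta> \<in> ?B" "g (\<alpha> * q) = g (\<beta> * q)"
    then show "\<alpha> = \<beta>" using lt[of \<alpha> \<beta>] lt[of \<beta> \<alpha>] by (cases \<alpha> \<beta> rule: linorder_cases) auto
  qed
  then have "card ?B = card ((\<lambda>\<alpha>. g (\<alpha> * q)) ` ?B)" by (simp add: card_image)
  also have "\<dots> \<le> card {..<K}" using bound by (intro card_mono) auto
  finally show ?thesis by simp
qed

text \<open>Where \<open>g\<close> and \<open>h\<close> are constant on the row block and on the
  column block, \<open>X\<close> is constant and equals its average. The remaining pairs of blocks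
  number at most \<open>2 * K * M\<close>, each with \<open>q ^ 2\<close> entries and an error of at
  most 1 per entry.\<close>

lemma rectangle_block_error:
  assumes q: "0 < q"
    and S: "mono_on {..<M * q} g" "\<And>a. g a < K" "\<And>a. a \<in> S \<longleftrightarrow> odd (g a)"
    and T: "mono_on {..<M * q} h" "\<And>a. h a < K" "\<And>a. a \<in> T \<longleftrightarrow> odd (h a)"
  defines "X \<equiv> \<lambda>a b :: nat. indicator S a * indicator T b :: real"
  shows "(\<Sum>a<M * q. \<Sum>b<M * q. \<bar>X a b - block_avg q X (a div q) (b div q)\<bar>) \<le> 2 * real K * real M * real q ^ 2"
proof -
  define BS where "BS = {\<alpha>. \<alpha> < M \<and> (\<exists>i<q. g (\<alpha> * q + i) \<noteq> g (\<alpha> * q))}"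
  define BT where "BT = {\<alpha>. \<alpha> < M \<and> (\<exists>i<q. h (\<alpha> * q + i) \<noteq> h (\<alpha> * q))}"
  have X01: "X a b \<in> {0..1}" for a b by (simp add: X_def split: split_indicator)
  have one: "\<bar>X a b - block_avg q X c d\<bar> \<le> 1" for a b c d
    using X01[of a b] block_avg_bounds[of X q c d, OF X01] by auto
  have good: "X (\<alpha> * q + i) (\<beta> * q + j) = block_avg q X \<alpha> \<beta>"
    if "\<alpha> < M" "\<beta> < M" "i < q" "j < q" "\<alpha> \<notin> BS" "\<beta> \<notin> BT" for \<alpha> \<beta> i j
  proof -
    have "X (\<alpha> * q + i') (\<beta> * q + j') = X (\<alpha> * q + i) (\<beta> * q + j)" if "i' < q" "j' < q" for i' j'
    proof -
      have "g (\<alpha> * q + i') = g (\<alpha> * q + i)" "h (\<beta> * q + j') = h (\<beta> * q + j)"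
        using that \<open>i < q\<close> \<open>j < q\<close> \<open>\<alpha> < M\<close> \<open>\<beta> < M\<close> \<open>\<alpha> \<notin> BS\<close> \<open>\<beta> \<notin> BT\<close> unfolding BS_def BT_def
        by (metis (mono_tags, lifting) mem_Collect_eq)+
      then show ?thesis by (simp add: X_def indicator_def S(3) T(3))
    qed
    then show ?thesis using q by (simp add: block_avg_def power2_eq_square)
  qed
  have "(\<Sum>a<M * q. \<Sum>b<M * q. \<bar>X a b - block_avg q X (a div q) (b div q)\<bar>) =
     (\<Sum>\<alpha><M. \<Sum>i<q. \<Sum>\<beta><M. \<Sum>j<q. \<bar>X (\<alpha> * q + i) (\<beta> * q + j) - block_avg q X \<alpha> \<beta>\<bar>)"
    unfolding sum_blocks by (intro sum.cong refl) simp
  also have "\<dots> \<le> (\<Sum>\<alpha><M. \<Sum>i<q. \<Sum>\<beta><M. \<Sum>j<q. indicator BS \<alpha> + indicator BT \<beta>)"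
  proof (intro sum_mono)
    fix \<alpha> i \<beta> j assume *: "\<alpha> \<in> {..<M}" "i \<in> {..<q}" "\<beta> \<in> {..<M}" "j \<in> {..<q}"
    show "\<bar>X (\<alpha> * q + i) (\<beta> * q + j) - block_avg q X \<alpha> \<beta>\<bar> \<le> indicator BS \<alpha> + indicator BT \<beta>"
      using one[of "\<alpha> * q + i" "\<beta> * q + j" \<alpha> \<beta>] good[of \<alpha> \<beta> i j] *
      by (cases "\<alpha> \<in> BS"; cases "\<beta> \<in> BT") auto
  qed
  also have "\<dots> = real q ^ 2 * real M * (real (card BS) + real (card BT))"
  proof -
    have "{..<M} \<inter> BS = BS" "{..<M} \<inter> BT = BT" by (auto simp: BS_def BT_def)
    then have "(\<Sum>\<alpha><M. indicator BS \<alpha>) = real (card BS)" "(\<Sum>\<alpha><M. indicator BT \<alpha>) = real (card BT)"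
      by (simp_all add: indicator_def sum.If_cases)
    then show ?thesis
      by (simp add: sum.distrib sum_distrib_left[symmetric] power2_eq_square algebra_simps)
  qed
  also have "\<dots> \<le> real q ^ 2 * real M * (real K + real K)"
    using bad_blocks[OF q S(1,2)] bad_blocks[OF q T(1,2)]
    by (intro mult_left_mono add_mono) (auto simp: BS_def BT_def)
  finally show ?thesis by (simp add: algebra_simps)
qed

text \<open>One permutation serves all \<open>m\<close> up to \<open>n\<close> and all grids
  \<open>j\<close>. The first term of the bound is the regularity error, counted once for the matrix
  and once for its average. The second is the error of averaging fewer than \<open>m\<close>
  rectangles with coefficients at most 1, by \<open>rectangle_block_error\<close> with
  \<open>K = 2 ^ (2 * m)\<close> and \<open>M = 2 ^ j\<close>.\<close>

lemma sorted_regularity: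
  fixes n :: nat
  assumes A: "\<And>a b. A a b \<in> {0..1}"
  obtains \<pi> where "\<pi> permutes {..<2 ^ p}"
    "\<And>m j S T. 0 < (m :: nat) \<Longrightarrow> m \<le> n \<Longrightarrow> j \<le> p \<Longrightarrow> S \<subseteq> {..<2 ^ p} \<Longrightarrow> T \<subseteq> {..<2 ^ p} \<Longrightarrow>
      \<bar>rect_sum (\<lambda>a b. A (\<pi> a) (\<pi> b) -
          block_avg (2 ^ (p - j)) (\<lambda>a b. A (\<pi> a) (\<pi> b)) (a div 2 ^ (p - j)) (b div 2 ^ (p - j))) S T\<bar>
      \<le> (2 / sqrt (real m) + real m * 2 ^ (2 * m + 1) / 2 ^ j) * 4 ^ p"
proof -
  let ?N = "2 ^ p :: nat"
  obtain S T :: "nat \<Rightarrow> nat set" and c :: "nat \<Rightarrow> real" where c: "\<And>l. \<bar>c l\<bar> \<le> 1"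
    and reg: "\<And>m. 0 < m \<Longrightarrow> \<exists>l<m. \<forall>S' T'. S' \<subseteq> {..<?N} \<longrightarrow> T' \<subseteq> {..<?N} \<longrightarrow>
       \<bar>rect_sum (\<lambda>a b. A a b - (\<Sum>i<l. c i * indicator (S i) a * indicator (T i) b)) S' T'\<bar> \<le> real ?N ^ 2 / sqrt (real m)"
    by (rule greedy_regularity[of ?N A, OF _ A]) (simp, rule that)
  \<comment> \<open>Rows and columns must undergo the same permutation, so both sides of every
    rectangle enter the sorting. Interleaving them makes the first \<open>m\<close> rectangles
    depend only on the first \<open>2 * m\<close> sets, which keeps the bound for \<open>m\<close>
    independent of \<open>n\<close>.\<close>
  define Q where "Q i = (if even i then S (i div 2) else T (i div 2))" for i
  obtain \<pi> where \<pi>: "\<pi> permutes {..<?N}"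
    and sorted: "\<And>l. l < 2 * n \<Longrightarrow> \<exists>g :: nat \<Rightarrow> nat. mono_on {..<?N} g \<and> (\<forall>a. g a < 2 ^ Suc l) \<and> (\<forall>a. \<pi> a \<in> Q l \<longleftrightarrow> odd (g a))"
    by (rule sort_sets[of ?N "2 * n" Q]) (rule that)
  have four: "real ?N ^ 2 = 4 ^ p"
    by (simp add: power2_eq_square power_mult_distrib[symmetric])
  show ?thesis
  proof (rule that[OF \<pi>])
    fix m j :: nat and S' T' assume m: "0 < m" "m \<le> n" and j: "j \<le> p" and ST': "S' \<subseteq> {..<?N}" "T' \<subseteq> {..<?N}"
    define q where "q = (2 :: nat) ^ (p - j)"
    have q: "0 < q" and Mq: "?N = 2 ^ j * q" using j by (simp_all add: q_def power_add[symmetric])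
    obtain l where l: "l < m" and reg_l: "\<And>S' T'. S' \<subseteq> {..<?N} \<Longrightarrow> T' \<subseteq> {..<?N} \<Longrightarrow>
       \<bar>rect_sum (\<lambda>a b. A a b - (\<Sum>i<l. c i * indicator (S i) a * indicator (T i) b)) S' T'\<bar> \<le> 4 ^ p / sqrt (real m)"
      using reg[OF m(1)] unfolding four by blast
    define B where "B a b = A (\<pi> a) (\<pi> b)" for a b
    define Y where "Y i a b = indicator (S i) (\<pi> a) * (indicator (T i) (\<pi> b) :: real)" for i a b
    define X where "X a b = (\<Sum>i<l. c i * Y i a b)" for a b
    let ?E = "\<lambda>Z a b. block_avg q Z (a div q) (b div q)"
    have BX: "\<bar>rect_sum (\<lambda>a b. B a b - X a b) S' T'\<bar> \<le> 4 ^ p / sqrt (real m)" if "S' \<subseteq> {..<?N}" "T' \<subseteq> {..<?N}" for S' T'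
    proof -
      have inj: "inj \<pi>" using \<pi> by (rule permutes_inj)
      have "rect_sum (\<lambda>a b. B a b - X a b) S' T' =
         rect_sum (\<lambda>a b. A a b - (\<Sum>i<l. c i * indicator (S i) a * indicator (T i) b)) (\<pi> ` S') (\<pi> ` T')"
        unfolding rect_sum_def using inj
        by (simp add: sum.reindex inj_on_subset[OF inj] B_def X_def Y_def mult.assoc)
      moreover have "\<pi> ` S' \<subseteq> {..<?N}" "\<pi> ` T' \<subseteq> {..<?N}"
        using that permutes_image[OF \<pi>] by (metis image_mono)+
      ultimately show ?thesis using reg_l by simp
    qed
    have BX': "\<bar>rect_sum (\<lambda>a b. ?E (\<lambda>a b. B a b - X a b) a b) S' T'\<bar> \<le> 4 ^ p / sqrt (real m)"
      using BX ST' unfolding Mq by (intro rect_sum_blowup[OF q]) auto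
    have XE: "(\<Sum>a<?N. \<Sum>b<?N. \<bar>X a b - ?E X a b\<bar>) \<le> real m * 2 ^ (2 * m + 1) / 2 ^ j * 4 ^ p"
    proof -
      define K :: real where "K = 2 ^ (2 * m + 1) / 2 ^ j * 4 ^ p"
      have Yi: "(\<Sum>a<?N. \<Sum>b<?N. \<bar>Y i a b - ?E (Y i) a b\<bar>) \<le> 2 ^ (2 * m + 1) / 2 ^ j * 4 ^ p" if i: "i < l" for i
      proof -
        obtain g :: "nat \<Rightarrow> nat" where g: "mono_on {..<?N} g" "\<And>a. g a < 2 ^ Suc (2 * i)" "\<And>a. \<pi> a \<in> S i \<longleftrightarrow> odd (g a)"
          using sorted[of "2 * i"] i l m by (auto simp: Q_def)
        obtain h :: "nat \<Rightarrow> nat" where h: "mono_on {..<?N} h" "\<And>a. h a < 2 ^ Suc (2 * i + 1)" "\<And>a. \<pi> a \<in> T i \<longleftrightarrow> odd (h a)"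
          using sorted[of "2 * i + 1"] i l m by (auto simp: Q_def)
        have "(2 :: nat) ^ Suc (2 * i) \<le> 2 ^ (2 * m)" "(2 :: nat) ^ Suc (2 * i + 1) \<le> 2 ^ (2 * m)"
          using i l by (intro power_increasing; simp)+
        then have gh: "g a < 2 ^ (2 * m)" "h a < 2 ^ (2 * m)" for a
          using g(2)[of a] h(2)[of a] by linarith+
        have Y_eq: "Y i = (\<lambda>a b. indicator {a. \<pi> a \<in> S i} a * indicator {b. \<pi> b \<in> T i} b)"
          by (auto simp: Y_def fun_eq_iff split: split_indicator)
        have "(\<Sum>a<?N. \<Sum>b<?N. \<bar>Y i a b - ?E (Y i) a b\<bar>) \<le> 2 * real (2 ^ (2 * m)) * real (2 ^ j) * real q ^ 2"
          unfolding Mq Y_eq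
          using g(1) h(1) gh g(3) h(3) unfolding Mq by (intro rectangle_block_error[OF q, of _ g _ _ h]) auto
        also have "\<dots> = 2 ^ (2 * m + 1) / 2 ^ j * (real (2 ^ j * q)) ^ 2"
          by (simp add: power2_eq_square field_simps)
        also have "real (2 ^ j * q) ^ 2 = 4 ^ p" using four unfolding Mq .
        finally show ?thesis .
      qed
      have EX: "?E X a b = (\<Sum>i<l. c i * ?E (Y i) a b)" for a b
        unfolding X_def block_avg_sum block_avg_cmult ..
      have "\<bar>X a b - ?E X a b\<bar> \<le> (\<Sum>i<l. \<bar>Y i a b - ?E (Y i) a b\<bar>)" for a b
      proof -
        have "X a b - ?E X a b = (\<Sum>i<l. c i * (Y i a b - ?E (Y i) a b))"
          unfolding EX by (simp add: X_def sum_subtractf right_diff_distrib)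
        moreover have "\<bar>\<Sum>i<l. c i * (Y i a b - ?E (Y i) a b)\<bar> \<le> (\<Sum>i<l. \<bar>c i * (Y i a b - ?E (Y i) a b)\<bar>)"
          by (rule sum_abs)
        moreover have "(\<Sum>i<l. \<bar>c i * (Y i a b - ?E (Y i) a b)\<bar>) \<le> (\<Sum>i<l. \<bar>Y i a b - ?E (Y i) a b\<bar>)"
          using c by (intro sum_mono) (simp add: abs_mult mult_left_le_one_le)
        ultimately show ?thesis by (simp only:)
      qed
      then have "(\<Sum>a<?N. \<Sum>b<?N. \<bar>X a b - ?E X a b\<bar>) \<le> (\<Sum>a<?N. \<Sum>b<?N. \<Sum>i<l. \<bar>Y i a b - ?E (Y i) a b\<bar>)"
        by (intro sum_mono)
      moreover have "(\<Sum>a<?N. \<Sum>b<?N. \<Sum>i<l. \<bar>Y i a b - ?E (Y i) a b\<bar>) = (\<Sum>i<l. \<Sum>a<?N. \<Sum>b<?N. \<bar>Y i a b - ?E (Y i) a b\<bar>)"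
        by (subst sum.swap[of _ "{..<l}"], intro sum.cong refl sum.swap)
      moreover have "(\<Sum>i<l. \<Sum>a<?N. \<Sum>b<?N. \<bar>Y i a b - ?E (Y i) a b\<bar>) \<le> (\<Sum>i<l. K)"
        using Yi by (intro sum_mono) (auto simp: K_def)
      moreover have "(\<Sum>i<l. K) \<le> real m * K"
      proof -
        have "real l * K \<le> real m * K" using l by (intro mult_right_mono) (auto simp: K_def)
        then show ?thesis by simp
      qed
      ultimately have "(\<Sum>a<?N. \<Sum>b<?N. \<bar>X a b - ?E X a b\<bar>) \<le> real m * K" by linarith
      then show ?thesis by (simp add: K_def mult.assoc)
    qed
    have XE': "\<bar>rect_sum (\<lambda>a b. X a b - ?E X a b) S' T'\<bar> \<le> real m * 2 ^ (2 * m + 1) / 2 ^ j * 4 ^ p"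
    proof -
      have "\<bar>rect_sum (\<lambda>a b. X a b - ?E X a b) S' T'\<bar> \<le> (\<Sum>a\<in>S'. \<Sum>b\<in>T'. \<bar>X a b - ?E X a b\<bar>)"
        unfolding rect_sum_def by (rule order_trans[OF sum_abs]) (intro sum_mono sum_abs)
      also have "\<dots> \<le> (\<Sum>a\<in>S'. \<Sum>b<?N. \<bar>X a b - ?E X a b\<bar>)"
        using ST' by (intro sum_mono sum_mono2) auto
      also have "\<dots> \<le> (\<Sum>a<?N. \<Sum>b<?N. \<bar>X a b - ?E X a b\<bar>)"
        using ST' by (intro sum_mono2) (auto intro: sum_nonneg)
      finally show ?thesis using XE by linarith
    qed
    \<comment> \<open>The rectangle approximation \<open>X\<close> is inserted between
      \<open>B\<close> and its average: both \<open>B - X\<close> and its average have small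
      rectangle sums, and \<open>X\<close> is close to its own average entry by entry.\<close>
    have "rect_sum (\<lambda>a b. B a b - ?E B a b) S' T' = rect_sum (\<lambda>a b. B a b - X a b) S' T' +
        rect_sum (\<lambda>a b. X a b - ?E X a b) S' T' - rect_sum (\<lambda>a b. ?E (\<lambda>a b. B a b - X a b) a b) S' T'"
      by (simp add: rect_sum_def block_avg_diff sum.distrib[symmetric] sum_subtractf[symmetric])
    then have "\<bar>rect_sum (\<lambda>a b. B a b - ?E B a b) S' T'\<bar> \<le> (2 / sqrt (real m) + real m * 2 ^ (2 * m + 1) / 2 ^ j) * 4 ^ p"
      using BX[OF ST'] XE' BX' by (simp add: algebra_simps)
    moreover have "B = (\<lambda>a b. A (\<pi> a) (\<pi> b))" by (simp add: B_def fun_eq_iff)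
    ultimately show "\<bar>rect_sum (\<lambda>a b. A (\<pi> a) (\<pi> b) -
          block_avg (2 ^ (p - j)) (\<lambda>a b. A (\<pi> a) (\<pi> b)) (a div 2 ^ (p - j)) (b div 2 ^ (p - j))) S' T'\<bar>
      \<le> (2 / sqrt (real m) + real m * 2 ^ (2 * m + 1) / 2 ^ j) * 4 ^ p"
      by (simp only: q_def)
  qed
qed

subsection \<open>Compactness in the cut norm\<close>

lemma cut_bound_cong:
  assumes "cut_bound D c" "\<And>q. q \<in> unit_square \<Longrightarrow> D' q = D q" "c \<le> c'"
  shows "cut_bound D' c'"
  unfolding cut_bound_def
proof (intro ballI)
  fix S T assume "S \<in> sets I01" "T \<in> sets I01"
  then have "\<bar>LINT p|sq. D p * indicator S (fst p) * indicator T (snd p)\<bar> \<le> c"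
    using assms(1) by (auto simp: cut_bound_def)
  also have "(LINT p|sq. D p * indicator S (fst p) * indicator T (snd p)) =
      (LINT p|sq. D' p * indicator S (fst p) * indicator T (snd p))"
    using assms(2) by (intro Bochner_Integration.integral_cong refl) (simp only: space_sq)
  finally show "\<bar>LINT p|sq. D' p * indicator S (fst p) * indicator T (snd p)\<bar> \<le> c'"
    using assms(3) by simp
qed

lemma cut_bound_add:
  assumes "cut_bound D c" "cut_bound D' c'" "integrable sq D" "integrable sq D'"
  shows "cut_bound (\<lambda>q. D q + D' q) (c + c')"
  unfolding cut_bound_def
proof (intro ballI)
  fix S T assume ST: "S \<in> sets I01" "T \<in> sets I01"
  note [measurable] = ST
  have int: "integrable sq (\<lambda>p. D p * indicator S (fst p) * indicator T (snd p))" if "integrable sq D" for D :: "real \<times> real \<Rightarrow> real"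
  proof (rule Bochner_Integration.integrable_bound[OF that])
    have [measurable]: "D \<in> borel_measurable sq" using that by auto
    show "(\<lambda>p. D p * indicator S (fst p) * indicator T (snd p)) \<in> borel_measurable sq" by measurable
  qed (auto split: split_indicator)
  have "(LINT p|sq. (D p + D' p) * indicator S (fst p) * indicator T (snd p)) =
     (LINT p|sq. D p * indicator S (fst p) * indicator T (snd p)) + (LINT p|sq. D' p * indicator S (fst p) * indicator T (snd p))"
    unfolding Bochner_Integration.integral_add[OF int[OF assms(3)] int[OF assms(4)], symmetric]
    by (intro Bochner_Integration.integral_cong refl) (simp add: distrib_right)
  moreover have "\<bar>LINT p|sq. D p * indicator S (fst p) * indicator T (snd p)\<bar> \<le> c"
    "\<bar>LINT p|sq. D' p * indicator S (fst p) * indicator T (snd p)\<bar> \<le> c'"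
    using assms(1,2) ST by (auto simp: cut_bound_def)
  ultimately show "\<bar>LINT p|sq. (D p + D' p) * indicator S (fst p) * indicator T (snd p)\<bar> \<le> c + c'"
    by linarith
qed

lemma cut_bound_sup:
  assumes "D \<in> borel_measurable sq" "\<And>q. q \<in> unit_square \<Longrightarrow> \<bar>D q\<bar> \<le> c" "0 \<le> c"
  shows "cut_bound D c"
proof -
  have "\<bar>LINT p|sq. D p * indicator S (fst p) * indicator T (snd p)\<bar> \<le> c" for S T :: "real set"
    using assms(2,3)
    by (intro integral_abs_le_const sq.P.prob_space_axioms) (auto split: split_indicator)
  then show ?thesis by (simp add: cut_bound_def)
qed

text \<open>The countable product of unit intervals is compact by Tychonoff and metrizable, hence
  sequentially compact, and convergence in it is convergence of the coordinates.\<close>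

lemma diagonal_subseq:
  fixes x :: "nat \<Rightarrow> 'i \<Rightarrow> real"
  assumes "countable (UNIV :: 'i set)" "\<And>n i. x n i \<in> {0..1}"
  obtains r l where "strict_mono r" "\<And>i. (\<lambda>n. x (r n) i) \<longlonglongrightarrow> l i"
proof -
  define y where "y n k = x n (from_nat_into UNIV k)" for n and k :: nat
  have "compactin (product_topology (\<lambda>_. euclidean) UNIV) (PiE UNIV (\<lambda>_ :: nat. {0..1 :: real}))"
    by (subst compactin_PiE) simp
  then have "compact (PiE UNIV (\<lambda>_ :: nat. {0..1 :: real}))"
    by (simp add: euclidean_product_topology)
  then have "seq_compact (PiE UNIV (\<lambda>_ :: nat. {0..1 :: real}))"
    by (simp add: compact_eq_seq_compact_metric)
  moreover have "\<forall>n. y n \<in> PiE UNIV (\<lambda>_. {0..1})" using assms(2) by (auto simp: y_def PiE_def)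
  ultimately obtain l r where r: "strict_mono r" and lim: "(y \<circ> r) \<longlonglongrightarrow> l"
    unfolding seq_compact_def by metis
  have "(\<lambda>n. y (r n) k) \<longlonglongrightarrow> l k" for k
  proof -
    have "isCont (\<lambda>f :: nat \<Rightarrow> real. f k) l"
    proof -
      have "continuous_on UNIV (\<lambda>f :: nat \<Rightarrow> real. f k)" by simp
      then show ?thesis by (simp add: continuous_on_eq_continuous_at del: continuous_on_product_coordinates)
    qed
    from isCont_tendsto_compose[OF this lim] show ?thesis by (simp add: comp_def)
  qed
  then have "(\<lambda>n. x (r n) i) \<longlonglongrightarrow> l (to_nat_on UNIV i)" for i
    using assms(1) from_nat_into_to_nat_on[of "UNIV :: 'i set" i] unfolding y_def by (metis UNIV_I)
  with r show ?thesis by (rule that)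
qed

section \<open>Nested dyadic grids and martingale limits\<close>

lemma idx_div:
  assumes "0 \<le> x" "j \<le> k"
  shows "idx k x div 2 ^ (k - j) = idx j x"
proof -
  define q where "q = (2 :: nat) ^ (k - j)"
  let ?i = "idx k x"
  have q: "0 < q" by (simp add: q_def)
  have k: "(2 :: real) ^ k = 2 ^ j * real q" using assms(2) by (simp add: q_def flip: power_add)
  have b: "real ?i \<le> 2 ^ k * x" "2 ^ k * x < real ?i + 1" using idx_bounds[OF assms(1), of k] by auto
  have d: "?i div q * q \<le> ?i" "?i < (?i div q + 1) * q"
    using dividend_less_div_times[OF q, of ?i] by (simp_all add: algebra_simps)
  have "real (?i div q) * real q \<le> (2 ^ j * x) * real q"
  proof -
    have "real (?i div q) * real q = real (?i div q * q)" by (simp only: of_nat_mult)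
    also have "\<dots> \<le> real ?i" using d(1) by (simp only: of_nat_le_iff)
    finally show ?thesis using b(1) k by (simp add: mult_ac)
  qed
  moreover have "(2 ^ j * x) * real q < (real (?i div q) + 1) * real q"
  proof -
    have "real ?i + 1 \<le> real ((?i div q + 1) * q)"
      using d(2) by (metis Suc_eq_plus1 Suc_leI of_nat_Suc of_nat_le_iff add.commute)
    also have "\<dots> = (real (?i div q) + 1) * real q" by (simp add: algebra_simps)
    finally show ?thesis using b(2) k by (simp add: mult_ac)
  qed
  ultimately have "real (?i div q) \<le> 2 ^ j * x" "2 ^ j * x < real (?i div q) + 1" 
    using q by simp_all
  then show ?thesis using idx_eq_iff[OF assms(1), of j "?i div q"] by (simp add: q_def)
qed

lemma stepfun_refine:
  assumes "j \<le> k" "q \<in> unit_square"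
  shows "stepfun j A q = stepfun k (\<lambda>a b. A (a div 2 ^ (k - j)) (b div 2 ^ (k - j))) q"
  using assms by (auto simp: stepfun_def idx_div)

text \<open>Pythagoras: on each block, averaging is the orthogonal projection onto the
  constants.\<close>

lemma block_avg_energy:
  fixes u :: "nat \<Rightarrow> nat \<Rightarrow> real"
  assumes q: "0 < q"
  shows "(\<Sum>a<M * q. \<Sum>b<M * q. (u a b - block_avg q u (a div q) (b div q))\<^sup>2) =
    (\<Sum>a<M * q. \<Sum>b<M * q. (u a b)\<^sup>2) - real q ^ 2 * (\<Sum>a<M. \<Sum>b<M. (block_avg q u a b)\<^sup>2)"
proof -
  have blk: "(\<Sum>i<q. \<Sum>j<q. (u (a * q + i) (b * q + j) - block_avg q u a b)\<^sup>2) =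
     (\<Sum>i<q. \<Sum>j<q. (u (a * q + i) (b * q + j))\<^sup>2) - real q ^ 2 * (block_avg q u a b)\<^sup>2" for a b
  proof -
    let ?m = "block_avg q u a b"
    have m: "(\<Sum>i<q. \<Sum>j<q. u (a * q + i) (b * q + j)) = real q ^ 2 * ?m"
      using q by (simp add: block_avg_def)
    have "(\<Sum>i<q. \<Sum>j<q. (u (a * q + i) (b * q + j) - ?m)\<^sup>2) =
       (\<Sum>i<q. \<Sum>j<q. (u (a * q + i) (b * q + j))\<^sup>2 - (2 * ?m) * u (a * q + i) (b * q + j) + ?m\<^sup>2)"
      by (intro sum.cong refl) (simp add: power2_eq_square algebra_simps)
    also have "\<dots> = (\<Sum>i<q. \<Sum>j<q. (u (a * q + i) (b * q + j))\<^sup>2) -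
        (2 * ?m) * (\<Sum>i<q. \<Sum>j<q. u (a * q + i) (b * q + j)) + real q ^ 2 * ?m\<^sup>2"
      by (simp only: sum.distrib sum_subtractf sum_distrib_left) (simp add: power2_eq_square)
    finally show ?thesis unfolding m by (simp add: power2_eq_square algebra_simps)
  qed
  have swap: "(\<Sum>a<M * q. \<Sum>b<M * q. f a b) = (\<Sum>a<M. \<Sum>b<M. \<Sum>i<q. \<Sum>j<q. f (a * q + i) (b * q + j))" for f :: "nat \<Rightarrow> nat \<Rightarrow> real"
    by (simp only: sum_blocks sum.swap[of _ "{..<M}" "{..<q}"])
  have "(\<Sum>a<M * q. \<Sum>b<M * q. (u a b - block_avg q u (a div q) (b div q))\<^sup>2) =
     (\<Sum>a<M. \<Sum>b<M. \<Sum>i<q. \<Sum>j<q. (u (a * q + i) (b * q + j) - block_avg q u a b)\<^sup>2)"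
    unfolding swap by (intro sum.cong refl) simp
  then show ?thesis
    by (simp only: blk swap[of "\<lambda>a b. (u a b)\<^sup>2"] sum_subtractf sum_distrib_left)
qed

lemma integral_abs_le_sqrt:
  fixes f :: "'a \<Rightarrow> real"
  assumes M: "prob_space M" and f: "f \<in> borel_measurable M" and B: "\<And>x. \<bar>f x\<bar> \<le> B"
  shows "(LINT x|M. \<bar>f x\<bar>) \<le> sqrt (LINT x|M. (f x)\<^sup>2)"
proof -
  interpret prob_space M by fact
  have int: "integrable M (\<lambda>x. \<bar>f x\<bar>)" using f B by (intro integrable_const_bound[where B=B]) auto
  have int2: "integrable M (\<lambda>x. \<bar>f x\<bar>\<^sup>2)"
  proof (rule integrable_const_bound[where B="B\<^sup>2"])
    show "AE x in M. norm (\<bar>f x\<bar>\<^sup>2) \<le> B\<^sup>2"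
    proof (rule AE_I2)
      fix x show "norm (\<bar>f x\<bar>\<^sup>2) \<le> B\<^sup>2" using power_mono[OF B[of x] abs_ge_zero, of 2] by simp
    qed
  qed (use f in measurable)
  have "(LINT x|M. \<bar>f x\<bar>)\<^sup>2 \<le> (LINT x|M. (f x)\<^sup>2)"
    using variance_positive[of "\<lambda>x. \<bar>f x\<bar>"] unfolding variance_eq[OF int int2] by simp
  then show ?thesis by (rule real_le_rsqrt)
qed

text \<open>The step functions are a bounded martingale for the dyadic grids. The squared L2
  distance of two of them is the difference of their energies, which increase and are bounded by 1,
  so the sequence is Cauchy in L1. A subsequence converges almost everywhere, and dominated
  convergence turns this into convergence in L1.\<close>

lemma martingale_limit:
  fixes u :: "nat \<Rightarrow> nat \<Rightarrow> nat \<Rightarrow> real"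
  assumes u01: "\<And>j. mat01 (u j)" and cons: "\<And>j k. j \<le> k \<Longrightarrow> u j = block_avg (2 ^ (k - j)) (u k)"
  obtains U V s where "U \<in> W0" "borel_version U V" "strict_mono s"
    "(\<lambda>i. LINT q|sq. \<bar>stepfun (s i) (u (s i)) q - V q\<bar>) \<longlonglongrightarrow> 0"
proof -
  let ?f = "\<lambda>j. stepfun j (u j)"
  define en where "en j = (\<Sum>a<2 ^ j. \<Sum>b<2 ^ j. (u j a b)\<^sup>2) / 4 ^ j" for j
  have ub: "0 \<le> u j a b" "u j a b \<le> 1" for j a b using u01[of j] by (auto simp: mat01_def)
  have fb: "0 \<le> ?f j q" "?f j q \<le> 1" for j q by (cases q, simp add: stepfun_def ub)+
  have L2: "(LINT q|sq. (?f k q - ?f j q)\<^sup>2) = en k - en j" if jk: "j \<le> k" for j k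
  proof -
    define q where "q = (2 :: nat) ^ (k - j)"
    have q: "0 < q" "2 ^ k = 2 ^ j * q" using jk by (simp_all add: q_def flip: power_add)
    have q2: "4 ^ k = 4 ^ j * real q ^ 2"
    proof -
      have "(4 :: real) ^ k = 4 ^ j * 4 ^ (k - j)" using jk by (simp flip: power_add)
      moreover have "real q ^ 2 = 4 ^ (k - j)" by (simp add: q_def power2_eq_square flip: power_mult_distrib)
      ultimately show ?thesis by simp
    qed
    have uj: "u j = block_avg q (u k)" using cons[OF jk] by (simp add: q_def)
    have "(LINT p|sq. (?f k p - ?f j p)\<^sup>2) =
       (LINT p|sq. stepfun k (\<lambda>a b. (u k a b - u j (a div q) (b div q))\<^sup>2) p)"
    proof (intro Bochner_Integration.integral_cong refl)
      fix p assume "p \<in> space sq"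
      then show "(?f k p - ?f j p)\<^sup>2 = stepfun k (\<lambda>a b. (u k a b - u j (a div q) (b div q))\<^sup>2) p"
        using stepfun_refine[OF jk, of p "u j"] unfolding space_sq by (cases p) (simp add: stepfun_def q_def)
    qed
    also have "\<dots> = (\<Sum>a<2 ^ k. \<Sum>b<2 ^ k. (u k a b - u j (a div q) (b div q))\<^sup>2) / 4 ^ k"
      by (rule stepfun_integral_total)
    also have "\<dots> = ((\<Sum>a<2 ^ k. \<Sum>b<2 ^ k. (u k a b)\<^sup>2) - real q ^ 2 * (\<Sum>a<2 ^ j. \<Sum>b<2 ^ j. (u j a b)\<^sup>2)) / 4 ^ k"
      unfolding q(2) uj block_avg_energy[OF q(1)] ..
    also have "\<dots> = en k - en j"
      using q(1) by (simp add: en_def diff_divide_distrib q2)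
    finally show ?thesis .
  qed
  have en_mono: "en j \<le> en k" if "j \<le> k" for j k
  proof -
    have "0 \<le> (LINT q|sq. (?f k q - ?f j q)\<^sup>2)" by (rule integral_nonneg_AE) simp
    then show ?thesis using L2[OF that] by simp
  qed
  have "en j \<le> 1" for j
  proof -
    have "(\<Sum>a<2 ^ j. \<Sum>b<2 ^ j. (u j a b)\<^sup>2) \<le> (\<Sum>a<(2::nat) ^ j. \<Sum>b<(2::nat) ^ j. 1)"
      using ub by (intro sum_mono) (simp add: power_le_one)
    also have "\<dots> = 4 ^ j" by (simp flip: power_mult_distrib)
    finally show ?thesis by (simp add: en_def divide_le_eq)
  qed
  moreover have "0 \<le> en j" for j by (simp add: en_def sum_nonneg)
  ultimately have "Bseq en" by (intro BseqI'[of _ 1]) simp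
  then have "convergent en" using en_mono by (intro Bseq_mono_convergent) auto
  then have Cauchy: "Cauchy en" by (rule convergent_Cauchy)
  have L1: "(LINT q|sq. norm (?f k q - ?f j q)) \<le> sqrt \<bar>en k - en j\<bar>" for j k
  proof -
    have "(LINT q|sq. norm (?f k q - ?f j q)) \<le> sqrt (LINT q|sq. (?f k q - ?f j q)\<^sup>2)"
      unfolding real_norm_def
    proof (rule integral_abs_le_sqrt[OF sq.P.prob_space_axioms, where B=1])
      show "\<bar>?f k q - ?f j q\<bar> \<le> 1" for q using fb[of k q] fb[of j q] by linarith
    qed measurable
    moreover have "(LINT q|sq. (?f k q - ?f j q)\<^sup>2) = \<bar>en k - en j\<bar>"
    proof (cases "j \<le> k")
      case True
      then show ?thesis using L2 en_mono by simp
    next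
      case False
      then have "(LINT q|sq. (?f j q - ?f k q)\<^sup>2) = en j - en k" "en k \<le> en j" using L2 en_mono by auto
      then show ?thesis by (simp add: power2_commute)
    qed
    ultimately show ?thesis by simp
  qed
  have int: "integrable sq (?f j)" for j
    using fb by (intro integrable_sq_bounded[where B=1]) auto
  have "\<exists>N. \<forall>i\<ge>N. \<forall>j\<ge>N. (LINT q|sq. norm (?f i q - ?f j q)) < e" if e: "e > 0" for e
  proof -
    obtain N where N: "\<forall>i\<ge>N. \<forall>j\<ge>N. norm (en i - en j) < e\<^sup>2"
      using CauchyD[OF Cauchy, of "e\<^sup>2"] e by auto
    have "(LINT q|sq. norm (?f i q - ?f j q)) < e" if "i \<ge> N" "j \<ge> N" for i j
    proof -
      have "\<bar>en i - en j\<bar> < e\<^sup>2" using N that by auto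
      then have "sqrt \<bar>en i - en j\<bar> < e" using e by (simp add: real_less_lsqrt)
      then show ?thesis using L1[of i j] by linarith
    qed
    then show ?thesis by blast
  qed
  from cauchy_L1_AE_cauchy_subseq[OF int this]
  obtain s where s: "strict_mono s" and ae: "AE q in sq. Cauchy (\<lambda>i. ?f (s i) q)" by blast
  \<comment> \<open>On the null set without convergence \<open>lim\<close> is arbitrary; clamping
    gives values in the unit interval everywhere, as \<open>borel_version\<close> demands.\<close>
  define V where "V q = max 0 (min 1 (lim (\<lambda>i. ?f (s i) q)))" for q
  have V_meas [measurable]: "V \<in> borel_measurable sq" unfolding V_def by measurable
  have V01: "0 \<le> V q" "V q \<le> 1" for q by (auto simp: V_def)
  have V: "borel_version (restrict V unit_square) V"
    using V01 V_meas by (auto simp: borel_version_def)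
  have "(\<lambda>i. LINT q|sq. \<bar>?f (s i) q - V q\<bar>) \<longlonglongrightarrow> (LINT q|sq. 0)"
  proof (rule integral_dominated_convergence[where w="\<lambda>_. 1"])
    show "AE q in sq. norm \<bar>?f (s i) q - V q\<bar> \<le> 1" for i
    proof (rule AE_I2)
      fix q show "norm \<bar>?f (s i) q - V q\<bar> \<le> 1" using fb[of "s i" q] V01[of q] by simp
    qed
    show "AE q in sq. (\<lambda>i. \<bar>?f (s i) q - V q\<bar>) \<longlonglongrightarrow> 0"
      using ae
    proof eventually_elim
      case (elim q)
      then have lim: "(\<lambda>i. ?f (s i) q) \<longlonglongrightarrow> lim (\<lambda>i. ?f (s i) q)"
        by (simp add: Cauchy_convergent_iff convergent_LIMSEQ_iff)
      have "0 \<le> lim (\<lambda>i. ?f (s i) q)" "lim (\<lambda>i. ?f (s i) q) \<le> 1"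
        using fb by (intro LIMSEQ_le_const[OF lim] LIMSEQ_le_const2[OF lim]; blast)+
      then have "V q = lim (\<lambda>i. ?f (s i) q)" by (simp add: V_def)
      then have "(\<lambda>i. ?f (s i) q - V q) \<longlonglongrightarrow> 0" using lim by (simp add: LIM_zero)
      then show ?case by (rule tendsto_rabs_zero)
    qed
  qed (auto simp: sq.P.integrable_const)
  then have lim: "(\<lambda>i. LINT q|sq. \<bar>?f (s i) q - V q\<bar>) \<longlonglongrightarrow> 0" by simp
  have "restrict V unit_square \<in> W0"
  proof (rule W0_I[OF V])
    fix x y :: real
    \<comment> \<open>Mirror points have identical sequences, so \<open>lim\<close> agrees on them
      even where they diverge, and \<open>V\<close> is symmetric everywhere.\<close>
    have "?f i (x, y) = ?f i (y, x)" for i using u01[of i] by (simp add: stepfun_def mat01_def)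
    then show "x \<in> {0..1} \<Longrightarrow> y \<in> {0..1} \<Longrightarrow> restrict V unit_square (x, y) = restrict V unit_square (y, x)"
      by (simp add: V_def)
  qed (use V01 in auto)
  then show ?thesis using V s lim by (rule that)
qed

lemma block_avg_tendsto:
  assumes "\<And>a b. (\<lambda>n. X n a b) \<longlonglongrightarrow> x a b"
  shows "(\<lambda>n. block_avg q (X n) a b) \<longlonglongrightarrow> block_avg q x a b"
  unfolding block_avg_def divide_inverse by (intro tendsto_mult tendsto_sum assms tendsto_const)

lemma cut_bound_sorted:
  assumes j: "j \<le> p"
    and bound: "\<And>S T. S \<subseteq> {..<2 ^ p} \<Longrightarrow> T \<subseteq> {..<2 ^ p} \<Longrightarrow>
      \<bar>rect_sum (\<lambda>a b. B a b - G (a div 2 ^ (p - j)) (b div 2 ^ (p - j))) S T\<bar> \<le> c * 4 ^ p"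
  shows "cut_bound (\<lambda>q. stepfun p B q - stepfun j G q) c"
proof (rule cut_bound_cong)
  show "cut_bound (stepfun p (\<lambda>a b. B a b - G (a div 2 ^ (p - j)) (b div 2 ^ (p - j)))) c"
    using bound unfolding rect_sum_def by (rule cut_bound_stepfun)
  fix q assume "q \<in> unit_square"
  from stepfun_refine[OF j this]
  show "stepfun p B q - stepfun j G q = stepfun p (\<lambda>a b. B a b - G (a div 2 ^ (p - j)) (b div 2 ^ (p - j))) q"
    by (simp add: stepfun_def case_prod_beta)
qed simp

text \<open>The order of the choices matters: \<open>m\<close> is fixed first to make the regularity
  error small, and only then is the grid refined, because the second term grows exponentially in
  \<open>m\<close>.\<close>

lemma regularity_parameters:
  assumes "0 < (e :: real)" "strict_mono s"
  obtains m where "0 < (m :: nat)"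
    "\<forall>\<^sub>F i in sequentially. 2 / sqrt (real m) + real m * 2 ^ (2 * m + 1) / 2 ^ s i < e"
proof -
  obtain m where m: "(4 / e)\<^sup>2 < real m" using reals_Archimedean2 by blast
  have "0 < m" using m by (metis of_nat_0_less_iff le_less_trans zero_le_power2)
  have "sqrt ((4 / e)\<^sup>2) < sqrt (real m)" using m by (rule real_sqrt_less_mono)
  then have "4 / e < sqrt (real m)" using assms(1) by simp
  then have a: "2 / sqrt (real m) < e / 2" using assms(1) \<open>0 < m\<close> by (simp add: field_simps)
  have "(\<lambda>j. c * (1 / 2) ^ j) \<longlonglongrightarrow> c * 0" for c :: real
    by (intro tendsto_mult_left LIMSEQ_power_zero) auto
  then have "(\<lambda>j. c / 2 ^ j) \<longlonglongrightarrow> 0" for c :: real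
    by (simp add: power_one_over)
  then have "(\<lambda>j. real m * 2 ^ (2 * m + 1) / 2 ^ j) \<longlonglongrightarrow> 0" .
  from LIMSEQ_subseq_LIMSEQ[OF this assms(2)] have "(\<lambda>i. real m * 2 ^ (2 * m + 1) / 2 ^ s i) \<longlonglongrightarrow> 0"
    by (simp add: comp_def)
  from order_tendstoD(2)[OF this, of "e / 2"] have "\<forall>\<^sub>F i in sequentially. real m * 2 ^ (2 * m + 1) / 2 ^ s i < e / 2"
    using assms(1) by simp
  then have "\<forall>\<^sub>F i in sequentially. 2 / sqrt (real m) + real m * 2 ^ (2 * m + 1) / 2 ^ s i < e"
    by eventually_elim (use a in linarith)
  with \<open>0 < m\<close> show ?thesis by (rule that)
qed

text \<open>The averages \<open>G n j\<close> of the sorted matrices are accurate in the cut norm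
  with an error that depends only on \<open>m\<close> and \<open>j\<close>, once \<open>n\<close> is
  large. For fixed \<open>j\<close> they range over a compact set, so a single subsequence makes
  them converge for all \<open>j\<close>. Their limits inherit the nesting of the grids, and the
  martingale they form has the required limit \<open>U\<close>.\<close>

theorem graphon_compactness:
  assumes W: "\<And>n :: nat. W n \<in> W0"
  obtains r U p \<pi> where "strict_mono r" "U \<in> W0" "\<And>n. \<pi> n permutes {..<2 ^ p n}"
    "(\<lambda>n. cut_norm (\<lambda>q. pullback (perm_map (p n) (\<pi> n)) (W (r n)) q - U q)) \<longlonglongrightarrow> 0"
proof -
  have "\<exists>p A. n \<le> p \<and> mat01 A \<and> fun_dist (W n) (step p A) < 1 / (real n + 1)" for n
  proof -
    obtain p0 where "\<forall>p\<ge>p0. \<exists>A. mat01 A \<and> fun_dist (W n) (step p A) < 1 / (real n + 1)"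
      using step_approx[OF W[of n], of "1 / (real n + 1)"] by auto
    then show ?thesis by (intro exI[of _ "max n p0"]) auto
  qed
  then obtain p A where p: "\<And>n. n \<le> p n" and A: "\<And>n. mat01 (A n)"
    and WA: "\<And>n. fun_dist (W n) (step (p n) (A n)) < 1 / (real n + 1)"
    by metis
  define Reg where "Reg n \<pi> \<longleftrightarrow> (\<forall>m j S T. 0 < m \<longrightarrow> m \<le> n \<longrightarrow> j \<le> p n \<longrightarrow> S \<subseteq> {..<2 ^ p n} \<longrightarrow> T \<subseteq> {..<2 ^ p n} \<longrightarrow>
      \<bar>rect_sum (\<lambda>a b. A n (\<pi> a) (\<pi> b) -
          block_avg (2 ^ (p n - j)) (\<lambda>a b. A n (\<pi> a) (\<pi> b)) (a div 2 ^ (p n - j)) (b div 2 ^ (p n - j))) S T\<bar>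
      \<le> (2 / sqrt (real m) + real m * 2 ^ (2 * m + 1) / 2 ^ j) * 4 ^ p n)" for n \<pi>
  have "\<exists>\<pi>. \<pi> permutes {..<2 ^ p n} \<and> Reg n \<pi>" for n
  proof -
    have A01: "A n a b \<in> {0..1}" for a b using A[of n] by (simp add: mat01_def)
    show ?thesis by (rule sorted_regularity[of "A n" "p n" n, OF A01]) (auto simp: Reg_def)
  qed
  then obtain \<pi> where \<pi>: "\<And>n. \<pi> n permutes {..<2 ^ p n}" and Reg: "\<And>n. Reg n (\<pi> n)"
    by metis
  note reg = Reg[unfolded Reg_def, rule_format]
  define B where "B n = (\<lambda>a b. A n (\<pi> n a) (\<pi> n b))" for n
  define G where "G n j = block_avg (2 ^ (p n - j)) (B n)" for n j
  have B: "mat01 (B n)" for n using A[of n] by (simp add: B_def mat01_def)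
  have G: "mat01 (G n j)" for n j unfolding G_def by (rule block_avg_mat01[OF B])
  have "\<And>n i. (\<lambda>(j, a, b). G n j a b) i \<in> {0..1}" using G by (auto simp: mat01_def)
  then obtain r l where r: "strict_mono r" and l: "\<And>i. (\<lambda>n. (\<lambda>(j, a, b). G (r n) j a b) i) \<longlonglongrightarrow> l i"
    by (rule diagonal_subseq[of "\<lambda>n (j, a, b). G n j a b", OF countableI_type]) (rule that)
  define u where "u j a b = l (j, a, b)" for j a b
  have lim: "(\<lambda>n. G (r n) j a b) \<longlonglongrightarrow> u j a b" for j a b using l[of "(j, a, b)"] by (simp add: u_def)
  have r_ge: "n \<le> r n" for n using seq_suble[OF r] .
  have u01: "mat01 (u j)" for j
    unfolding mat01_def
  proof (intro allI conjI)
    fix a b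
    have Gn: "0 \<le> G (r n) j a b" "G (r n) j a b \<le> 1" "G (r n) j a b = G (r n) j b a" for n
      using G[of "r n" j] by (auto simp: mat01_def)
    have "0 \<le> u j a b" by (rule LIMSEQ_le_const[OF lim]) (use Gn(1) in blast)
    moreover have "u j a b \<le> 1" by (rule LIMSEQ_le_const2[OF lim]) (use Gn(2) in blast)
    ultimately show "u j a b \<in> {0..1}" by simp
    show "u j a b = u j b a"
      using LIMSEQ_unique[OF lim[of j a b]] lim[of j b a] unfolding Gn(3) by blast
  qed
  have cons: "u j = block_avg (2 ^ (k - j)) (u k)" if "j \<le> k" for j k
  proof (intro ext)
    fix a b
    have "(\<lambda>n. block_avg (2 ^ (k - j)) (G (r n) k) a b) \<longlonglongrightarrow> block_avg (2 ^ (k - j)) (u k) a b"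
      by (rule block_avg_tendsto) (rule lim)
    \<comment> \<open>Eventually only: once \<open>k \<le> p (r n)\<close>, the subtractions in the
      exponents are genuine and an average of averages is an average. Before that they are
      truncated.\<close>
    moreover have "\<forall>\<^sub>F n in sequentially. block_avg (2 ^ (k - j)) (G (r n) k) a b = G (r n) j a b"
      using eventually_ge_at_top[of k]
    proof eventually_elim
      case (elim n)
      then have "k \<le> p (r n)" using r_ge[of n] p[of "r n"] by linarith
      then have "(2 :: nat) ^ (k - j) * 2 ^ (p (r n) - k) = 2 ^ (p (r n) - j)"
        using that by (simp flip: power_add)
      then show ?case by (simp add: G_def block_avg_block_avg)
    qed
    ultimately have "(\<lambda>n. G (r n) j a b) \<longlonglongrightarrow> block_avg (2 ^ (k - j)) (u k) a b"
      by (rule Lim_transform_eventually)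
    then show "u j a b = block_avg (2 ^ (k - j)) (u k) a b"
      using lim by (metis LIMSEQ_unique)
  qed
  obtain U V s where U: "U \<in> W0" and V: "borel_version U V" and s: "strict_mono s"
    and conv: "(\<lambda>i. LINT q|sq. \<bar>stepfun (s i) (u (s i)) q - V q\<bar>) \<longlonglongrightarrow> 0"
    by (rule martingale_limit[OF u01 cons])
  note [measurable] = V
  define W' where "W' n = pullback (perm_map (p (r n)) (\<pi> (r n))) (W (r n))" for n
  note mp = measure_preserving_perm_map[OF \<pi>]
  have W': "W' n \<in> W0" for n unfolding W'_def using mp W by (rule pullback_W0)
  have W'B: "fun_dist (W' n) (step (p (r n)) (B (r n))) < 1 / (real (r n) + 1)" for n
    unfolding W'_def B_def pullback_step[OF \<pi>, symmetric]
    by (subst fun_dist_pullback[OF mp W step_W0[OF A]]) (rule WA)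
  have "(\<lambda>n. cut_norm (\<lambda>q. W' n q - U q)) \<longlonglongrightarrow> 0"
  proof (rule LIMSEQ_I)
    fix e :: real assume e: "0 < e"
    \<comment> \<open>Four replacements cost \<open>e / 8\<close> each: the rearranged function by
      its step function, this by its averages on the grid \<open>j\<close>, these by their limits,
      and these by \<open>U\<close>.\<close>
    obtain m where m: "0 < m"
      and ev1: "\<forall>\<^sub>F i in sequentially. 2 / sqrt (real m) + real m * 2 ^ (2 * m + 1) / 2 ^ s i < e / 8"
      using regularity_parameters[OF _ s, of "e / 8"] e by auto
    have ev2: "\<forall>\<^sub>F i in sequentially. (LINT q|sq. \<bar>stepfun (s i) (u (s i)) q - V q\<bar>) < e / 8"
      using order_tendstoD(2)[OF conv, of "e / 8"] e by simp
    obtain i where i: "2 / sqrt (real m) + real m * 2 ^ (2 * m + 1) / 2 ^ s i < e / 8"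
      "(LINT q|sq. \<bar>stepfun (s i) (u (s i)) q - V q\<bar>) < e / 8"
      using eventually_happens'[OF sequentially_bot eventually_conj[OF ev1 ev2]] by blast
    define j where "j = s i"
    \<comment> \<open>A finite set of entries, so convergence is uniform on it. It includes the
      index \<open>2 ^ j\<close>, because the bound is used at every point of the square, including
      those with a coordinate 1.\<close>
    have ev3: "\<forall>\<^sub>F n in sequentially. \<forall>a\<in>{..2 ^ j}. \<forall>b\<in>{..2 ^ j}. \<bar>G (r n) j a b - u j a b\<bar> < e / 8"
      using tendstoD[OF lim, of "e / 8"] e by (intro eventually_ball_finite ballI) (auto simp: dist_real_def)
    obtain N where N: "8 / e < real N" using reals_Archimedean2 by blast
    have "\<forall>\<^sub>F n in sequentially. norm (cut_norm (\<lambda>q. W' n q - U q) - 0) < e"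
      using ev3 eventually_ge_at_top[of "max N (max m j)"]
    proof eventually_elim
      case (elim n)
      define k where "k = p (r n)"
      have n: "N \<le> r n" "m \<le> r n" "j \<le> k"
        using elim(2) r_ge[of n] p[of "r n"] by (auto simp: k_def)
      obtain V' where V': "borel_version (W' n) V'" using borel_version_exists[OF W'] .
      note [measurable] = V'
      note VB = borel_version_step[OF B, of k "r n"] borel_version_step[OF G, of j "r n" j] borel_version_step[OF u01, of j j]
      have "(LINT q|sq. \<bar>V' q - stepfun k (B (r n)) q\<bar>) < 1 / (real (r n) + 1)"
        using W'B[of n] fun_dist_borel_version[OF V' VB(1)] by (simp add: k_def)
      also have "\<dots> \<le> e / 8"
      proof -
        have "8 / e < real (r n) + 1" using N n(1) by (meson add_increasing2 less_le_trans of_nat_le_iff zero_le_one)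
        then show ?thesis using e by (simp add: field_simps)
      qed
      finally have c1: "cut_bound (\<lambda>q. V' q - stepfun k (B (r n)) q) (e / 8)"
        by (intro cut_bound_cong[OF cut_bound_L1[OF borel_version_diff_integrable[OF V' VB(1)]]]) auto
      have "cut_bound (\<lambda>q. stepfun k (B (r n)) q - stepfun j (G (r n) j) q) (2 / sqrt (real m) + real m * 2 ^ (2 * m + 1) / 2 ^ j)"
        using reg[OF m n(2) n(3)[unfolded k_def]] unfolding k_def G_def B_def
        by (intro cut_bound_sorted n(3)[unfolded k_def]) auto
      then have c2: "cut_bound (\<lambda>q. stepfun k (B (r n)) q - stepfun j (G (r n) j) q) (e / 8)"
        by (rule cut_bound_cong) (use i(1) in \<open>simp_all add: j_def\<close>)
      have c3: "cut_bound (\<lambda>q. stepfun j (G (r n) j) q - stepfun j (u j) q) (e / 8)"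
      proof (rule cut_bound_sup)
        fix q assume "q \<in> unit_square"
        then obtain x y where q: "q = (x, y)" "x \<in> {0..1}" "y \<in> {0..1}" by auto
        have "idx j z \<le> 2 ^ j" if "z \<in> {0..1}" for z
          using idx_less[of z j] idx_1[of j] that by (cases "z = 1") auto
        then have "\<bar>G (r n) j (idx j x) (idx j y) - u j (idx j x) (idx j y)\<bar> < e / 8"
          using elim(1) q by auto
        then show "\<bar>stepfun j (G (r n) j) q - stepfun j (u j) q\<bar> \<le> e / 8" by (simp add: stepfun_def q)
      qed (use e in auto)
      have c4: "cut_bound (\<lambda>q. stepfun j (u j) q - V q) (e / 8)"
        using i(2) by (intro cut_bound_cong[OF cut_bound_L1[OF borel_version_diff_integrable[OF VB(3) V]]]) (auto simp: j_def)
      note int = borel_version_diff_integrable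
      have "cut_bound (\<lambda>q. (V' q - stepfun k (B (r n)) q) + ((stepfun k (B (r n)) q - stepfun j (G (r n) j) q) +
          ((stepfun j (G (r n) j) q - stepfun j (u j) q) + (stepfun j (u j) q - V q)))) (e / 8 + (e / 8 + (e / 8 + e / 8)))"
        by (intro cut_bound_add c1 c2 c3 c4 Bochner_Integration.integrable_add int[OF V' VB(1)] int[OF VB(1,2)] int[OF VB(2,3)] int[OF VB(3) V])
      then have c: "cut_bound (\<lambda>q. V' q - V q) (e / 2)"
        by (rule cut_bound_cong) auto
      have "cut_norm (\<lambda>q. W' n q - U q) \<le> e / 2" by (rule cut_norm_le[OF V' V c])
      moreover have "0 \<le> cut_norm (\<lambda>q. W' n q - U q)"
        using cut_bound_nonneg[OF cut_bound_cut_norm[OF V' V]] .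
      ultimately show ?case using e by simp
    qed
    then show "\<exists>no. \<forall>n\<ge>no. norm (cut_norm (\<lambda>q. W' n q - U q) - 0) < e"
      by (simp add: eventually_sequentially)
  qed
  with r U show ?thesis unfolding W'_def
    by (intro that[of r U "\<lambda>n. \<pi> (r n)" "\<lambda>n. p (r n)"] \<pi>)
qed

subsection \<open>Flexings of cut norm limits\<close>

text \<open>
  The test function is close to a step function in \<open>L\<^sup>1\<close>, and on each of its cells the cut norm bounds the
  integral of \<open>D\<close>.
\<close>

lemma cut_bound_weak:
  assumes H: "H \<in> W0" and h: "borel_version H h" and e: "0 < e"
  obtains K :: real where "0 \<le> K"
    "\<And>D c. D \<in> borel_measurable sq \<Longrightarrow> (\<And>q. \<bar>D q\<bar> \<le> 1) \<Longrightarrow> cut_bound D c \<Longrightarrow> \<bar>LINT q|sq. D q * h q\<bar> \<le> e + K * c"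
proof -
  obtain p A where A: "mat01 A" and HA: "fun_dist H (step p A) < e"
    using step_approx[OF H e] by blast
  note [measurable] = h
  show ?thesis
  \<comment> \<open>One \<open>c\<close> for every pair of cells. The grid depends on the test
    function and on \<open>e\<close> only, so \<open>K\<close> is chosen before
    \<open>D\<close>.\<close>
  proof (rule that[of "4 ^ p"])
    fix D c assume D [measurable]: "D \<in> borel_measurable sq" and D1: "\<And>q. \<bar>D q\<bar> \<le> 1" and cut: "cut_bound D c"
    let ?I = "\<lambda>a b. LINT q|sq. D q * indicator (cell p a) (fst q) * indicator (cell p b) (snd q)"
    have Dh: "integrable sq (\<lambda>q. D q * f q)" if "f \<in> borel_measurable sq" "\<And>q. \<bar>f q\<bar> \<le> 1" for f
    proof (rule integrable_sq_bounded[where B=1])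
      show "\<bar>D q * f q\<bar> \<le> 1" for q using mult_mono[OF D1[of q] that(2)[of q]] by (simp add: abs_mult)
    qed (use that(1) in measurable)
    have A1: "0 \<le> A a b" "A a b \<le> 1" for a b using A by (auto simp: mat01_def)
    have s1: "\<bar>stepfun p A q\<bar> \<le> 1" for q using A1 by (cases q) (simp add: stepfun_def)
    have h1: "\<bar>h q\<bar> \<le> 1" for q using borel_version_bounds[OF h, of q] by simp
    have "\<bar>LINT q|sq. D q * h q - D q * stepfun p A q\<bar> \<le> (LINT q|sq. \<bar>D q * h q - D q * stepfun p A q\<bar>)"
      by (rule integral_abs_bound)
    also have "\<dots> \<le> (LINT q|sq. \<bar>h q - stepfun p A q\<bar>)"
    proof (rule integral_mono)
      show "integrable sq (\<lambda>q. \<bar>D q * h q - D q * stepfun p A q\<bar>)"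
        by (intro integrable_abs Bochner_Integration.integrable_diff Dh h1 s1) measurable
      show "integrable sq (\<lambda>q. \<bar>h q - stepfun p A q\<bar>)"
        by (intro integrable_abs borel_version_diff_integrable[OF h borel_version_step[OF A]])
      show "\<bar>D q * h q - D q * stepfun p A q\<bar> \<le> \<bar>h q - stepfun p A q\<bar>" for q
        using D1[of q] by (simp add: right_diff_distrib[symmetric] abs_mult mult_left_le_one_le)
    qed
    also have "\<dots> < e" using HA fun_dist_borel_version[OF h borel_version_step[OF A]] by simp
    also have "(LINT q|sq. D q * h q - D q * stepfun p A q) = (LINT q|sq. D q * h q) - (LINT q|sq. D q * stepfun p A q)"
      by (intro Bochner_Integration.integral_diff Dh h1 s1) measurable
    finally have 1: "\<bar>(LINT q|sq. D q * h q) - (LINT q|sq. D q * stepfun p A q)\<bar> < e" .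
    have int: "integrable sq (\<lambda>q. A a b * (D q * indicator (cell p a) (fst q) * indicator (cell p b) (snd q)))" for a b
    proof (rule integrable_sq_bounded[where B=1])
      show "\<bar>A a b * (D q * indicator (cell p a) (fst q) * indicator (cell p b) (snd q))\<bar> \<le> 1" for q
        using mult_mono[OF A1(2)[of a b] D1[of q]] A1(1)[of a b] by (auto simp: abs_mult split: split_indicator)
    qed measurable
    have "(LINT q|sq. D q * stepfun p A q) = (LINT q|sq. (\<Sum>a<2 ^ p. \<Sum>b<2 ^ p. A a b * (D q * indicator (cell p a) (fst q) * indicator (cell p b) (snd q))))"
    proof (rule integral_cong_AE)
      show "AE q in sq. D q * stepfun p A q = (\<Sum>a<2 ^ p. \<Sum>b<2 ^ p. A a b * (D q * indicator (cell p a) (fst q) * indicator (cell p b) (snd q)))"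
        using stepfun_AE[of p A] by eventually_elim (simp add: sum_distrib_left mult_ac)
    qed measurable
    also have "\<dots> = (\<Sum>a<2 ^ p. \<Sum>b<2 ^ p. A a b * ?I a b)"
    proof -
      have "(LINT q|sq. (\<Sum>a<2 ^ p. \<Sum>b<2 ^ p. A a b * (D q * indicator (cell p a) (fst q) * indicator (cell p b) (snd q)))) =
        (\<Sum>a<2 ^ p. (LINT q|sq. (\<Sum>b<2 ^ p. A a b * (D q * indicator (cell p a) (fst q) * indicator (cell p b) (snd q)))))"
        by (intro Bochner_Integration.integral_sum Bochner_Integration.integrable_sum int)
      also have "\<dots> = (\<Sum>a<2 ^ p. \<Sum>b<2 ^ p. (LINT q|sq. A a b * (D q * indicator (cell p a) (fst q) * indicator (cell p b) (snd q))))"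
        by (intro sum.cong refl Bochner_Integration.integral_sum int)
      finally show ?thesis by simp
    qed
    finally have "\<bar>LINT q|sq. D q * stepfun p A q\<bar> \<le> (\<Sum>a<2 ^ p. \<Sum>b<2 ^ p. \<bar>A a b * ?I a b\<bar>)"
      by (simp only:) (rule order_trans[OF sum_abs sum_mono[OF sum_abs]])
    also have "\<dots> \<le> (\<Sum>a<(2::nat) ^ p. \<Sum>b<(2::nat) ^ p. c)"
    proof (intro sum_mono)
      fix a b
      have "\<bar>?I a b\<bar> \<le> c" using cut by (auto simp: cut_bound_def)
      then show "\<bar>A a b * ?I a b\<bar> \<le> c"
        using mult_mono[OF A1(2)[of a b], of "\<bar>?I a b\<bar>" c] A1(1)[of a b] by (simp add: abs_mult)
    qed
    also have "\<dots> = 4 ^ p * c" by (simp flip: power_mult_distrib mult.assoc)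
    finally show "\<bar>LINT q|sq. D q * h q\<bar> \<le> e + 4 ^ p * c" using 1 by linarith
  qed simp
qed

text \<open>Left unrestricted, so that the same formula serves the functions on the square and their
  Borel versions, which are total.\<close>

definition flex_of :: "(real \<times> real \<Rightarrow> real) \<Rightarrow> (real \<times> real \<Rightarrow> real) \<Rightarrow> real \<times> real \<Rightarrow> real" where
  "flex_of U W = (\<lambda>q. if U q \<in> {0, 1} then U q else W q)"

lemma flex_of_flexing:
  assumes U: "U \<in> W0" and W: "W \<in> W0" and Z: "borel_version U Z" and V: "borel_version W V"
  shows "flexing (restrict (flex_of U W) unit_square) U"
    "borel_version (restrict (flex_of U W) unit_square) (flex_of Z V)"
proof -
  note [measurable] = Z V
  show ver: "borel_version (restrict (flex_of U W) unit_square) (flex_of Z V)"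
    unfolding borel_version_def
  proof (intro conjI allI)
    show "flex_of Z V \<in> borel_measurable sq" unfolding flex_of_def by measurable
    show "flex_of Z V q \<in> {0..1}" for q
      using borel_version_bounds[OF Z, of q] borel_version_bounds[OF V, of q] by (simp add: flex_of_def)
    show "AE q in sq. restrict (flex_of U W) unit_square q = flex_of Z V q"
      using borel_version_AE[OF Z] borel_version_AE[OF V] AE_space
    proof eventually_elim
      case (elim q)
      then show ?case by (simp only: space_sq restrict_apply' flex_of_def)
    qed
  qed
  have "restrict (flex_of U W) unit_square \<in> W0"
    using W0_D(2,3)[OF U] W0_D(2,3)[OF W]
    by (intro W0_I[OF ver]) (auto simp: flex_of_def)
  then show "flexing (restrict (flex_of U W) unit_square) U"
    using U by (auto simp: flexing_def flex_of_def)
qed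

text \<open>The level sets at 0 and at 1 become test functions for \<open>cut_bound_weak\<close>,
  which takes its test functions from \<open>W0\<close>.\<close>

lemma W0_level_set:
  assumes U: "U \<in> W0" and Z: "borel_version U Z"
  shows "restrict (\<lambda>q. if U q = c then 1 else 0) unit_square \<in> W0"
    "borel_version (restrict (\<lambda>q. if U q = c then 1 else 0) unit_square) (\<lambda>q. if Z q = c then 1 else 0)"
proof -
  note [measurable] = Z
  show ver: "borel_version (restrict (\<lambda>q. if U q = c then 1 else 0) unit_square) (\<lambda>q. if Z q = c then 1 else 0)"
    unfolding borel_version_def
  proof (intro conjI allI)
    show "AE q in sq. restrict (\<lambda>q. if U q = c then 1 else 0) unit_square q = (if Z q = c then 1 else 0 :: real)"
      using borel_version_AE[OF Z] AE_space
    proof eventually_elim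
      case (elim q)
      then show ?case by (simp only: space_sq restrict_apply')
    qed
  qed auto
  show "restrict (\<lambda>q. if U q = c then 1 else 0) unit_square \<in> W0"
    using W0_D(3)[OF U] by (intro W0_I[OF ver]) auto
qed

lemma flexing_limit:
  assumes W: "\<And>n :: nat. W n \<in> W0" and U: "U \<in> W0" and lim: "(\<lambda>n. cut_norm (\<lambda>q. W n q - U q)) \<longlonglongrightarrow> 0" and e: "0 < e"
  shows "\<exists>n Z. flexing Z U \<and> fun_dist (W n) Z < e"
proof -
  obtain Z where Z: "borel_version U Z" using borel_version_exists[OF U] .
  note lev = W0_level_set[OF U Z]
  obtain K0 where K0: "0 \<le> K0" "\<And>D c. D \<in> borel_measurable sq \<Longrightarrow> (\<And>q. \<bar>D q\<bar> \<le> 1) \<Longrightarrow> cut_bound D c \<Longrightarrow>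
      \<bar>LINT q|sq. D q * (if Z q = 0 then 1 else 0)\<bar> \<le> e / 4 + K0 * c"
    using cut_bound_weak[OF lev, of "e / 4" 0] e by auto
  obtain K1 where K1: "0 \<le> K1" "\<And>D c. D \<in> borel_measurable sq \<Longrightarrow> (\<And>q. \<bar>D q\<bar> \<le> 1) \<Longrightarrow> cut_bound D c \<Longrightarrow>
      \<bar>LINT q|sq. D q * (if Z q = 1 then 1 else 0)\<bar> \<le> e / 4 + K1 * c"
    using cut_bound_weak[OF lev, of "e / 4" 1] e by auto
  have "(\<lambda>n. (K0 + K1) * cut_norm (\<lambda>q. W n q - U q)) \<longlonglongrightarrow> (K0 + K1) * 0"
    by (intro tendsto_mult_left lim)
  then have "(\<lambda>n. (K0 + K1) * cut_norm (\<lambda>q. W n q - U q)) \<longlonglongrightarrow> 0" by simp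
  from order_tendstoD(2)[OF this, of "e / 2"] obtain n where n: "(K0 + K1) * cut_norm (\<lambda>q. W n q - U q) < e / 2"
    using e by (auto simp: eventually_sequentially)
  obtain V where V: "borel_version (W n) V" using borel_version_exists[OF W] .
  note [measurable] = Z V
  note fl = flex_of_flexing[OF U W Z V]
  let ?D = "\<lambda>q. V q - Z q" and ?c = "cut_norm (\<lambda>q. W n q - U q)"
  have D: "?D \<in> borel_measurable sq" "cut_bound ?D ?c" "\<bar>?D q\<bar> \<le> 1" for q
    using cut_bound_cut_norm[OF V Z] borel_version_bounds[OF V, of q] borel_version_bounds[OF Z, of q] by auto
  have int: "integrable sq (\<lambda>q. ?D q * (if Z q = c then 1 else 0))" for c
    by (rule Bochner_Integration.integrable_bound[OF borel_version_diff_integrable[OF V Z]]) auto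
  have "fun_dist (W n) (restrict (flex_of U (W n)) unit_square) = (LINT q|sq. \<bar>V q - flex_of Z V q\<bar>)"
    by (rule fun_dist_borel_version[OF V fl(2)])
  \<comment> \<open>The difference \<open>V - Z\<close> is nonnegative where \<open>Z\<close> is 0
    and nonpositive where \<open>Z\<close> is 1; elsewhere the flexing equals \<open>V\<close>. This
    constant sign turns the L1 distance into integrals that are linear in \<open>V - Z\<close>,
    which the cut norm does control.\<close>
  also have "\<dots> = (LINT q|sq. ?D q * (if Z q = 0 then 1 else 0) - ?D q * (if Z q = 1 then 1 else 0))"
  proof (rule Bochner_Integration.integral_cong[OF refl])
    fix q show "\<bar>V q - flex_of Z V q\<bar> = ?D q * (if Z q = 0 then 1 else 0) - ?D q * (if Z q = 1 then 1 else 0)"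
      using borel_version_bounds[OF V, of q] by (auto simp: flex_of_def)
  qed
  also have "\<dots> = (LINT q|sq. ?D q * (if Z q = 0 then 1 else 0)) - (LINT q|sq. ?D q * (if Z q = 1 then 1 else 0))"
    by (rule Bochner_Integration.integral_diff[OF int int])
  also have "\<dots> \<le> (e / 4 + K0 * ?c) + (e / 4 + K1 * ?c)"
    using K0(2)[OF D(1,3,2)] K1(2)[OF D(1,3,2)] by linarith
  also have "\<dots> < e" using n by (simp add: algebra_simps)
  finally show ?thesis using fl(1) by blast
qed

text \<open>The invariance shared by graphon properties and by closures of graph properties, so that
  \<open>flexible_close\<close> serves both halves of the result.\<close>

definition iso_invariant :: "(real \<times> real \<Rightarrow> real) set \<Rightarrow> bool" where
  "iso_invariant R \<longleftrightarrow> R \<subseteq> W0 \<and> (\<forall>W\<in>R. \<forall>W'\<in>W0. (\<forall>F. simple_graph F \<longrightarrow> fun_density F W' = fun_density F W) \<longrightarrow> W' \<in> R)"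

lemma density_tendsto:
  assumes W: "\<And>n :: nat. W n \<in> W0" and U: "U \<in> W0" and lim: "(\<lambda>n. cut_norm (\<lambda>q. W n q - U q)) \<longlonglongrightarrow> 0"
    and F: "simple_graph F"
  shows "(\<lambda>n. fun_density F (W n)) \<longlonglongrightarrow> fun_density F U"
proof -
  have "(\<lambda>n. real (card (ordered_edges F)) * cut_norm (\<lambda>q. W n q - U q)) \<longlonglongrightarrow> real (card (ordered_edges F)) * 0"
    by (intro tendsto_mult_left lim)
  then have lim0: "(\<lambda>n. real (card (ordered_edges F)) * cut_norm (\<lambda>q. W n q - U q)) \<longlonglongrightarrow> 0" by simp
  have "norm (fun_density F (W n) - fun_density F U) \<le> real (card (ordered_edges F)) * cut_norm (\<lambda>q. W n q - U q)" for n
    using density_cut_norm[OF F W U] by (simp only: real_norm_def)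
  then have "(\<lambda>n. fun_density F (W n) - fun_density F U) \<longlonglongrightarrow> 0"
    by (rule Lim_null_comparison[OF always_eventually[OF allI] lim0])
  then show ?thesis by (rule LIM_zero_cancel)
qed

text \<open>
  The point where flexibility enters: if the densities of \<open>W n\<close> can only accumulate at members of \<open>R\<close>, then
  \<open>W n\<close> comes close to \<open>R\<close> in \<open>L\<^sup>1\<close>, not just in the cut norm.
\<close>

lemma flexible_close:
  assumes R: "iso_invariant R" "flexible_fun R" and W: "\<And>n :: nat. W n \<in> W0" and e: "0 < e"
    and limits: "\<And>U r. U \<in> W0 \<Longrightarrow> strict_mono r \<Longrightarrow>
      (\<And>F. simple_graph F \<Longrightarrow> (\<lambda>n. fun_density F (W (r n))) \<longlonglongrightarrow> fun_density F U) \<Longrightarrow> U \<in> R"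
  shows "\<exists>n. \<exists>Z\<in>R. fun_dist (W n) Z < e"
proof -
  obtain r U p \<pi> where r: "strict_mono r" and U: "U \<in> W0" and \<pi>: "\<And>n. \<pi> n permutes {..<2 ^ p n}"
    and lim: "(\<lambda>n. cut_norm (\<lambda>q. pullback (perm_map (p n) (\<pi> n)) (W (r n)) q - U q)) \<longlonglongrightarrow> 0"
    by (rule graphon_compactness[of W, OF W]) (rule that)
  define W' where "W' n = pullback (perm_map (p n) (\<pi> n)) (W (r n))" for n
  note mp = measure_preserving_perm_map[OF \<pi>] and mp' = measure_preserving_perm_map[OF permutes_inv[OF \<pi>]]
  have W': "W' n \<in> W0" for n unfolding W'_def by (rule pullback_W0[OF mp W])
  have lim': "(\<lambda>n. cut_norm (\<lambda>q. W' n q - U q)) \<longlonglongrightarrow> 0" using lim by (simp add: W'_def)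
  have "U \<in> R"
  proof (rule limits[OF U r])
    fix F assume F: "simple_graph F"
    show "(\<lambda>n. fun_density F (W (r n))) \<longlonglongrightarrow> fun_density F U"
      using density_tendsto[OF W' U lim' F] by (simp add: W'_def fun_density_pullback[OF mp W F])
  qed
  obtain n Z where Z: "flexing Z U" "fun_dist (W' n) Z < e"
    using flexing_limit[OF W' U lim' e] by blast
  have "Z \<in> R" using R(2) \<open>U \<in> R\<close> Z(1) by (auto simp: flexible_fun_def)
  then have Z0: "Z \<in> W0" using R(1) by (auto simp: iso_invariant_def)
  \<comment> \<open>The rearrangement is undone: \<open>R\<close> is invariant under it, the L1
    distance is preserved, and the rearranged function returns to \<open>W (r n)\<close>
    itself.\<close>
  let ?Z = "pullback (perm_map (p n) (inv (\<pi> n))) Z"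
  have "?Z \<in> R"
    using R(1) \<open>Z \<in> R\<close> pullback_W0[OF mp' Z0] fun_density_pullback[OF mp' Z0] by (auto simp: iso_invariant_def)
  moreover have "fun_dist (W (r n)) ?Z = fun_dist (W' n) Z"
    using fun_dist_pullback[OF mp'[of n] W'[of n] Z0] by (simp add: W'_def pullback_inverse[OF \<pi> W])
  ultimately show ?thesis using Z(2) by metis
qed

section \<open>Limits of densities in closed graphon properties\<close>

lemma graphon_property_iso_invariant: "graphon_property R \<Longrightarrow> iso_invariant R"
  unfolding graphon_property_def function_property_def iso_invariant_def fun_iso_def by metis

lemma cut_closed_limit:
  assumes "cut_closed R" "U \<in> W0" "\<And>n :: nat. V n \<in> R" "R \<subseteq> W0" "(\<lambda>n. cut_norm (\<lambda>q. V n q - U q)) \<longlonglongrightarrow> 0"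
  shows "U \<in> R"
proof (rule ccontr)
  assume "U \<notin> R"
  then obtain e where e: "e > 0" "\<And>Y. Y \<in> W0 \<Longrightarrow> cut_norm (\<lambda>p. Y p - U p) < e \<Longrightarrow> Y \<notin> R"
    using assms(1,2) unfolding cut_closed_def by (metis DiffI)
  obtain n where "cut_norm (\<lambda>p. V n p - U p) < e"
    using order_tendstoD(2)[OF assms(5) e(1)] by (auto simp: eventually_sequentially)
  then show False using e(2) assms(3,4) by blast
qed

lemma close_if_densities_close:
  assumes R: "graphon_property R" "cut_closed R" "flexible_fun R"
    and W: "\<And>n :: nat. W n \<in> W0" and V: "\<And>n :: nat. V n \<in> R" and e: "0 < e"
    and diff: "\<And>F. simple_graph F \<Longrightarrow> (\<lambda>n. fun_density F (W n) - fun_density F (V n)) \<longlonglongrightarrow> 0"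
  shows "\<exists>n. \<exists>Z\<in>R. fun_dist (W n) Z < e"
proof (rule flexible_close[OF graphon_property_iso_invariant[OF R(1)] R(3) W e])
  note inv = graphon_property_iso_invariant[OF R(1)]
  have RW0: "R \<subseteq> W0" using inv by (simp add: iso_invariant_def)
  fix U r assume U: "U \<in> W0" and r: "strict_mono r"
    and limU: "\<And>F. simple_graph F \<Longrightarrow> (\<lambda>n. fun_density F (W (r n))) \<longlonglongrightarrow> fun_density F U"
  have V0: "V (r n) \<in> W0" for n using V RW0 by blast
  \<comment> \<open>The rearrangements found here are unrelated to those behind \<open>U\<close>.
    Only the densities of \<open>U\<close> and \<open>U'\<close> are compared, which rearrangements
    do not affect.\<close>
  obtain s U' p \<pi> where s: "strict_mono s" and U': "U' \<in> W0" and \<pi>: "\<And>n. \<pi> n permutes {..<2 ^ p n}"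
    and lim: "(\<lambda>n. cut_norm (\<lambda>q. pullback (perm_map (p n) (\<pi> n)) (V (r (s n))) q - U' q)) \<longlonglongrightarrow> 0"
    by (rule graphon_compactness[of "\<lambda>n. V (r n)", OF V0]) (rule that)
  define V' where "V' n = pullback (perm_map (p n) (\<pi> n)) (V (r (s n)))" for n
  note mp = measure_preserving_perm_map[OF \<pi>]
  have V': "V' n \<in> W0" for n unfolding V'_def by (rule pullback_W0[OF mp V0])
  have V'R: "V' n \<in> R" for n
    using inv V V' fun_density_pullback[OF mp V0] unfolding iso_invariant_def V'_def by blast
  have lim': "(\<lambda>n. cut_norm (\<lambda>q. V' n q - U' q)) \<longlonglongrightarrow> 0" using lim by (simp add: V'_def)
  have "U' \<in> R" using cut_closed_limit[OF R(2) U' V'R RW0 lim'] .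
  moreover have "fun_density F U = fun_density F U'" if F: "simple_graph F" for F
  proof -
    have "(\<lambda>n. fun_density F (V (r (s n)))) \<longlonglongrightarrow> fun_density F U'"
      using density_tendsto[OF V' U' lim' F] by (simp add: V'_def fun_density_pullback[OF mp V0 F])
    moreover have "(\<lambda>n. fun_density F (W (r (s n))) - fun_density F (V (r (s n)))) \<longlonglongrightarrow> 0"
      using LIMSEQ_subseq_LIMSEQ[OF diff[OF F] strict_mono_o[OF r s]] by (simp add: comp_def)
    ultimately have "(\<lambda>n. fun_density F (W (r (s n)))) \<longlonglongrightarrow> fun_density F U'"
      using tendsto_add by fastforce
    moreover have "(\<lambda>n. fun_density F (W (r (s n)))) \<longlonglongrightarrow> fun_density F U"
      using LIMSEQ_subseq_LIMSEQ[OF limU[OF F] s] by (simp add: comp_def)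
    ultimately show ?thesis by (metis LIMSEQ_unique)
  qed
  ultimately show "U \<in> R" using inv U by (auto simp: iso_invariant_def)
qed

subsection \<open>Homomorphism densities and concentration\<close>

definition homs :: "graph \<Rightarrow> graph \<Rightarrow> (nat \<Rightarrow> nat) set" where
  "homs F G = {f \<in> verts F \<rightarrow>\<^sub>E verts G. \<forall>u v. {u, v} \<in> edges F \<longrightarrow> {f u, f v} \<in> edges G}"

lemma finite_funs: "simple_graph F \<Longrightarrow> finite X \<Longrightarrow> finite (verts F \<rightarrow>\<^sub>E X)"
  by (simp add: simple_graph_def finite_PiE)

lemma card_funs: "simple_graph F \<Longrightarrow> card (verts F \<rightarrow>\<^sub>E X) = card X ^ card (verts F)"
  by (simp add: simple_graph_def card_PiE)

lemma hom_density_eq: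
  "simple_graph F \<Longrightarrow> hom_density F G = real (card (homs F G)) / real (card (verts G)) ^ card (verts F)"
  by (simp add: hom_density_def homs_def card_funs)

lemma hom_density_01: 
  assumes "simple_graph F" "finite (verts G)"
  shows "0 \<le> hom_density F G" "hom_density F G \<le> 1"
proof -
  have "card (homs F G) \<le> card (verts F \<rightarrow>\<^sub>E verts G)"
    by (intro card_mono finite_funs assms) (auto simp: homs_def)
  then show "0 \<le> hom_density F G" "hom_density F G \<le> 1"
    by (auto simp: hom_density_def homs_def divide_le_eq)
qed

text \<open>A union bound over ordered pairs of distinct nodes: a map with \<open>f u = f v\<close>
  is determined by its restriction to the other nodes than \<open>v\<close>. Multiplying by
  \<open>card X\<close> instead of dividing keeps the count within the naturals.\<close>

lemma card_non_injective:
  assumes V: "finite V" and X: "finite X"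
  shows "card {f \<in> V \<rightarrow>\<^sub>E X. \<not> inj_on f V} * card X \<le> card V ^ 2 * card X ^ card V"
proof -
  let ?P = "{(u, v) \<in> V \<times> V. u \<noteq> v}"
  let ?S = "\<lambda>(u, v). {f \<in> V \<rightarrow>\<^sub>E X. f u = f v}"
  have fin: "finite (V \<rightarrow>\<^sub>E X)" using V X by (simp add: finite_PiE)
  have finP: "finite ?P" by (rule finite_subset[of _ "V \<times> V"]) (use V in auto)
  have S: "card (?S p) * card X \<le> card X ^ card V" if p: "p \<in> ?P" for p
  proof -
    obtain u v where uv: "p = (u, v)" "u \<in> V" "v \<in> V" "u \<noteq> v" using p by auto
    have "inj_on (\<lambda>f. restrict f (V - {v})) (?S p)"
    proof (rule inj_onI)
      fix f g assume f: "f \<in> ?S p" and g: "g \<in> ?S p" and eq: "restrict f (V - {v}) = restrict g (V - {v})"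
      have *: "f w = g w" if "w \<in> V - {v}" for w using eq that by (metis restrict_apply')
      have "f w = g w" for w
      proof (cases "w \<in> V")
        case True
        have "f v = f u" "g v = g u" "f u = g u" using f g *[of u] uv by auto
        then show ?thesis using *[of w] True by (cases "w = v") auto
      next
        case False
        moreover have "f \<in> V \<rightarrow>\<^sub>E X" "g \<in> V \<rightarrow>\<^sub>E X" using f g uv(1) by auto
        ultimately show ?thesis using PiE_arb[of f V _ w] PiE_arb[of g V _ w] by metis
      qed
      then show "f = g" by auto
    qed
    moreover have "(\<lambda>f. restrict f (V - {v})) ` ?S p \<subseteq> (V - {v}) \<rightarrow>\<^sub>E X"
    proof
      fix h assume "h \<in> (\<lambda>f. restrict f (V - {v})) ` ?S p"
      then obtain f where f: "f \<in> V \<rightarrow>\<^sub>E X" "h = restrict f (V - {v})" using uv(1) by auto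
      show "h \<in> (V - {v}) \<rightarrow>\<^sub>E X" unfolding f(2) using PiE_mem[OF f(1)] by (intro restrict_PiE_iff[THEN iffD2]) auto
    qed
    ultimately have "card (?S p) \<le> card ((V - {v}) \<rightarrow>\<^sub>E X)"
      by (rule card_inj_on_le) (use V X in \<open>simp add: finite_PiE\<close>)
    also have "\<dots> = card X ^ (card V - 1)" using V uv(3) by (simp add: card_PiE)
    finally have "card (?S p) * card X \<le> card X ^ (card V - 1) * card X" by (rule mult_right_mono) simp
    also have "\<dots> = card X ^ card V"
    proof -
      have "0 < card V" using V uv(3) by (auto simp: card_gt_0_iff)
      then show ?thesis by (rule power_minus_mult)
    qed
    finally show ?thesis .
  qed
  have "card {f \<in> V \<rightarrow>\<^sub>E X. \<not> inj_on f V} \<le> card (\<Union>p\<in>?P. ?S p)"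
    by (intro card_mono finite_subset[OF _ fin]) (auto simp: inj_on_def)
  also have "\<dots> \<le> (\<Sum>p\<in>?P. card (?S p))" by (rule card_UN_le[OF finP])
  finally have "card {f \<in> V \<rightarrow>\<^sub>E X. \<not> inj_on f V} * card X \<le> (\<Sum>p\<in>?P. card (?S p) * card X)"
    by (simp add: sum_distrib_right[symmetric])
  also have "\<dots> \<le> (\<Sum>p\<in>?P. card X ^ card V)" by (rule sum_mono) (rule S)
  also have "\<dots> = card ?P * card X ^ card V" by simp
  also have "\<dots> \<le> card V ^ 2 * card X ^ card V"
  proof -
    have "card ?P \<le> card (V \<times> V)" using V by (intro card_mono) auto
    then show ?thesis by (simp add: card_cartesian_product power2_eq_square)
  qed
  finally show ?thesis .
qed

lemma non_injective_fraction:
  assumes V: "finite V" and X: "finite X" "X \<noteq> {}"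
  shows "real (card {f \<in> V \<rightarrow>\<^sub>E X. \<not> inj_on f V}) / real (card X) ^ card V \<le> real (card V) ^ 2 / real (card X)"
proof -
  have c: "0 < card X" using X by (simp add: card_gt_0_iff)
  have "real (card {f \<in> V \<rightarrow>\<^sub>E X. \<not> inj_on f V} * card X) \<le> real (card V ^ 2 * card X ^ card V)"
    using card_non_injective[OF V X(1)] by (simp only: of_nat_le_iff)
  then show ?thesis using c by (simp add: field_simps)
qed

text \<open>The disjoint union of two copies of \<open>F\<close>. Parity tells the copies apart and
  \<open>div 2\<close> recovers the original node, so the nodes remain natural numbers.\<close>

definition double :: "graph \<Rightarrow> graph" where
  "double F = ((\<lambda>v. 2 * v) ` verts F \<union> (\<lambda>v. 2 * v + 1) ` verts F,
     (\<lambda>e. (\<lambda>v. 2 * v) ` e) ` edges F \<union> (\<lambda>e. (\<lambda>v. 2 * v + 1) ` e) ` edges F)"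

lemma double_edge:
  "{u, v} \<in> edges (double F) \<longleftrightarrow>
    (\<exists>a b. u = 2 * a \<and> v = 2 * b \<and> {a, b} \<in> edges F) \<or> (\<exists>a b. u = 2 * a + 1 \<and> v = 2 * b + 1 \<and> {a, b} \<in> edges F)"
proof -
  have "{u, v} \<in> (\<lambda>e. f ` e) ` E \<longleftrightarrow> (\<exists>a b. u = f a \<and> v = f b \<and> {a, b} \<in> E)" if f: "inj f" for f :: "nat \<Rightarrow> nat" and E
  proof
    assume "{u, v} \<in> (\<lambda>e. f ` e) ` E"
    then obtain e where e: "e \<in> E" "{u, v} = f ` e" by auto
    then obtain a b where ab: "a \<in> e" "b \<in> e" "u = f a" "v = f b" by (metis imageE insertCI)
    have "e = {a, b}" using e(2) ab f by (metis image_empty image_insert inj_image_eq_iff)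
    then show "\<exists>a b. u = f a \<and> v = f b \<and> {a, b} \<in> E" using e(1) ab by blast
  next
    assume "\<exists>a b. u = f a \<and> v = f b \<and> {a, b} \<in> E"
    then obtain a b where "u = f a" "v = f b" "{a, b} \<in> E" by blast
    then show "{u, v} \<in> (\<lambda>e. f ` e) ` E" by (intro image_eqI[of _ _ "{a, b}"]) auto
  qed
  from this[of "\<lambda>v. 2 * v"] this[of "\<lambda>v. 2 * v + 1"] show ?thesis
    by (simp add: double_def inj_def)
qed

lemma double_simple:
  assumes "simple_graph F"
  shows "simple_graph (double F)" "card (verts (double F)) = 2 * card (verts F)"
proof -
  have inj: "inj_on (\<lambda>v. 2 * v :: nat) A" "inj_on (\<lambda>v. 2 * v + 1 :: nat) A" for A by (auto simp: inj_on_def)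
  show "simple_graph (double F)"
    unfolding simple_graph_def
  proof (intro conjI ballI)
    fix e assume "e \<in> edges (double F)"
    then obtain e0 f where e: "e0 \<in> edges F" "e = f ` e0" "inj f" "f ` verts F \<subseteq> verts (double F)"
      by (auto simp: double_def inj_def intro: that[of _ "\<lambda>v. 2 * v"] that[of _ "\<lambda>v. 2 * v + 1"])
    have "e0 \<subseteq> verts F" "card e0 = 2" using assms e(1) by (auto simp: simple_graph_def)
    then show "e \<subseteq> verts (double F)" "card e = 2"
      using e by (auto simp: card_image inj_on_subset)
  qed (use assms in \<open>auto simp: simple_graph_def double_def\<close>)
  have "(\<lambda>v. 2 * v) ` verts F \<inter> (\<lambda>v. 2 * v + 1) ` verts F = {}" by auto presburger
  then show "card (verts (double F)) = 2 * card (verts F)"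
    using assms inj[of "verts F"] by (simp add: double_def simple_graph_def card_Un_disjoint card_image)
qed

lemma hom_density_double:
  assumes F: "simple_graph F"
  shows "hom_density (double F) G = (hom_density F G)\<^sup>2"
proof -
  let ?V = "verts F"
  let ?split = "\<lambda>f. (\<lambda>v\<in>?V. f (2 * v), \<lambda>v\<in>?V. f (2 * v + 1))"
  let ?join = "\<lambda>(g, h). \<lambda>w\<in>verts (double F). if even w then g (w div 2) else h (w div 2)"
  have V2: "2 * v \<in> verts (double F) \<longleftrightarrow> v \<in> ?V" "2 * v + 1 \<in> verts (double F) \<longleftrightarrow> v \<in> ?V" for v
    by (auto simp: double_def) presburger+
  have E: "a \<in> ?V" "b \<in> ?V" if "{a, b} \<in> edges F" for a b
    using F that by (auto simp: simple_graph_def)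
  have dV: "w div 2 \<in> ?V" if "w \<in> verts (double F)" for w using that by (auto simp: double_def)
  have "bij_betw ?split (homs (double F) G) (homs F G \<times> homs F G)"
  proof (rule bij_betw_byWitness[where f'="?join"])
    show "\<forall>f\<in>homs (double F) G. ?join (?split f) = f"
    proof
      fix f assume f: "f \<in> homs (double F) G"
      show "?join (?split f) = f"
      proof
        fix w :: nat
        have "2 * (w div 2) = w" if "even w" using that by simp
        moreover have "2 * (w div 2) + 1 = w" if "odd w" using that by simp
        moreover have "f w = undefined" if "w \<notin> verts (double F)"
          using f that PiE_arb[of f "verts (double F)" _ w] unfolding homs_def by blast
        ultimately show "?join (?split f) w = f w"
          using dV[of w] unfolding restrict_def prod.case by metis
      qed
    qed
    show "\<forall>gh\<in>homs F G \<times> homs F G. ?split (?join gh) = gh"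
    proof
      fix gh assume "gh \<in> homs F G \<times> homs F G"
      then obtain g h where gh: "gh = (g, h)" and g: "g \<in> homs F G" and h: "h \<in> homs F G" by auto
      have arb: "g w = undefined" "h w = undefined" if "w \<notin> ?V" for w
        using g h that PiE_arb[of g ?V _ w] PiE_arb[of h ?V _ w] unfolding homs_def by blast+
      have "(\<lambda>v\<in>?V. ?join (g, h) (2 * v)) = g"
      proof
        fix v show "(\<lambda>v\<in>?V. ?join (g, h) (2 * v)) v = g v"
          using V2(1)[of v] arb(1)[of v] by (cases "v \<in> ?V") simp_all
      qed
      moreover have "(\<lambda>v\<in>?V. ?join (g, h) (2 * v + 1)) = h"
      proof
        fix v show "(\<lambda>v\<in>?V. ?join (g, h) (2 * v + 1)) v = h v"
          using V2(2)[of v] arb(2)[of v] by (cases "v \<in> ?V") simp_all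
      qed
      ultimately show "?split (?join gh) = gh" unfolding gh by (simp only: prod.case)
    qed
    show "?split ` homs (double F) G \<subseteq> homs F G \<times> homs F G"
    proof safe
      fix f assume f: "f \<in> homs (double F) G"
      then have fm: "f w \<in> verts G" if "w \<in> verts (double F)" for w using that by (auto simp: homs_def)
      have fe: "{f u, f v} \<in> edges G" if "{u, v} \<in> edges (double F)" for u v using f that by (auto simp: homs_def)
      show "(\<lambda>v\<in>?V. f (2 * v)) \<in> homs F G"
        using fm[of "2 * _"] fe[of "2 * _" "2 * _"] E by (auto simp: homs_def V2 double_edge)
      have "f (Suc (2 * v)) \<in> verts G" if "v \<in> ?V" for v using fm[of "2 * v + 1"] V2(2) that by simp
      moreover have "{f (Suc (2 * a)), f (Suc (2 * b))} \<in> edges G" if "{a, b} \<in> edges F" for a b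
        using fe[of "2 * a + 1" "2 * b + 1"] that unfolding double_edge by auto
      ultimately show "(\<lambda>v\<in>?V. f (2 * v + 1)) \<in> homs F G"
        using E by (auto simp: homs_def)
    qed
    show "?join ` (homs F G \<times> homs F G) \<subseteq> homs (double F) G"
    proof
      fix f assume "f \<in> ?join ` (homs F G \<times> homs F G)"
      then obtain g h where f: "f = ?join (g, h)" and g: "g \<in> homs F G" and h: "h \<in> homs F G" by blast
      have gh: "g v \<in> verts G" "h v \<in> verts G" if "v \<in> ?V" for v
        using g h PiE_mem[OF _ that] unfolding homs_def by blast+
      have mem: "?join (g, h) \<in> verts (double F) \<rightarrow>\<^sub>E verts G"
        using gh dV by auto
      have "{?join (g, h) u, ?join (g, h) v} \<in> edges G" if uv: "{u, v} \<in> edges (double F)" for u v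
        using uv unfolding double_edge
      proof (elim disjE exE conjE)
        fix a b assume ab: "u = 2 * a" "v = 2 * b" "{a, b} \<in> edges F"
        then show ?thesis using g E[OF ab(3)] V2(1) by (auto simp: homs_def)
      next
        fix a b assume ab: "u = 2 * a + 1" "v = 2 * b + 1" "{a, b} \<in> edges F"
        then show ?thesis using h E[OF ab(3)] V2(2)[of a] V2(2)[of b] by (auto simp: homs_def)
      qed
      with mem show "f \<in> homs (double F) G" unfolding f homs_def by blast
    qed
  qed
  then have "card (homs (double F) G) = card (homs F G) * card (homs F G)"
    by (simp add: bij_betw_same_card card_cartesian_product)
  then show ?thesis
    unfolding hom_density_eq[OF F] hom_density_eq[OF double_simple(1)[OF F]]
    by (simp add: double_simple(2)[OF F] power2_eq_square power_mult power_mult_distrib[symmetric])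
qed

section \<open>Comparing finitely many densities at a growing precision\<close>

lemma countable_simple_graphs: "countable {F. simple_graph F}"
proof -
  have "{F. simple_graph F} \<subseteq> (\<Union>V\<in>Collect finite. {V} \<times> Pow (Pow V))"
    by (force simp: simple_graph_def)
  moreover have "countable (\<Union>V\<in>(Collect finite :: nat set set). {V} \<times> Pow (Pow V))"
    by (intro countable_UN countable_Collect_finite countable_finite) auto
  ultimately show ?thesis by (rule countable_subset)
qed

definition graph_enum :: "nat \<Rightarrow> graph" where
  "graph_enum = from_nat_into {F. simple_graph F}"

lemma simple_graph_enum: "simple_graph (graph_enum i)"
proof -
  have "simple_graph ({}, {})" by (simp add: simple_graph_def)
  then have "{F. simple_graph F} \<noteq> {}" by blast
  from from_nat_into[OF this] show ?thesis by (simp add: graph_enum_def)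
qed

lemma graph_enum_surj: "simple_graph F \<Longrightarrow> \<exists>i. graph_enum i = F"
  unfolding graph_enum_def using from_nat_into_surj[OF countable_simple_graphs, of F] by blast

text \<open>The parameter \<open>j\<close> sets both the number of densities compared and the
  tolerance, so nearness along a growing \<open>j\<close> forces every single density to
  converge.\<close>

definition near :: "nat \<Rightarrow> (graph \<Rightarrow> real) \<Rightarrow> (graph \<Rightarrow> real) \<Rightarrow> bool" where
  "near j s t \<longleftrightarrow> (\<forall>i<j. \<bar>s (graph_enum i) - t (graph_enum i)\<bar> < 1 / (real j + 1))"

text \<open>
  From \<open>12 * card (verts F) ^ 2 / k\<close>, the bound on the variance of the density of \<open>F\<close> in a sample of size \<open>k\<close>,
  Chebyshev's inequality and the union bound.
\<close>

definition rate :: "nat \<Rightarrow> nat" where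
  "rate j = (j + 1) ^ 2 * (\<Sum>i<j. 12 * card (verts (graph_enum i)) ^ 2)"

text \<open>The finest comparison for which the failure probability \<open>rate j / k\<close> is at
  most 1/3. The condition \<open>j \<le> k\<close> keeps the set finite, and 0 always belongs to it.
  By \<open>precision_ge\<close> the precision tends to infinity with \<open>k\<close>.\<close>

definition precision :: "nat \<Rightarrow> nat" where
  "precision k = Max {j. j \<le> k \<and> 3 * rate j \<le> k}"

lemma precision_rate: "3 * rate (precision k) \<le> k"
proof -
  have "finite {j. j \<le> k \<and> 3 * rate j \<le> k}" "0 \<in> {j. j \<le> k \<and> 3 * rate j \<le> k}" by (auto simp: rate_def)
  then have "precision k \<in> {j. j \<le> k \<and> 3 * rate j \<le> k}" unfolding precision_def by (intro Max_in) auto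
  then show ?thesis by simp
qed

lemma precision_ge: "j \<le> k \<Longrightarrow> 3 * rate j \<le> k \<Longrightarrow> j \<le> precision k"
  unfolding precision_def by (intro Max_ge) auto

lemma near_tendsto:
  assumes k: "\<And>n. n \<le> k n" and near: "\<And>n. near (precision (k n)) (s n) (t n)" and F: "simple_graph F"
  shows "(\<lambda>n. s n F - t n F) \<longlonglongrightarrow> 0"
proof (rule LIMSEQ_I)
  fix e :: real assume e: "0 < e"
  obtain i where i: "graph_enum i = F" using graph_enum_surj[OF F] by blast
  obtain N where N: "1 / e < real N" using reals_Archimedean2 by blast
  define j where "j = max N (Suc i)"
  have "norm (s n F - t n F - 0) < e" if n: "max j (3 * rate j) \<le> n" for n
  proof -
    have pj: "j \<le> precision (k n)" using n k[of n] by (intro precision_ge) auto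
    then have "\<bar>s n F - t n F\<bar> < 1 / (real (precision (k n)) + 1)"
      using near[of n] i unfolding near_def j_def by force
    also have "\<dots> \<le> 1 / (real N + 1)" using pj by (intro divide_left_mono) (auto simp: j_def)
    also have "\<dots> < e" using N e by (simp add: field_simps)
    finally show ?thesis by simp
  qed
  then show "\<exists>no. \<forall>n\<ge>no. norm (s n F - t n F - 0) < e" by blast
qed

text \<open>Stated for an arbitrary law \<open>M\<close> of the sample, with \<open>\<tau>\<close>
  the densities of the sampled object, so that it covers sampling from a function and from a graph.
  A bound on the mean alone suffices: the mean of the density of \<open>double F\<close> is the
  second moment of that of \<open>F\<close>. The constant 2 is the one of
  \<open>subset_mean\<close>.\<close>

lemma density_concentration:
  fixes M :: "graph measure" and \<tau> :: "graph \<Rightarrow> real"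
  assumes M: "prob_space M" "sets M = UNIV" and k: "1 \<le> k"
    and fin: "AE H in M. finite (verts H)"
    and \<tau>: "\<And>F. simple_graph F \<Longrightarrow> \<tau> F \<in> {0..1}" "\<And>F. simple_graph F \<Longrightarrow> \<tau> (double F) = (\<tau> F)\<^sup>2"
    and mean: "\<And>F. simple_graph F \<Longrightarrow> \<bar>(LINT H|M. hom_density F H) - \<tau> F\<bar> \<le> 2 * real (card (verts F)) ^ 2 / real k"
  shows "2 / 3 \<le> measure M {H. near (precision k) (\<lambda>F. hom_density F H) \<tau>}"
proof -
  interpret M: prob_space M by (rule M(1))
  have space: "space M = UNIV" using M(2) sets.sets_into_space by blast
  have meas [measurable]: "f \<in> borel_measurable M" for f :: "graph \<Rightarrow> real"
    by (rule measurableI) (auto simp: M(2))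
  have ev: "A \<in> sets M" for A by (simp add: M(2))
  define j where "j = precision k"
  let ?bad = "\<lambda>i. {H. 1 / (real j + 1) \<le> \<bar>hom_density (graph_enum i) H - \<tau> (graph_enum i)\<bar>}"
  have bad: "measure M (?bad i) \<le> (real j + 1) ^ 2 * (12 * real (card (verts (graph_enum i))) ^ 2 / real k)" for i
  proof -
    let ?F = "graph_enum i"
    define d where "d = real (card (verts ?F)) ^ 2 / real k"
    note F = simple_graph_enum[of i]
    have bnd: "AE H in M. norm (hom_density F H) \<le> 1" if "simple_graph F" for F
      using fin by eventually_elim (use hom_density_01[OF that] in auto)
    have int1: "integrable M (hom_density F)" if "simple_graph F" for F
      by (rule M.integrable_const_bound[OF bnd[OF that]]) simp
    have int2: "integrable M (\<lambda>H. (hom_density ?F H)\<^sup>2)"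
      using int1[OF double_simple(1)[OF F]] unfolding hom_density_double[OF F, abs_def] .
    let ?t = "\<tau> ?F"
    have t: "0 \<le> ?t" "?t \<le> 1" using \<tau>(1)[OF F] by auto
    have e1: "\<bar>(LINT H|M. hom_density ?F H) - ?t\<bar> \<le> 2 * d"
      using mean[OF F] by (simp add: d_def)
    \<comment> \<open>\<open>double F\<close> has twice as many nodes, so its error is
      \<open>2 * 2 ^ 2 * d\<close>, that is \<open>8 * d\<close>. The cross term of the variance
      adds at most \<open>4 * d\<close>, which makes the 12 in \<open>rate\<close>.\<close>
    have e2: "(LINT H|M. (hom_density ?F H)\<^sup>2) \<le> ?t\<^sup>2 + 8 * d"
      using mean[OF double_simple(1)[OF F]] \<tau>(2)[OF F]
      by (simp add: hom_density_double[OF F] double_simple(2)[OF F] d_def power_mult_distrib)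
    have "(LINT H|M. (hom_density ?F H - ?t)\<^sup>2) =
      (LINT H|M. (hom_density ?F H)\<^sup>2 - 2 * ?t * hom_density ?F H + ?t\<^sup>2)"
      by (intro Bochner_Integration.integral_cong refl) (simp add: power2_eq_square algebra_simps)
    also have "\<dots> = (LINT H|M. (hom_density ?F H)\<^sup>2) - 2 * ?t * (LINT H|M. hom_density ?F H) + ?t\<^sup>2"
      using int1[OF F] int2 by (simp add: M.prob_space)
    also have "\<dots> \<le> 12 * d"
    proof -
      have "?t * (?t - 2 * d) \<le> ?t * (LINT H|M. hom_density ?F H)"
        using e1 t by (intro mult_left_mono) auto
      moreover have "?t * d \<le> 1 * d"
        using t by (intro mult_right_mono) (auto simp: d_def)
      ultimately show ?thesis using e2 by (simp add: power2_eq_square algebra_simps)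
    qed
    finally have var: "(LINT H|M. (hom_density ?F H - ?t)\<^sup>2) \<le> 12 * d" .
    have int: "integrable M (\<lambda>H. (hom_density ?F H - ?t)\<^sup>2)"
    proof -
      have "(\<lambda>H. (hom_density ?F H - ?t)\<^sup>2) = (\<lambda>H. (hom_density ?F H)\<^sup>2 - 2 * ?t * hom_density ?F H + ?t\<^sup>2)"
        by (simp add: fun_eq_iff power2_eq_square algebra_simps)
      then show ?thesis using int1[OF F] int2 by simp
    qed
    have "?bad i \<subseteq> {H \<in> space M. (1 / (real j + 1))\<^sup>2 \<le> (hom_density ?F H - ?t)\<^sup>2}"
    proof
      fix H assume "H \<in> ?bad i"
      then have "1 / (real j + 1) \<le> \<bar>hom_density ?F H - ?t\<bar>" by simp
      then have "(1 / (real j + 1))\<^sup>2 \<le> \<bar>hom_density ?F H - ?t\<bar>\<^sup>2" by (rule power_mono) simp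
      then show "H \<in> {H \<in> space M. (1 / (real j + 1))\<^sup>2 \<le> (hom_density ?F H - ?t)\<^sup>2}" by (simp add: space)
    qed
    then have "measure M (?bad i) \<le> measure M {H \<in> space M. (1 / (real j + 1))\<^sup>2 \<le> (hom_density ?F H - ?t)\<^sup>2}"
      by (rule M.finite_measure_mono) (rule ev)
    also have "\<dots> \<le> (LINT H|M. (hom_density ?F H - ?t)\<^sup>2) / (1 / (real j + 1))\<^sup>2"
      by (rule integral_Markov_inequality_measure[OF int ev]) auto
    also have "\<dots> \<le> (12 * d) / (1 / (real j + 1))\<^sup>2"
      using var by (intro divide_right_mono) auto
    finally show ?thesis by (simp add: d_def power_divide mult.commute)
  qed
  have "measure M (\<Union>i<j. ?bad i) \<le> (\<Sum>i<j. measure M (?bad i))"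
    by (rule M.finite_measure_subadditive_finite) (auto simp: M(2))
  also have "\<dots> \<le> (\<Sum>i<j. (real j + 1) ^ 2 * (12 * real (card (verts (graph_enum i))) ^ 2 / real k))"
    by (intro sum_mono bad)
  also have "\<dots> = real (rate j) / real k"
    by (simp add: rate_def sum_distrib_left sum_divide_distrib add.commute)
  also have "\<dots> \<le> 1 / 3"
  proof -
    have "real (3 * rate j) \<le> real k" using precision_rate[of k] unfolding j_def by (simp only: of_nat_le_iff)
    then show ?thesis using k by (simp add: field_simps)
  qed
  finally have "measure M (space M - (\<Union>i<j. ?bad i)) \<ge> 2 / 3"
    by (subst M.prob_compl[OF ev]) simp
  also have "space M - (\<Union>i<j. ?bad i) = {H. near (precision k) (\<lambda>F. hom_density F H) \<tau>}"
    by (auto simp: near_def j_def space not_le)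
  finally show ?thesis .
qed

subsection \<open>Sampling from functions\<close>

lemma cube_reindex:
  fixes g :: "(nat \<Rightarrow> real) \<Rightarrow> real"
  assumes "inj_on \<phi> V" "\<phi> ` V \<subseteq> K" "g \<in> borel_measurable (cube V)"
  shows "(LINT x|cube K. g (\<lambda>i\<in>V. x (\<phi> i))) = (LINT x|cube V. g x)"
proof -
  have m: "(\<lambda>x. \<lambda>i\<in>V. x (\<phi> i)) \<in> cube K \<rightarrow>\<^sub>M cube V"
    using assms(2) by (intro measurable_restrict measurable_component_singleton) auto
  have "distr (cube K) (cube V) (\<lambda>x. \<lambda>i\<in>V. x (\<phi> i)) = cube V"
    using assms(1,2) prob_space_I01 by (intro distr_PiM_reindex) auto
  then have "(LINT x|cube V. g x) = (LINT x|distr (cube K) (cube V) (\<lambda>x. \<lambda>i\<in>V. x (\<phi> i)). g x)" by simp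
  also have "\<dots> = (LINT x|cube K. g (\<lambda>i\<in>V. x (\<phi> i)))" by (rule integral_distr[OF m assms(3)])
  finally show ?thesis ..
qed

lemma edge_prod_01:
  assumes "borel_version W V"
  shows "0 \<le> edge_prod F V x" "edge_prod F V x \<le> 1"
  using borel_version_bounds[OF assms] unfolding edge_prod_def case_prod_beta
  by (auto intro!: prod_nonneg prod_le_1)

lemma edge_prod_integrable:
  assumes "simple_graph F" "borel_version W V"
  shows "integrable (cube (verts F)) (edge_prod F V)"
proof -
  interpret prob_space "cube (verts F)" by (rule prob_space_cube)
  show ?thesis
    using edge_prod_01[OF assms(2)] edge_prod_measurable[OF assms(1) borel_versionD[OF assms(2)]]
    by (intro integrable_const_bound[where B=1]) auto
qed

lemma ordered_edges_double:
  "ordered_edges (double F) = (\<lambda>(a, b). (2 * a, 2 * b)) ` ordered_edges F \<union> (\<lambda>(a, b). (2 * a + 1, 2 * b + 1)) ` ordered_edges F"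
  unfolding ordered_edges_def double_edge by auto

lemma edge_prod_double:
  assumes F: "simple_graph F"
  shows "edge_prod (double F) V x = edge_prod F V (\<lambda>i\<in>verts F. x (2 * i)) * edge_prod F V (\<lambda>i\<in>verts F. x (2 * i + 1))"
proof -
  let ?E = "ordered_edges F"
  have fin: "finite ?E" by (rule finite_ordered_edges[OF F])
  have mem: "a \<in> verts F" "b \<in> verts F" if "(a, b) \<in> ?E" for a b
    using ordered_edges_subset[OF F] that by auto
  have "edge_prod (double F) V x = (\<Prod>(i, j)\<in>(\<lambda>(a, b). (2 * a, 2 * b)) ` ?E. V (x i, x j)) *
     (\<Prod>(i, j)\<in>(\<lambda>(a, b). (2 * a + 1, 2 * b + 1)) ` ?E. V (x i, x j))"
    unfolding edge_prod_def ordered_edges_double using fin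
    by (intro prod.union_disjoint) (auto, presburger+)
  also have "(\<Prod>(i, j)\<in>(\<lambda>(a, b). (2 * a, 2 * b)) ` ?E. V (x i, x j)) = edge_prod F V (\<lambda>i\<in>verts F. x (2 * i))"
    unfolding edge_prod_def by (subst prod.reindex) (auto simp: inj_on_def mem intro!: prod.cong)
  also have "(\<Prod>(i, j)\<in>(\<lambda>(a, b). (2 * a + 1, 2 * b + 1)) ` ?E. V (x i, x j)) = edge_prod F V (\<lambda>i\<in>verts F. x (2 * i + 1))"
    unfolding edge_prod_def by (subst prod.reindex) (auto simp: inj_on_def mem intro!: prod.cong)
  finally show ?thesis .
qed

lemma fun_density_double:
  assumes F: "simple_graph F" and W: "W \<in> W0"
  shows "fun_density (double F) W = (fun_density F W)\<^sup>2"
proof -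
  interpret P: product_prob_space "\<lambda>_. I01" UNIV by (rule product_prob_space_I01)
  obtain V where V: "borel_version W V" using borel_version_exists[OF W] .
  let ?A = "(\<lambda>v. 2 * v) ` verts F" and ?B = "(\<lambda>v. 2 * v + 1) ` verts F"
  let ?g = "edge_prod F V"
  have AB: "?A \<inter> ?B = {}" by auto presburger
  have fin: "finite ?A" "finite ?B" using F by (auto simp: simple_graph_def)
  have vd: "verts (double F) = ?A \<union> ?B" by (simp add: double_def)
  have g: "?g \<in> borel_measurable (cube (verts F))"
    by (rule edge_prod_measurable[OF F borel_versionD[OF V]])
  have "fun_density (double F) W = (LINT x|cube (?A \<union> ?B). edge_prod (double F) V x)"
    by (simp only: fun_density_borel_version[OF double_simple(1)[OF F] V] vd)
  also have "\<dots> = (LINT x|cube ?A. LINT y|cube ?B. edge_prod (double F) V (merge ?A ?B (x, y)))"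
    using edge_prod_integrable[OF double_simple(1)[OF F] V] unfolding vd
    by (intro P.product_integral_fold AB fin)
  also have "\<dots> = (LINT x|cube ?A. LINT y|cube ?B. ?g (\<lambda>i\<in>verts F. x (2 * i)) * ?g (\<lambda>i\<in>verts F. y (2 * i + 1)))"
  proof (intro Bochner_Integration.integral_cong refl)
    fix x y :: "nat \<Rightarrow> real"
    have m: "merge ?A ?B (x, y) (2 * i) = x (2 * i)" "merge ?A ?B (x, y) (2 * i + 1) = y (2 * i + 1)" if "i \<in> verts F" for i
      using AB that by (auto simp: merge_def)
    have "(\<lambda>i\<in>verts F. merge ?A ?B (x, y) (2 * i)) = (\<lambda>i\<in>verts F. x (2 * i))"
      "(\<lambda>i\<in>verts F. merge ?A ?B (x, y) (2 * i + 1)) = (\<lambda>i\<in>verts F. y (2 * i + 1))"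
      using m by (simp_all only: restrict_def fun_eq_iff if_split) auto
    then show "edge_prod (double F) V (merge ?A ?B (x, y)) = ?g (\<lambda>i\<in>verts F. x (2 * i)) * ?g (\<lambda>i\<in>verts F. y (2 * i + 1))"
      by (simp only: edge_prod_double[OF F])
  qed
  also have "\<dots> = (LINT x|cube ?A. ?g (\<lambda>i\<in>verts F. x (2 * i))) * (LINT y|cube ?B. ?g (\<lambda>i\<in>verts F. y (2 * i + 1)))"
    by simp
  also have "\<dots> = (LINT x|cube (verts F). ?g x) * (LINT x|cube (verts F). ?g x)"
    using cube_reindex[of "\<lambda>i. 2 * i" "verts F" ?A ?g] cube_reindex[of "\<lambda>i. 2 * i + 1" "verts F" ?B ?g] g
    by (simp add: inj_on_def)
  finally show ?thesis by (simp add: fun_density_borel_version[OF F V] power2_eq_square)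
qed

lemma fun_density_01:
  assumes F: "simple_graph F" and W: "W \<in> W0"
  shows "fun_density F W \<in> {0..1}"
proof -
  obtain V where V: "borel_version W V" using borel_version_exists[OF W] .
  interpret prob_space "cube (verts F)" by (rule prob_space_cube)
  have "0 \<le> (LINT x|cube (verts F). edge_prod F V x)"
    using edge_prod_01[OF V] by (intro integral_nonneg_AE) auto
  moreover have "(LINT x|cube (verts F). edge_prod F V x) \<le> (LINT x|cube (verts F). 1)"
    using edge_prod_01[OF V] by (intro integral_mono edge_prod_integrable[OF F V]) auto
  ultimately show ?thesis by (simp add: fun_density_borel_version[OF F V] prob_space)
qed

section \<open>The random graph for given edge probabilities\<close>

definition coin_outcome :: "nat \<Rightarrow> (nat \<times> nat \<Rightarrow> bool) \<Rightarrow> graph" where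
  "coin_outcome k b = ({1..k}, {{i, j} | i j. (i, j) \<in> node_pairs k \<and> b (i, j)})"

lemma finite_node_pairs: "finite (node_pairs k)"
  by (rule finite_subset[of _ "{1..k} \<times> {1..k}"]) (auto simp: node_pairs_def)

lemma coin_graph_eq:
  "coin_graph k p = map_pmf (coin_outcome k) (Pi_pmf (node_pairs k) False (\<lambda>ij. bernoulli_pmf (p ij)))"
  by (simp add: coin_graph_def coin_outcome_def[abs_def])

text \<open>An explicit polynomial in the edge probabilities, from which
  \<open>coin_kernel_measurable\<close> reads off that the law depends measurably on the sampled
  points.\<close>

lemma coin_graph_prob:
  assumes p: "\<And>e. e \<in> node_pairs k \<Longrightarrow> p e \<in> {0..1}"
  shows "measure_pmf.prob (coin_graph k p) A =
    (\<Sum>b\<in>PiE_dflt (node_pairs k) False (\<lambda>_. UNIV). (\<Prod>e\<in>node_pairs k. if b e then p e else 1 - p e) * indicator A (coin_outcome k b))"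
proof -
  let ?N = "node_pairs k" and ?Q = "Pi_pmf (node_pairs k) False (\<lambda>ij. bernoulli_pmf (p ij))"
  let ?B = "PiE_dflt ?N False (\<lambda>_. UNIV :: bool set)"
  note fN = finite_node_pairs[of k]
  have finB: "finite ?B" using fN by (intro finite_PiE_dflt) auto
  have sub: "set_pmf ?Q \<subseteq> ?B" using set_Pi_pmf_subset[OF fN, of False "\<lambda>ij. bernoulli_pmf (p ij)"] by (auto simp: PiE_dflt_def)
  have "measure_pmf.prob (coin_graph k p) A = measure_pmf.prob ?Q (coin_outcome k -` A)"
    by (simp add: coin_graph_eq)
  also have "\<dots> = measure_pmf.prob ?Q (?B \<inter> coin_outcome k -` A)"
    using sub by (intro measure_prob_cong_0) (auto simp: set_pmf_iff)
  also have "\<dots> = (\<Sum>b\<in>?B \<inter> coin_outcome k -` A. pmf ?Q b)"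
    using finB by (intro measure_measure_pmf_finite) auto
  also have "\<dots> = (\<Sum>b\<in>?B. pmf ?Q b * indicator A (coin_outcome k b))"
    using finB by (intro sum.mono_neutral_cong_left) (auto split: split_indicator)
  also have "\<dots> = (\<Sum>b\<in>?B. (\<Prod>e\<in>?N. if b e then p e else 1 - p e) * indicator A (coin_outcome k b))"
  proof (intro sum.cong refl arg_cong2[where f="(*)"])
    fix b assume b: "b \<in> ?B"
    have "pmf ?Q b = (\<Prod>e\<in>?N. pmf (bernoulli_pmf (p e)) (b e))"
      using b by (intro pmf_Pi' fN) (auto simp: PiE_dflt_def)
    also have "\<dots> = (\<Prod>e\<in>?N. if b e then p e else 1 - p e)"
      using p by (intro prod.cong refl) auto
    finally show "pmf ?Q b = (\<Prod>e\<in>?N. if b e then p e else 1 - p e)" .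
  qed
  finally show ?thesis .
qed

lemma coin_outcome_edge: "(i, j) \<in> node_pairs k \<Longrightarrow> {i, j} \<in> edges (coin_outcome k b) \<longleftrightarrow> b (i, j)"
  by (auto simp: coin_outcome_def node_pairs_def doubleton_eq_iff)

text \<open>The condition on edges alone, which for a fixed map is an event about the random
  graph.\<close>

definition is_hom :: "graph \<Rightarrow> (nat \<Rightarrow> nat) \<Rightarrow> graph \<Rightarrow> bool" where
  "is_hom F f H \<longleftrightarrow> (\<forall>u v. {u, v} \<in> edges F \<longrightarrow> {f u, f v} \<in> edges H)"

lemma is_hom_ordered:
  assumes "simple_graph F"
  shows "is_hom F f H \<longleftrightarrow> (\<forall>(u, v)\<in>ordered_edges F. {f u, f v} \<in> edges H)"
proof
  assume h: "\<forall>(u, v)\<in>ordered_edges F. {f u, f v} \<in> edges H"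
  show "is_hom F f H"
    unfolding is_hom_def
  proof (intro allI impI)
    fix u v assume uv: "{u, v} \<in> edges F"
    then have "u \<noteq> v" using assms by (auto simp: simple_graph_def)
    then consider "(u, v) \<in> ordered_edges F" | "(v, u) \<in> ordered_edges F"
      using uv by (cases u v rule: linorder_cases) (auto simp: ordered_edges_def insert_commute)
    then show "{f u, f v} \<in> edges H" using h by cases (auto simp: insert_commute)
  qed
qed (auto simp: is_hom_def ordered_edges_def)

text \<open>Injectivity of \<open>f\<close> sends distinct edges of \<open>F\<close> to distinct
  pairs, so the coins involved are independent. Coins are indexed by pairs in increasing order,
  hence \<open>min\<close> and \<open>max\<close>.\<close>

lemma coin_graph_hom:
  assumes F: "simple_graph F" and f: "f \<in> verts F \<rightarrow>\<^sub>E {1..k}" "inj_on f (verts F)"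
    and p: "\<And>e. e \<in> node_pairs k \<Longrightarrow> p e \<in> {0..1}"
  shows "measure_pmf.prob (coin_graph k p) {H. is_hom F f H} = (\<Prod>(u, v)\<in>ordered_edges F. p (min (f u) (f v), max (f u) (f v)))"
proof -
  let ?N = "node_pairs k" and ?E = "ordered_edges F"
  define h where "h = (\<lambda>(u, v). (min (f u) (f v), max (f u) (f v)))"
  have mem: "u \<in> verts F" "v \<in> verts F" "u < v" if "(u, v) \<in> ?E" for u v
    using ordered_edges_subset[OF F] that by (auto simp: ordered_edges_def)
  have hN: "h ` ?E \<subseteq> ?N"
  proof (rule image_subsetI)
    fix e assume "e \<in> ?E"
    then obtain u v where e: "e = (u, v)" and uv: "(u, v) \<in> ?E" by (cases e) auto
    have "f u \<in> {1..k}" "f v \<in> {1..k}" using PiE_mem[OF f(1)] mem[OF uv] by auto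
    moreover have "f u \<noteq> f v" using inj_onD[OF f(2), of u v] mem[OF uv] by auto
    ultimately show "h e \<in> ?N" by (auto simp: e h_def node_pairs_def)
  qed
  have inj: "inj_on h ?E"
  proof (rule inj_onI)
    fix e e' assume ee: "e \<in> ?E" "e' \<in> ?E" and "h e = h e'"
    moreover obtain u v u' v' where e: "e = (u, v)" "e' = (u', v')" by (cases e; cases e')
    ultimately have uv: "(u, v) \<in> ?E" "(u', v') \<in> ?E" and eq: "h (u, v) = h (u', v')" by auto
    then have "{f u, f v} = {f u', f v'}" by (auto simp: h_def min_def max_def split: if_splits)
    then have "f ` {u, v} = f ` {u', v'}" by simp
    then have "{u, v} = {u', v'}" using mem[OF uv(1)] mem[OF uv(2)] by (subst (asm) inj_on_image_eq_iff[OF f(2)]) auto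
    then show "e = e'" using mem[OF uv(1)] mem[OF uv(2)] by (auto simp: e doubleton_eq_iff)
  qed
  have edge: "{f u, f v} \<in> edges (coin_outcome k b) \<longleftrightarrow> b (h (u, v))" if uv: "(u, v) \<in> ?E" for u v b
  proof -
    have "h (u, v) \<in> ?N" using hN uv by blast
    moreover have "{f u, f v} = {min (f u) (f v), max (f u) (f v)}" by (auto simp: min_def max_def)
    ultimately show ?thesis by (simp add: h_def coin_outcome_edge)
  qed
  have "measure_pmf.prob (coin_graph k p) {H. is_hom F f H} =
     measure_pmf.prob (Pi_pmf ?N False (\<lambda>ij. bernoulli_pmf (p ij))) (Pi ?N (\<lambda>e. if e \<in> h ` ?E then {True} else UNIV))"
    unfolding coin_graph_eq measure_map_pmf
  proof (rule arg_cong[where f="measure_pmf.prob _"])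
    have "is_hom F f (coin_outcome k b) \<longleftrightarrow> (\<forall>e\<in>h ` ?E. b e)" for b
      unfolding is_hom_ordered[OF F] using edge by fastforce
    moreover have "b \<in> Pi ?N (\<lambda>e. if e \<in> h ` ?E then {True} else UNIV) \<longleftrightarrow> (\<forall>e\<in>h ` ?E. b e)" for b
    proof
      assume b: "b \<in> Pi ?N (\<lambda>e. if e \<in> h ` ?E then {True} else UNIV)"
      show "\<forall>e\<in>h ` ?E. b e"
      proof
        fix e assume e: "e \<in> h ` ?E"
        then have "e \<in> ?N" using hN by blast
        from Pi_mem[OF b this] e show "b e" by simp
      qed
    qed (auto simp: Pi_iff simp del: ball_simps)
    ultimately show "coin_outcome k -` {H. is_hom F f H} = Pi ?N (\<lambda>e. if e \<in> h ` ?E then {True} else UNIV)"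
      by (intro set_eqI) (simp only: vimage_eq mem_Collect_eq)
  qed
  also have "\<dots> = (\<Prod>e\<in>?N. measure_pmf.prob (bernoulli_pmf (p e)) (if e \<in> h ` ?E then {True} else UNIV))"
    by (rule measure_Pi_pmf_Pi[OF finite_node_pairs])
  also have "\<dots> = (\<Prod>e\<in>?N. if e \<in> h ` ?E then p e else 1)"
    using p by (intro prod.cong refl) (auto simp: measure_pmf_single)
  also have "\<dots> = (\<Prod>e\<in>h ` ?E. p e)"
    using hN finite_node_pairs[of k] by (simp add: prod.If_cases Int_absorb1)
  also have "\<dots> = (\<Prod>(u, v)\<in>?E. p (min (f u) (f v), max (f u) (f v)))"
    using inj by (subst prod.reindex) (auto simp: h_def case_prod_beta)
  finally show ?thesis .
qed

abbreviation edge_probs :: "(real \<times> real \<Rightarrow> real) \<Rightarrow> (nat \<Rightarrow> real) \<Rightarrow> nat \<times> nat \<Rightarrow> real" where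
  "edge_probs W x \<equiv> \<lambda>(i, j). W (x i, x j)"

lemma edge_probs_01:
  assumes "W \<in> W0" "x \<in> space (cube {1..k})" "e \<in> node_pairs k"
  shows "edge_probs W x e \<in> {0..1}"
proof -
  obtain i j where e: "e = (i, j)" "i \<in> {1..k}" "j \<in> {1..k}" using assms(3) by (cases e) (auto simp: node_pairs_def)
  then have "x i \<in> {0..1}" "x j \<in> {0..1}" using assms(2) by (auto simp: space_PiM PiE_iff)
  then show ?thesis using W0_D(2)[OF assms(1)] by (simp add: e)
qed

lemma coin_kernel_measurable:
  assumes W: "W \<in> W0"
  shows "(\<lambda>x. measure_pmf (coin_graph k (edge_probs W x))) \<in> completion (cube {1..k}) \<rightarrow>\<^sub>M subprob_algebra (count_space UNIV)"
proof (rule measurable_subprob_algebra)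
  fix x show "subprob_space (measure_pmf (coin_graph k (edge_probs W x)))" by unfold_locales
  show "sets (measure_pmf (coin_graph k (edge_probs W x))) = sets (count_space UNIV)" by simp
next
  fix A :: "graph set"
  let ?B = "PiE_dflt (node_pairs k) False (\<lambda>_. UNIV :: bool set)"
  obtain V where V: "borel_version W V" using borel_version_exists[OF W] .
  have Wm: "(\<lambda>x. edge_probs W x e) \<in> borel_measurable (completion (cube {1..k}))" if e: "e \<in> node_pairs k" for e
  proof -
    obtain i j where ij: "e = (i, j)" "i \<in> {1..k}" "j \<in> {1..k}" "i \<noteq> j" using e by (cases e) (auto simp: node_pairs_def)
    have "(\<lambda>x. V (x i, x j)) \<in> borel_measurable (cube {1..k})"
      by (rule measurable_compose[OF measurable_cube_pair[OF ij(2,3)] borel_versionD[OF V]])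
    moreover have "AE x in cube {1..k}. W (x i, x j) = V (x i, x j)"
      by (rule AE_cube_pair[OF _ ij(2,3,4) borel_version_AE[OF V]]) simp
    ultimately show ?thesis unfolding ij(1) prod.case by (rule AE_eq_imp_measurable_completion)
  qed
  have Pm: "(\<lambda>x. \<Sum>b\<in>?B. (\<Prod>e\<in>node_pairs k. if b e then edge_probs W x e else 1 - edge_probs W x e) * indicator A (coin_outcome k b))
      \<in> borel_measurable (completion (cube {1..k}))"
  proof (intro borel_measurable_sum borel_measurable_times borel_measurable_prod borel_measurable_const)
    fix b :: "nat \<times> nat \<Rightarrow> bool" and e assume "e \<in> node_pairs k"
    then show "(\<lambda>x. if b e then edge_probs W x e else 1 - edge_probs W x e) \<in> borel_measurable (completion (cube {1..k}))"
      using Wm[of e] by (cases "b e") simp_all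
  qed
  have "(\<lambda>x. ennreal (measure_pmf.prob (coin_graph k (edge_probs W x)) A)) \<in> borel_measurable (completion (cube {1..k}))"
  proof (rule measurable_compose[OF _ measurable_ennreal])
    have "measure_pmf.prob (coin_graph k (edge_probs W x)) A =
      (\<Sum>b\<in>?B. (\<Prod>e\<in>node_pairs k. if b e then edge_probs W x e else 1 - edge_probs W x e) * indicator A (coin_outcome k b))"
      if "x \<in> space (completion (cube {1..k}))" for x
      using that edge_probs_01[OF W] by (intro coin_graph_prob) simp
    then show "(\<lambda>x. measure_pmf.prob (coin_graph k (edge_probs W x)) A) \<in> borel_measurable (completion (cube {1..k}))"
      using Pm by (subst measurable_cong)
  qed
  then show "(\<lambda>x. emeasure (measure_pmf (coin_graph k (edge_probs W x))) A) \<in> borel_measurable (completion (cube {1..k}))"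
    by (simp add: measure_pmf.emeasure_eq_measure)
qed

lemma prob_space_completion_cube: "prob_space (completion (cube V))"
  by (rule prob_space.prob_space_completion[OF prob_space_cube])

lemma sample_graph_eq:
  "sample_graph k W = completion (cube {1..k}) \<bind> (\<lambda>x. measure_pmf (coin_graph k (edge_probs W x)))"
  by (simp add: sample_graph_def unit_cube_def)

lemma sample_graph_measure:
  assumes W: "W \<in> W0"
  shows "measure (sample_graph k W) A = (LINT x|completion (cube {1..k}). measure_pmf.prob (coin_graph k (edge_probs W x)) A)"
proof -
  interpret C: prob_space "completion (cube {1..k})" by (rule prob_space_completion_cube)
  show ?thesis unfolding sample_graph_eq
    by (rule C.measure_bind[OF coin_kernel_measurable[OF W]]) simp
qed

lemma sample_graph_prob_space:
  assumes W: "W \<in> W0"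
  shows "prob_space (sample_graph k W)" "sets (sample_graph k W) = UNIV"
proof -
  interpret C: prob_space "completion (cube {1..k})" by (rule prob_space_completion_cube)
  show "prob_space (sample_graph k W)" unfolding sample_graph_eq
    by (rule C.prob_space_bind[OF _ coin_kernel_measurable[OF W]]) (auto intro: AE_I2 measure_pmf.prob_space_axioms)
  show "sets (sample_graph k W) = UNIV" unfolding sample_graph_eq
    using C.not_empty by (subst sets_bind[where N="count_space UNIV"]) auto
qed

lemma sample_graph_verts:
  assumes W: "W \<in> W0"
  shows "AE H in sample_graph k W. verts H = {1..k}"
proof -
  interpret S: prob_space "sample_graph k W" by (rule sample_graph_prob_space(1)[OF W])
  interpret C: prob_space "completion (cube {1..k})" by (rule prob_space_completion_cube)
  have "measure_pmf.prob (coin_graph k p) {H. verts H = {1..k}} = 1" for p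
    unfolding coin_graph_eq measure_map_pmf by (simp add: coin_outcome_def vimage_def)
  then have "measure (sample_graph k W) {H. verts H = {1..k}} = 1"
    using C.prob_space by (simp add: sample_graph_measure[OF W])
  from S.AE_prob_1[OF this] show ?thesis by simp
qed

text \<open>For an injective \<open>f\<close> the points \<open>x (f v)\<close> are again
  independent and uniform, so averaging the product of edge probabilities over them gives the
  density exactly. Symmetry of \<open>W\<close> removes the ordering of the pairs.\<close>

lemma sample_graph_hom:
  assumes W: "W \<in> W0" and F: "simple_graph F" and f: "f \<in> verts F \<rightarrow>\<^sub>E {1..k}" "inj_on f (verts F)"
  shows "measure (sample_graph k W) {H. is_hom F f H} = fun_density F W"
proof -
  obtain V where V: "borel_version W V" using borel_version_exists[OF W] .
  let ?C = "cube {1..k}" and ?E = "ordered_edges F"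
  have mem: "u \<in> verts F" "v \<in> verts F" "f u \<in> {1..k}" "f v \<in> {1..k}" "f u \<noteq> f v" if "(u, v) \<in> ?E" for u v
  proof -
    show uv: "u \<in> verts F" "v \<in> verts F" using ordered_edges_subset[OF F] that by auto
    show "f u \<in> {1..k}" "f v \<in> {1..k}" using PiE_mem[OF f(1)] uv by auto
    show "f u \<noteq> f v" using inj_onD[OF f(2) _ uv] that by (auto simp: ordered_edges_def)
  qed
  let ?g = "\<lambda>x. \<Prod>(u, v)\<in>?E. edge_probs W x (min (f u) (f v), max (f u) (f v))"
  let ?h = "\<lambda>x. edge_prod F V (\<lambda>i\<in>verts F. x (f i))"
  have m: "(\<lambda>x. \<lambda>i\<in>verts F. x (f i)) \<in> ?C \<rightarrow>\<^sub>M cube (verts F)"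
    using PiE_mem[OF f(1)] by (intro measurable_restrict measurable_component_singleton) auto
  have hm: "?h \<in> borel_measurable ?C"
    by (rule measurable_compose[OF m edge_prod_measurable[OF F borel_versionD[OF V]]])
  have "AE x in ?C. \<forall>e\<in>?E. W (x (f (fst e)), x (f (snd e))) = V (x (f (fst e)), x (f (snd e)))"
  proof (intro AE_finite_allI finite_ordered_edges F)
    fix e assume "e \<in> ?E"
    then have "(fst e, snd e) \<in> ?E" by simp
    from mem(3-5)[OF this] show "AE x in ?C. W (x (f (fst e)), x (f (snd e))) = V (x (f (fst e)), x (f (snd e)))"
      by (intro AE_cube_pair borel_version_AE[OF V]) auto
  qed
  then have AE: "AE x in ?C. ?g x = ?h x"
    using AE_space
  proof eventually_elim
    case (elim x)
    show "?g x = ?h x"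
      unfolding edge_prod_def
    proof (rule prod.cong[OF refl])
      fix e assume "e \<in> ?E"
      then obtain u v where e: "e = (u, v)" and uv: "(u, v) \<in> ?E" by (cases e) auto
      have "x (f u) \<in> {0..1}" "x (f v) \<in> {0..1}"
        using elim(2) mem(3,4)[OF uv] by (auto simp: space_PiM PiE_iff)
      then have "edge_probs W x (min (f u) (f v), max (f u) (f v)) = W (x (f u), x (f v))"
        using W0_D(3)[OF W] by (auto simp: min_def max_def)
      also have "\<dots> = V (x (f u), x (f v))" using elim(1) uv by force
      finally show "(case e of (u, v) \<Rightarrow> edge_probs W x (min (f u) (f v), max (f u) (f v))) =
        (case e of (i, j) \<Rightarrow> V ((\<lambda>i\<in>verts F. x (f i)) i, (\<lambda>i\<in>verts F. x (f i)) j))"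
        using mem(1,2)[OF uv] by (simp add: e)
    qed
  qed
  have "measure (sample_graph k W) {H. is_hom F f H} = (LINT x|completion ?C. ?g x)"
    unfolding sample_graph_measure[OF W]
    using edge_probs_01[OF W] by (intro Bochner_Integration.integral_cong refl coin_graph_hom F f) simp
  also have "\<dots> = (LINT x|completion ?C. ?h x)"
  proof (rule integral_cong_AE)
    show "?g \<in> borel_measurable (completion ?C)" using hm AE by (rule AE_eq_imp_measurable_completion)
    show "?h \<in> borel_measurable (completion ?C)" using hm by (rule measurable_completion)
    show "AE x in completion ?C. ?g x = ?h x" using AE by (rule AE_completion)
  qed
  also have "\<dots> = (LINT x|?C. ?h x)" by (rule integral_completion[OF hm])
  also have "\<dots> = (LINT x|cube (verts F). edge_prod F V x)"
    using PiE_mem[OF f(1)] f(2) by (intro cube_reindex edge_prod_measurable[OF F borel_versionD[OF V]]) auto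
  also have "\<dots> = fun_density F W" by (simp add: fun_density_borel_version[OF F V])
  finally show ?thesis .
qed

lemma hom_density_indicator:
  assumes F: "simple_graph F" and fin: "finite (verts H)"
  shows "hom_density F H = (\<Sum>f\<in>verts F \<rightarrow>\<^sub>E verts H. indicator {H. is_hom F f H} H) / real (card (verts H)) ^ card (verts F)"
proof -
  have "homs F H = (verts F \<rightarrow>\<^sub>E verts H) \<inter> {f. is_hom F f H}" by (auto simp: homs_def is_hom_def)
  moreover have "(\<Sum>f\<in>verts F \<rightarrow>\<^sub>E verts H. indicator {H. is_hom F f H} H) = real (card ((verts F \<rightarrow>\<^sub>E verts H) \<inter> {f. is_hom F f H}))"
    using finite_funs[OF F fin] by (simp add: indicator_def sum.If_cases)
  ultimately show ?thesis by (simp add: hom_density_eq[OF F])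
qed

lemma average_close:
  fixes P :: "(nat \<Rightarrow> nat) \<Rightarrow> real"
  assumes V: "finite V" and X: "finite X" "X \<noteq> {}" and P: "\<And>f. f \<in> V \<rightarrow>\<^sub>E X \<Longrightarrow> P f \<in> {0..1}" and t: "t \<in> {0..1}"
    and inj: "\<And>f. f \<in> V \<rightarrow>\<^sub>E X \<Longrightarrow> inj_on f V \<Longrightarrow> P f = t"
  shows "\<bar>(\<Sum>f\<in>V \<rightarrow>\<^sub>E X. P f) / real (card X) ^ card V - t\<bar> \<le> real (card V) ^ 2 / real (card X)"
proof -
  have fin: "finite (V \<rightarrow>\<^sub>E X)" using V X by (simp add: finite_PiE)
  have c: "real (card X) ^ card V > 0" using X by (simp add: card_gt_0_iff)
  have "(\<Sum>f\<in>V \<rightarrow>\<^sub>E X. P f) / real (card X) ^ card V - t = (\<Sum>f\<in>V \<rightarrow>\<^sub>E X. P f - t) / real (card X) ^ card V"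
    using c V by (simp add: sum_subtractf card_PiE diff_divide_distrib)
  moreover have "\<bar>\<Sum>f\<in>V \<rightarrow>\<^sub>E X. P f - t\<bar> \<le> real (card {f \<in> V \<rightarrow>\<^sub>E X. \<not> inj_on f V})"
  proof -
    have "\<bar>\<Sum>f\<in>V \<rightarrow>\<^sub>E X. P f - t\<bar> \<le> (\<Sum>f\<in>V \<rightarrow>\<^sub>E X. \<bar>P f - t\<bar>)" by (rule sum_abs)
    also have "\<dots> \<le> (\<Sum>f\<in>V \<rightarrow>\<^sub>E X. if \<not> inj_on f V then 1 else 0)"
    proof (rule sum_mono)
      fix f assume f: "f \<in> V \<rightarrow>\<^sub>E X"
      show "\<bar>P f - t\<bar> \<le> (if \<not> inj_on f V then 1 else 0)"
        using inj[OF f] P[OF f] t by auto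
    qed
    also have "\<dots> = real (card {f \<in> V \<rightarrow>\<^sub>E X. \<not> inj_on f V})"
      using fin by (simp add: sum.If_cases Int_def)
    finally show ?thesis .
  qed
  ultimately have "\<bar>(\<Sum>f\<in>V \<rightarrow>\<^sub>E X. P f) / real (card X) ^ card V - t\<bar> \<le>
      real (card {f \<in> V \<rightarrow>\<^sub>E X. \<not> inj_on f V}) / real (card X) ^ card V"
    using c by (simp add: abs_divide divide_right_mono)
  also have "\<dots> \<le> real (card V) ^ 2 / real (card X)" by (rule non_injective_fraction[OF V X])
  finally show ?thesis .
qed

text \<open>Every injective map contributes exactly the density to the expectation, so the error is
  at most the fraction of non-injective maps.\<close>

lemma sample_graph_mean:
  assumes W: "W \<in> W0" and F: "simple_graph F" and k: "1 \<le> k"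
  shows "\<bar>(LINT H|sample_graph k W. hom_density F H) - fun_density F W\<bar> \<le> real (card (verts F)) ^ 2 / real k"
proof -
  interpret S: prob_space "sample_graph k W" by (rule sample_graph_prob_space(1)[OF W])
  have sets: "A \<in> sets (sample_graph k W)" for A using sample_graph_prob_space(2)[OF W] by simp
  have space: "space (sample_graph k W) = UNIV" using sets sets.sets_into_space by blast
  have meas: "f \<in> borel_measurable (sample_graph k W)" for f :: "graph \<Rightarrow> real"
    by (rule measurableI) (auto simp: sets)
  let ?M = "verts F \<rightarrow>\<^sub>E {1..k}"
  have "(LINT H|sample_graph k W. hom_density F H) =
      (LINT H|sample_graph k W. (\<Sum>f\<in>?M. indicator {H. is_hom F f H} H) / real k ^ card (verts F))"
  proof (rule integral_cong_AE[OF meas meas])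
    show "AE H in sample_graph k W. hom_density F H = (\<Sum>f\<in>?M. indicator {H. is_hom F f H} H) / real k ^ card (verts F)"
      using sample_graph_verts[OF W] by eventually_elim (simp add: hom_density_indicator[OF F])
  qed
  also have "\<dots> = (\<Sum>f\<in>?M. measure (sample_graph k W) {H. is_hom F f H}) / real k ^ card (verts F)"
  proof -
    have "(LINT H|sample_graph k W. (\<Sum>f\<in>?M. indicator {H. is_hom F f H} H)) = (\<Sum>f\<in>?M. measure (sample_graph k W) {H. is_hom F f H})"
      using sets by (subst Bochner_Integration.integral_sum) (auto simp: space less_top[symmetric])
    then show ?thesis by simp
  qed
  finally show ?thesis
    using average_close[of "verts F" "{1..k}" "\<lambda>f. measure (sample_graph k W) {H. is_hom F f H}" "fun_density F W"]
      fun_density_01[OF F W] sample_graph_hom[OF W F] F k by (simp add: simple_graph_def)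
qed

subsection \<open>Testing function properties\<close>

lemma near_triangle_limit:
  assumes k: "\<And>n. n \<le> k n"
    and s: "\<And>n. near (precision (k n)) (h n) (s n)" and t: "\<And>n. near (precision (k n)) (h n) (t n)" and F: "simple_graph F"
  shows "(\<lambda>n. s n F - t n F) \<longlonglongrightarrow> 0"
  using tendsto_diff[OF near_tendsto[OF k t F] near_tendsto[OF k s F]] by simp

lemma simple_graph_finite: "simple_graph G \<Longrightarrow> finite (verts G)"
  by (simp add: simple_graph_def)

lemma hom_density_iso:
  assumes F: "simple_graph F" and G: "finite (verts G)" and iso: "graph_iso G H"
  shows "hom_density F H = hom_density F G"
proof -
  obtain \<phi> where \<phi>: "bij_betw \<phi> (verts G) (verts H)"
    and edge: "\<And>u v. u \<in> verts G \<Longrightarrow> v \<in> verts G \<Longrightarrow> {u, v} \<in> edges G \<longleftrightarrow> {\<phi> u, \<phi> v} \<in> edges H"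
    using iso unfolding graph_iso_def by blast
  have FE: "u \<in> verts F" "v \<in> verts F" if "{u, v} \<in> edges F" for u v
    using F that by (auto simp: simple_graph_def)
  have inj: "inj_on (\<lambda>f. \<lambda>v\<in>verts F. \<phi> (f v)) (homs F G)"
  proof (rule inj_onI)
    fix f g assume f: "f \<in> homs F G" and g: "g \<in> homs F G" and eq: "(\<lambda>v\<in>verts F. \<phi> (f v)) = (\<lambda>v\<in>verts F. \<phi> (g v))"
    have mem: "f \<in> verts F \<rightarrow>\<^sub>E verts G" "g \<in> verts F \<rightarrow>\<^sub>E verts G" using f g by (auto simp: homs_def)
    have "f v = g v" if v: "v \<in> verts F" for v
    proof -
      have "\<phi> (f v) = \<phi> (g v)" using fun_cong[OF eq, of v] v by simp
      then show ?thesis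
        using bij_betw_imp_inj_on[OF \<phi>] PiE_mem[OF mem(1) v] PiE_mem[OF mem(2) v] by (auto dest: inj_onD)
    qed
    then show "f = g" by (rule PiE_ext[OF mem])
  qed
  have img: "(\<lambda>f. \<lambda>v\<in>verts F. \<phi> (f v)) ` homs F G = homs F H"
  proof (intro set_eqI iffI)
    fix g assume "g \<in> (\<lambda>f. \<lambda>v\<in>verts F. \<phi> (f v)) ` homs F G"
    then obtain f where f: "f \<in> homs F G" and g: "g = (\<lambda>v\<in>verts F. \<phi> (f v))" by blast
    have fm: "f v \<in> verts G" if "v \<in> verts F" for v using f that by (auto simp: homs_def)
    have "g \<in> verts F \<rightarrow>\<^sub>E verts H" using fm bij_betwE[OF \<phi>] by (auto simp: g)
    moreover have "{g u, g v} \<in> edges H" if "{u, v} \<in> edges F" for u v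
    proof -
      have "{f u, f v} \<in> edges G" using f that by (auto simp: homs_def)
      then show ?thesis using edge[OF fm[OF FE(1)[OF that]] fm[OF FE(2)[OF that]]] FE[OF that] by (simp add: g)
    qed
    ultimately show "g \<in> homs F H" by (auto simp: homs_def)
  next
    fix g assume g: "g \<in> homs F H"
    define \<psi> where "\<psi> = the_inv_into (verts G) \<phi>"
    have \<psi>: "\<psi> w \<in> verts G" "\<phi> (\<psi> w) = w" if "w \<in> verts H" for w
      using the_inv_into_into[OF bij_betw_imp_inj_on[OF \<phi>] _ order_refl] f_the_inv_into_f_bij_betw[OF \<phi>] that
        bij_betw_imp_surj_on[OF \<phi>] by (auto simp: \<psi>_def)
    have gm: "g v \<in> verts H" if "v \<in> verts F" for v using g that by (auto simp: homs_def)
    define f where "f = (\<lambda>v\<in>verts F. \<psi> (g v))"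
    have "f \<in> verts F \<rightarrow>\<^sub>E verts G" using \<psi>(1)[OF gm] by (auto simp: f_def)
    moreover have "{f u, f v} \<in> edges G" if uv: "{u, v} \<in> edges F" for u v
    proof -
      have "{\<phi> (f u), \<phi> (f v)} = {g u, g v}" using \<psi>(2)[OF gm] FE[OF uv] by (simp add: f_def)
      moreover have "{g u, g v} \<in> edges H" using g uv by (auto simp: homs_def)
      ultimately show ?thesis using edge[of "f u" "f v"] \<psi>(1)[OF gm] FE[OF uv] by (simp add: f_def)
    qed
    ultimately have "f \<in> homs F G" by (auto simp: homs_def)
    moreover have "g = (\<lambda>v\<in>verts F. \<phi> (f v))"
    proof
      have "g \<in> verts F \<rightarrow>\<^sub>E verts H" using g by (auto simp: homs_def)
      then show "g v = (\<lambda>v\<in>verts F. \<phi> (f v)) v" for v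
        using \<psi>(2)[OF gm] PiE_arb[of g "verts F" _ v] by (cases "v \<in> verts F") (auto simp: f_def)
    qed
    ultimately show "g \<in> (\<lambda>f. \<lambda>v\<in>verts F. \<phi> (f v)) ` homs F G" by blast
  qed
  have "card (homs F H) = card (homs F G)" using card_image[OF inj] img by simp
  moreover have "card (verts H) = card (verts G)" using bij_betw_same_card[OF \<phi>] by simp
  ultimately show ?thesis by (simp add: hom_density_eq[OF F])
qed

lemma near_cong: "(\<And>F. simple_graph F \<Longrightarrow> s F = s' F) \<Longrightarrow> near j s t \<Longrightarrow> near j s' t"
  by (auto simp: near_def simple_graph_enum)

text \<open>The accepted densities may depend on the size of the sample: for a graph property they
  come only from members at least as large as the sample.\<close>

definition density_tester :: "(nat \<Rightarrow> (graph \<Rightarrow> real) set) \<Rightarrow> graph set" where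
  "density_tester T = {H. simple_graph H \<and> (\<exists>t\<in>T (card (verts H)). near (precision (card (verts H))) (\<lambda>F. hom_density F H) t)}"

lemma density_tester_property: "graph_property (density_tester T)"
  unfolding graph_property_def
proof (intro conjI ballI allI impI)
  fix G H assume G: "G \<in> density_tester T" and H: "simple_graph H \<and> graph_iso G H"
  have fin: "finite (verts G)" using G by (auto simp: density_tester_def simple_graph_def)
  have card: "card (verts H) = card (verts G)"
    using H by (auto simp: graph_iso_def dest: bij_betw_same_card)
  obtain t where t: "t \<in> T (card (verts G))" "near (precision (card (verts G))) (\<lambda>F. hom_density F G) t"
    using G by (auto simp: density_tester_def)
  have "near (precision (card (verts H))) (\<lambda>F. hom_density F H) t"
    using t(2) unfolding card by (rule near_cong[rotated]) (use hom_density_iso[OF _ fin] H in auto)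
  then show "H \<in> density_tester T" using t(1) H card by (auto simp: density_tester_def)
qed (auto simp: density_tester_def)

lemma coin_outcome_simple: "simple_graph (coin_outcome k b)"
  by (auto simp: simple_graph_def coin_outcome_def node_pairs_def)

lemma sample_graph_simple:
  assumes W: "W \<in> W0"
  shows "AE H in sample_graph k W. simple_graph H"
proof -
  interpret S: prob_space "sample_graph k W" by (rule sample_graph_prob_space(1)[OF W])
  interpret C: prob_space "completion (cube {1..k})" by (rule prob_space_completion_cube)
  have "measure_pmf.prob (coin_graph k p) {H. simple_graph H} = 1" for p
    unfolding coin_graph_eq measure_map_pmf by (simp add: vimage_def coin_outcome_simple)
  then have "measure (sample_graph k W) {H. simple_graph H} = 1"
    using C.prob_space by (simp add: sample_graph_measure[OF W])
  from S.AE_prob_1[OF this] show ?thesis by simp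
qed

lemma sample_graph_concentration:
  assumes W: "W \<in> W0" and k: "1 \<le> k"
  shows "2 / 3 \<le> measure (sample_graph k W) {H. near (precision k) (\<lambda>F. hom_density F H) (\<lambda>F. fun_density F W)}"
proof (rule density_concentration[OF sample_graph_prob_space[OF W] k])
  show "AE H in sample_graph k W. finite (verts H)"
    using sample_graph_verts[OF W] by eventually_elim simp
  show "simple_graph F \<Longrightarrow> \<bar>(LINT H|sample_graph k W. hom_density F H) - fun_density F W\<bar> \<le> 2 * real (card (verts F)) ^ 2 / real k" for F
  proof -
    assume F: "simple_graph F"
    have "real (card (verts F)) ^ 2 / real k \<le> 2 * real (card (verts F)) ^ 2 / real k"
      by (intro divide_right_mono) auto
    then show ?thesis using sample_graph_mean[OF W F k] by linarith
  qed
qed (use fun_density_01[OF _ W] fun_density_double[OF _ W] in auto)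

text \<open>Rejection is shown by contradiction: failures at arbitrarily large sample sizes form a
  sequence to which compactness applies. So no explicit sample size comes out of it.\<close>

theorem testable_fun_closed_flexible:
  assumes R: "graphon_property R" "cut_closed R" "flexible_fun R"
  shows "testable_fun R"
proof -
  define R' where "R' = density_tester (\<lambda>_. (\<lambda>W F. fun_density F W) ` R)"
  have RW0: "R \<subseteq> W0" using R(1) by (simp add: graphon_property_def function_property_def)
  have accept: "2 / 3 \<le> measure (sample_graph k W) R'" if W: "W \<in> R" and k: "1 \<le> k" for W k
  proof -
    have W0: "W \<in> W0" using W RW0 by blast
    interpret S: prob_space "sample_graph k W" by (rule sample_graph_prob_space(1)[OF W0])
    have "measure (sample_graph k W) {H. near (precision k) (\<lambda>F. hom_density F H) (\<lambda>F. fun_density F W)} \<le> measure (sample_graph k W) R'"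
    proof (rule S.finite_measure_mono_AE)
      show "AE H in sample_graph k W. H \<in> {H. near (precision k) (\<lambda>F. hom_density F H) (\<lambda>F. fun_density F W)} \<longrightarrow> H \<in> R'"
        using sample_graph_verts[OF W0] sample_graph_simple[OF W0]
        by eventually_elim (use W in \<open>auto simp: R'_def density_tester_def\<close>)
    qed (simp add: sample_graph_prob_space(2)[OF W0])
    then show ?thesis using sample_graph_concentration[OF W0 k] by linarith
  qed
  have reject: "\<exists>k0\<ge>1. \<forall>k\<ge>k0. \<forall>W\<in>W0. ereal e \<le> fun_dist_set W R \<longrightarrow> measure (sample_graph k W) R' \<le> 1 / 3" if e: "0 < e" for e :: real
  proof (rule ccontr)
    assume neg: "\<not> (\<exists>k0\<ge>1. \<forall>k\<ge>k0. \<forall>W\<in>W0. ereal e \<le> fun_dist_set W R \<longrightarrow> measure (sample_graph k W) R' \<le> 1 / 3)"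
    have "\<exists>k W V H. Suc n \<le> k \<and> W \<in> W0 \<and> ereal e \<le> fun_dist_set W R \<and> V \<in> R \<and>
        near (precision k) (\<lambda>F. hom_density F H) (\<lambda>F. fun_density F W) \<and>
        near (precision k) (\<lambda>F. hom_density F H) (\<lambda>F. fun_density F V)" for n
    proof -
      have "1 \<le> Suc n" by simp
      then obtain k W where k: "Suc n \<le> k" and W: "W \<in> W0" "ereal e \<le> fun_dist_set W R" "1 / 3 < measure (sample_graph k W) R'"
        using neg not_le by blast
      let ?N = "{H. near (precision k) (\<lambda>F. hom_density F H) (\<lambda>F. fun_density F W)}"
      interpret S: prob_space "sample_graph k W" by (rule sample_graph_prob_space(1)[OF W(1)])
      have ev: "A \<in> sets (sample_graph k W)" for A by (simp add: sample_graph_prob_space(2)[OF W(1)])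
      \<comment> \<open>An event of probability above 1/3 meets one of probability at least 2/3. The
        common sample \<open>H\<close> is near both to \<open>W\<close> and to some member of
        \<open>R\<close>. Fixing its node set makes the tester compare at precision
        \<open>precision k\<close>.\<close>
      have "\<exists>H. H \<in> R' \<and> H \<in> ?N \<and> verts H = {1..k}"
      proof (rule ccontr)
        assume none: "\<nexists>H. H \<in> R' \<and> H \<in> ?N \<and> verts H = {1..k}"
        have "1 < measure (sample_graph k W) R' + measure (sample_graph k W) ?N"
          using W(3) sample_graph_concentration[OF W(1), of k] k by simp
        also have "\<dots> = measure (sample_graph k W) (R' \<union> ?N)"
        proof (rule measure_Un_AE[symmetric])
          show "AE H in sample_graph k W. H \<notin> R' \<or> H \<notin> ?N"
            using sample_graph_verts[OF W(1)] by eventually_elim (use none in blast)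
        qed (auto simp: fmeasurable_def ev S.emeasure_eq_measure)
        also have "\<dots> \<le> 1" by (rule S.prob_le_1)
        finally show False by simp
      qed
      then obtain H where H: "H \<in> R'" "H \<in> ?N" "verts H = {1..k}" by blast
      then obtain V where "V \<in> R" "near (precision k) (\<lambda>F. hom_density F H) (\<lambda>F. fun_density F V)"
        by (auto simp: R'_def density_tester_def)
      then show ?thesis using k W H(2) by blast
    qed
    then obtain k W V H where *: "\<And>n. Suc n \<le> k n" "\<And>n. W n \<in> W0" "\<And>n. ereal e \<le> fun_dist_set (W n) R" "\<And>n. V n \<in> R"
        "\<And>n. near (precision (k n)) (\<lambda>F. hom_density F (H n)) (\<lambda>F. fun_density F (W n))"
        "\<And>n. near (precision (k n)) (\<lambda>F. hom_density F (H n)) (\<lambda>F. fun_density F (V n))"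
      by metis
    have k: "n \<le> k n" for n using *(1)[of n] by simp
    have "\<exists>n. \<exists>Z\<in>R. fun_dist (W n) Z < e"
      by (rule close_if_densities_close[OF R *(2,4) e near_triangle_limit[OF k *(5,6)]])
    then obtain n Z where Z: "Z \<in> R" "fun_dist (W n) Z < e" by blast
    have "fun_dist_set (W n) R \<le> ereal (fun_dist (W n) Z)"
      unfolding fun_dist_set_def using Z(1) by (rule INF_lower)
    then show False using *(3)[of n] Z(2) by (metis ereal_less(2) ereal_less_eq(3) less_le_not_le order_trans)
  qed
  show ?thesis
    unfolding testable_fun_def
    using density_tester_property accept reject by (intro exI[of _ R']) (auto simp: R'_def)
qed

subsection \<open>Testing graph properties\<close>

definition relabel :: "(nat \<Rightarrow> nat) \<Rightarrow> graph \<Rightarrow> graph" where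
  "relabel \<phi> G = (\<phi> ` verts G, (`) \<phi> ` edges G)"

lemma relabel_edge:
  assumes "simple_graph G" "inj_on \<phi> (verts G)" "u \<in> verts G" "v \<in> verts G"
  shows "{\<phi> u, \<phi> v} \<in> edges (relabel \<phi> G) \<longleftrightarrow> {u, v} \<in> edges G"
proof
  assume "{\<phi> u, \<phi> v} \<in> edges (relabel \<phi> G)"
  then obtain e where e: "e \<in> edges G" "\<phi> ` {u, v} = \<phi> ` e" by (auto simp: relabel_def)
  then have "{u, v} = e"
    using assms by (subst (asm) inj_on_image_eq_iff[OF assms(2)]) (auto simp: simple_graph_def)
  then show "{u, v} \<in> edges G" using e by simp
next
  assume "{u, v} \<in> edges G"
  then have "\<phi> ` {u, v} \<in> edges (relabel \<phi> G)" unfolding relabel_def snd_conv by (rule imageI)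
  then show "{\<phi> u, \<phi> v} \<in> edges (relabel \<phi> G)" by simp
qed

lemma relabel_simple:
  assumes "simple_graph G" "inj_on \<phi> (verts G)"
  shows "simple_graph (relabel \<phi> G)"
  unfolding simple_graph_def
proof (intro conjI ballI)
  fix e assume "e \<in> edges (relabel \<phi> G)"
  then obtain e0 where e: "e = \<phi> ` e0" "e0 \<subseteq> verts G" "card e0 = 2" using assms(1) by (auto simp: relabel_def simple_graph_def)
  then show "e \<subseteq> verts (relabel \<phi> G)" "card e = 2"
    using card_image[OF inj_on_subset[OF assms(2) e(2)]] by (auto simp: relabel_def)
qed (use assms in \<open>simp add: relabel_def simple_graph_def\<close>)

lemma relabel_iso:
  assumes "simple_graph G" "inj_on \<phi> (verts G)"
  shows "graph_iso G (relabel \<phi> G)"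
  unfolding graph_iso_def
  using relabel_edge[OF assms] assms(2)
  by (intro exI[of _ \<phi>]) (auto simp: relabel_def bij_betw_def)

lemma relabel_dist:
  assumes G: "simple_graph G" and H: "simple_graph H" and verts: "verts H = verts G" and inj: "inj_on \<phi> (verts G)"
  shows "graph_dist (relabel \<phi> G) (relabel \<phi> H) = graph_dist G H"
proof -
  have sub: "edges G \<subseteq> Pow (verts G)" "edges H \<subseteq> Pow (verts G)" using G H verts by (auto simp: simple_graph_def)
  have injP: "inj_on ((`) \<phi>) (Pow (verts G))" using inj by (rule inj_on_image_Pow)
  have "sym_diff (edges (relabel \<phi> G)) (edges (relabel \<phi> H)) = (`) \<phi> ` sym_diff (edges G) (edges H)"
  proof -
    have "(`) \<phi> ` (edges G - edges H) = (`) \<phi> ` edges G - (`) \<phi> ` edges H"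
      using sub by (intro inj_on_image_set_diff[OF injP]) auto
    moreover have "(`) \<phi> ` (edges H - edges G) = (`) \<phi> ` edges H - (`) \<phi> ` edges G"
      using sub by (intro inj_on_image_set_diff[OF injP]) auto
    ultimately show ?thesis by (simp only: relabel_def snd_conv image_Un)
  qed
  moreover have "inj_on ((`) \<phi>) (sym_diff (edges G) (edges H))"
    using sub by (intro inj_on_subset[OF injP]) auto
  ultimately have "card (sym_diff (edges (relabel \<phi> G)) (edges (relabel \<phi> H))) = card (sym_diff (edges G) (edges H))"
    by (simp only: card_image)
  moreover have "card (verts (relabel \<phi> G)) = card (verts G)" using inj by (simp add: relabel_def card_image)
  ultimately show ?thesis by (simp add: graph_dist_def)
qed

lemma relabel_inverse:
  assumes G: "simple_graph G" and inv: "\<And>v. v \<in> verts G \<Longrightarrow> \<psi> (\<phi> v) = v"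
  shows "relabel \<psi> (relabel \<phi> G) = G"
proof -
  have "\<psi> ` \<phi> ` e = e" if "e \<subseteq> verts G" for e
    using that inv by (force simp: image_iff)
  then have "(`) \<psi> ` (`) \<phi> ` edges G = edges G" "\<psi> ` \<phi> ` verts G = verts G"
    using G by (force simp: simple_graph_def image_iff)+
  then show ?thesis by (cases G) (simp add: relabel_def)
qed

text \<open>Robustness speaks only of graphs on \<open>{1..n}\<close>, since the function of a graph
  depends on the labels. Every competitor of \<open>G0\<close> relabels back to a competitor of
  \<open>G\<close> at the same distance, so a lower bound on the distance passes from
  \<open>G\<close> to \<open>G0\<close>.\<close>

lemma normalize_graph:
  assumes G: "simple_graph G" and P: "graph_property P"
  obtains G0 where "simple_graph G0" "verts G0 = {1..card (verts G)}" "graph_iso G G0"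
    "graph_dist_set G P \<le> graph_dist_set G0 P"
proof -
  have fin: "finite (verts G)" using G by (simp add: simple_graph_def)
  obtain \<phi> where \<phi>: "bij_betw \<phi> (verts G) {1..card (verts G)}"
    using fin by (metis finite_same_card_bij finite_atLeastAtMost card_atLeastAtMost diff_Suc_1)
  define \<psi> where "\<psi> = the_inv_into (verts G) \<phi>"
  have \<psi>: "\<psi> (\<phi> v) = v" if "v \<in> verts G" for v
    unfolding \<psi>_def using \<phi> that by (intro the_inv_into_f_f) (auto simp: bij_betw_def)
  have \<psi>b: "bij_betw \<psi> {1..card (verts G)} (verts G)"
    unfolding \<psi>_def by (rule bij_betw_the_inv_into[OF \<phi>])
  have \<phi>i: "inj_on \<phi> (verts G)" and \<psi>i: "inj_on \<psi> {1..card (verts G)}"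
    using \<phi> \<psi>b by (auto simp: bij_betw_def)
  let ?G0 = "relabel \<phi> G"
  have v0: "verts ?G0 = {1..card (verts G)}" using \<phi> by (auto simp: relabel_def bij_betw_def)
  have s0: "simple_graph ?G0" by (rule relabel_simple[OF G \<phi>i])
  have "graph_dist_set G P \<le> graph_dist_set ?G0 P"
    unfolding graph_dist_set_def
  proof (rule INF_greatest)
    fix H assume "H \<in> {H \<in> P. verts H = verts ?G0}"
    then have H: "H \<in> P" "verts H = verts ?G0" by auto
    have sH: "simple_graph H" using P H(1) by (auto simp: graph_property_def)
    have inj: "inj_on \<psi> (verts H)" using \<psi>i v0 H(2) by simp
    have "relabel \<psi> H \<in> P"
      using P H(1) relabel_simple[OF sH inj] relabel_iso[OF sH inj] unfolding graph_property_def by blast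
    moreover have "verts (relabel \<psi> H) = verts G"
      using \<psi>b v0 H(2) by (auto simp: relabel_def bij_betw_def)
    moreover have "graph_dist G (relabel \<psi> H) = graph_dist ?G0 H"
      using relabel_dist[OF s0 sH H(2), of \<psi>] \<psi>i v0 relabel_inverse[where \<phi>=\<phi> and \<psi>=\<psi>, OF G \<psi>] by simp
    ultimately show "(INF H\<in>{H \<in> P. verts H = verts G}. ereal (graph_dist G H)) \<le> ereal (graph_dist ?G0 H)"
      by (metis (mono_tags, lifting) INF_lower mem_Collect_eq)
  qed
  then show ?thesis using that[of ?G0] s0 v0 relabel_iso[OF G \<phi>i] by blast
qed

section \<open>The step function of a graph and its densities\<close>

definition unit_cell :: "nat \<Rightarrow> real \<Rightarrow> nat" where
  "unit_cell n x = nat \<lceil>real n * x\<rceil>"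

text \<open>The cells of \<open>graph_fun\<close> are open on the left and closed on the right,
  unlike the dyadic ones, so the index is a ceiling. The point 0 gets the index 0, which is no node
  of a graph on \<open>{1..n}\<close>.\<close>

lemma unit_cell_iff:
  assumes "0 < n" "0 \<le> x"
  shows "x \<in> {(real i - 1) / real n<..real i / real n} \<longleftrightarrow> unit_cell n x = i"
proof -
  have "x \<in> {(real i - 1) / real n<..real i / real n} \<longleftrightarrow> real i - 1 < real n * x \<and> real n * x \<le> real i"
    using assms(1) by (auto simp: field_simps)
  also have "\<dots> \<longleftrightarrow> \<lceil>real n * x\<rceil> = int i" by (simp add: ceiling_eq_iff)
  also have "\<dots> \<longleftrightarrow> unit_cell n x = i"
  proof -
    have "0 \<le> real n * x" using assms by simp
    then have "0 \<le> \<lceil>real n * x\<rceil>" by linarith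
    then show ?thesis by (auto simp: unit_cell_def)
  qed
  finally show ?thesis .
qed

lemma unit_cell_measurable [measurable]: "unit_cell n \<in> I01 \<rightarrow>\<^sub>M count_space UNIV"
  unfolding unit_cell_def by (rule measurable_restrict_space1) measurable

definition adjacency :: "graph \<Rightarrow> real \<times> real \<Rightarrow> real" where
  "adjacency G = (\<lambda>(x, y). if {unit_cell (card (verts G)) x, unit_cell (card (verts G)) y} \<in> edges G then 1 else 0)"

lemma graph_fun_eq:
  assumes "0 < card (verts G)"
  shows "graph_fun G = restrict (adjacency G) unit_square"
proof
  fix p show "graph_fun G p = restrict (adjacency G) unit_square p"
  proof (cases p)
    case (Pair x y)
    show ?thesis
    proof (cases "x \<in> {0..1} \<and> y \<in> {0..1}")
      case True
      then have "(\<exists>i j. {i, j} \<in> edges G \<and> x \<in> {(real i - 1) / real (card (verts G))<..real i / real (card (verts G))} \<and>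
          y \<in> {(real j - 1) / real (card (verts G))<..real j / real (card (verts G))}) \<longleftrightarrow>
          {unit_cell (card (verts G)) x, unit_cell (card (verts G)) y} \<in> edges G"
        using unit_cell_iff[OF assms, of x] unit_cell_iff[OF assms, of y] by auto
      then show ?thesis using True by (simp only: Pair graph_fun_def Let_def adjacency_def restrict_def prod.case)
    next
      case False
      then show ?thesis by (auto simp: Pair graph_fun_def Let_def)
    qed
  qed
qed

lemma graph_fun_version:
  assumes "0 < card (verts G)"
  shows "borel_version (graph_fun G) (adjacency G)" "graph_fun G \<in> W0"
proof -
  let ?n = "card (verts G)"
  have c: "(\<lambda>q. unit_cell ?n (fst q)) \<in> sq \<rightarrow>\<^sub>M count_space UNIV" "(\<lambda>q. unit_cell ?n (snd q)) \<in> sq \<rightarrow>\<^sub>M count_space UNIV"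
    by (rule measurable_compose[OF _ unit_cell_measurable], simp)+
  have "adjacency G \<in> borel_measurable sq"
    using c unfolding adjacency_def case_prod_beta' by measurable
  moreover have "adjacency G p \<in> {0..1}" for p by (simp add: adjacency_def split: prod.split)
  moreover have "AE p in sq. graph_fun G p = adjacency G p"
    by (rule AE_I2) (simp only: graph_fun_eq[OF assms] space_sq restrict_apply')
  ultimately show ver: "borel_version (graph_fun G) (adjacency G)" by (simp add: borel_version_def)
  show "graph_fun G \<in> W0"
    by (rule W0_I[OF ver]) (auto simp: graph_fun_eq[OF assms] adjacency_def insert_commute)
qed

lemma measure_unit_cell:
  assumes "a \<in> {1..n}"
  shows "{x \<in> {0..1}. unit_cell n x = a} \<in> sets I01" "measure I01 {x \<in> {0..1}. unit_cell n x = a} = 1 / real n"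
proof -
  have n: "0 < n" using assms by simp
  have eq: "{x \<in> {0..1}. unit_cell n x = a} = {(real a - 1) / real n<..real a / real n}"
  proof (intro set_eqI iffI)
    fix x assume "x \<in> {(real a - 1) / real n<..real a / real n}"
    moreover have "0 \<le> (real a - 1) / real n" "real a / real n \<le> 1" using assms n by auto
    ultimately have "0 \<le> x" "x \<le> 1" "x \<in> {(real a - 1) / real n<..real a / real n}" by auto
    then show "x \<in> {x \<in> {0..1}. unit_cell n x = a}" using unit_cell_iff[OF n, of x a] by auto
  qed (use unit_cell_iff[OF n] in auto)
  show s: "{x \<in> {0..1}. unit_cell n x = a} \<in> sets I01"
    using measurable_sets[OF unit_cell_measurable, of "{a}" n] by (simp add: vimage_def Int_def conj_commute)
  have "measure I01 {x \<in> {0..1}. unit_cell n x = a} = measure lborel {x \<in> {0..1}. unit_cell n x = a}"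
    using emeasure_I01[OF s] by (simp add: measure_def)
  then show "measure I01 {x \<in> {0..1}. unit_cell n x = a} = 1 / real n"
    unfolding eq using n by (simp add: divide_simps)
qed

text \<open>Almost every point of the cube determines the map that sends each node of
  \<open>F\<close> to the index of its coordinate. So the integrand is a sum of indicators of
  disjoint boxes, one for each homomorphism, and each box has volume
  \<open>(1 / n) ^ card (verts F)\<close>.\<close>

lemma fun_density_graph_fun:
  assumes F: "simple_graph F" and G: "simple_graph G" "verts G = {1..n}" and n: "0 < n"
  shows "fun_density F (graph_fun G) = hom_density F G"
proof -
  let ?V = "verts F" and ?M = "verts F \<rightarrow>\<^sub>E {1..n}"
  let ?A = "\<lambda>a. {x \<in> {0..1}. unit_cell n x = a}"
  have fin: "finite ?V" by (rule simple_graph_finite[OF F])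
  interpret P: product_prob_space "\<lambda>_. I01" ?V by (rule product_prob_space_I01)
  interpret P: finite_product_prob_space "\<lambda>_. I01" ?V by unfold_locales (rule fin)
  have card: "0 < card (verts G)" "card (verts G) = n" using G n by auto
  have finM: "finite (homs F G)" using finite_funs[OF F, of "{1..n}"] by (simp add: homs_def G)
  have A: "?A a \<in> sets I01" "measure I01 (?A a) = 1 / real n" if "a \<in> {1..n}" for a
    using measure_unit_cell[OF that] by auto
  have hA: "?A (f i) \<in> sets I01" "measure I01 (?A (f i)) = 1 / real n" if "f \<in> homs F G" "i \<in> ?V" for f i
  proof -
    have "f i \<in> {1..n}" using that by (auto simp: homs_def G)
    then show "?A (f i) \<in> sets I01" "measure I01 (?A (f i)) = 1 / real n" using A[of "f i"] by blast+
  qed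
  have sets: "Pi\<^sub>E ?V (\<lambda>i. ?A (f i)) \<in> sets (cube ?V)" if "f \<in> homs F G" for f
    using hA(1)[OF that] by (intro sets_PiM_I_finite fin)
  \<comment> \<open>A coordinate 0 has index 0 and would not give a map into
    \<open>{1..n}\<close>.\<close>
  have AE0: "AE x in cube ?V. \<forall>i\<in>?V. x i \<noteq> 0"
  proof (intro AE_finite_allI fin AE_PiM_component prob_space_I01)
    have "AE x in lborel. x \<noteq> (0::real)" by (rule AE_lborel_singleton)
    then show "AE x in I01. x \<noteq> 0" by (subst AE_restrict_space_iff) auto
  qed auto
  have "fun_density F (graph_fun G) = (LINT x|cube ?V. edge_prod F (adjacency G) x)"
    by (rule fun_density_borel_version[OF F graph_fun_version(1)[OF card(1)]])
  also have "\<dots> = (LINT x|cube ?V. (\<Sum>f\<in>homs F G. indicat_real (Pi\<^sub>E ?V (\<lambda>i. ?A (f i))) x))"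
  proof (rule integral_cong_AE)
    show "edge_prod F (adjacency G) \<in> borel_measurable (cube ?V)"
      by (rule edge_prod_measurable[OF F borel_versionD[OF graph_fun_version(1)[OF card(1)]]])
    show "(\<lambda>x. \<Sum>f\<in>homs F G. indicat_real (Pi\<^sub>E ?V (\<lambda>i. ?A (f i))) x) \<in> borel_measurable (cube ?V)"
      by (intro borel_measurable_sum borel_measurable_indicator sets)
    show "AE x in cube ?V. edge_prod F (adjacency G) x = (\<Sum>f\<in>homs F G. indicat_real (Pi\<^sub>E ?V (\<lambda>i. ?A (f i))) x)"
      using AE0 AE_space
    proof eventually_elim
      case (elim x)
      define g where "g = (\<lambda>i\<in>?V. unit_cell n (x i))"
      have x: "x \<in> extensional ?V" "0 < x i" "x i \<le> 1" if "i \<in> ?V" for i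
        using elim that by (auto simp: space_PiM PiE_iff less_le)
      have xe: "x \<in> extensional ?V" using elim by (auto simp: space_PiM PiE_iff)
      have gM: "g \<in> ?M"
      proof -
        have "unit_cell n (x i) \<in> {1..n}" if "i \<in> ?V" for i
        proof -
          have "0 < real n * x i" "real n * x i \<le> real n" using x[OF that] n by (simp_all add: mult_left_le)
          then show ?thesis unfolding unit_cell_def by (auto simp: le_nat_iff ceiling_le_iff nat_le_iff)
        qed
        then show ?thesis by (simp add: g_def)
      qed
      have "indicator (Pi\<^sub>E ?V (\<lambda>i. ?A (f i))) x = (if f = g then 1 else 0 :: real)" if f: "f \<in> homs F G" for f
      proof -
        have fe: "f \<in> extensional ?V" using f by (auto simp: homs_def PiE_iff)
        have "x \<in> Pi\<^sub>E ?V (\<lambda>i. ?A (f i)) \<longleftrightarrow> (\<forall>i\<in>?V. f i = g i)"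
        proof -
          have "x i \<in> ?A (f i) \<longleftrightarrow> f i = g i" if "i \<in> ?V" for i
            using x(2,3)[OF that] that by (auto simp: g_def)
          then show ?thesis using xe by (simp add: PiE_iff)
        qed
        also have "\<dots> \<longleftrightarrow> f = g" using fe by (auto simp: g_def extensional_def fun_eq_iff)
        finally show ?thesis by (simp add: indicator_def)
      qed
      then have "(\<Sum>f\<in>homs F G. indicat_real (Pi\<^sub>E ?V (\<lambda>i. ?A (f i))) x) = (if g \<in> homs F G then 1 else 0 :: real)"
        using finM by simp
      also have "g \<in> homs F G \<longleftrightarrow> is_hom F g G" using gM by (auto simp: homs_def is_hom_def G)
      also have "(if is_hom F g G then 1 else 0) = edge_prod F (adjacency G) x"
      proof -
        have "adjacency G (x i, x j) = (if {g i, g j} \<in> edges G then 1 else 0)" if "(i, j) \<in> ordered_edges F" for i j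
          using ordered_edges_subset[OF F] that by (auto simp: adjacency_def card(2) g_def)
        then have "edge_prod F (adjacency G) x = (\<Prod>(i, j)\<in>ordered_edges F. if {g i, g j} \<in> edges G then 1 else 0)"
          unfolding edge_prod_def by (intro prod.cong) auto
        also have "\<dots> = (if \<forall>(i, j)\<in>ordered_edges F. {g i, g j} \<in> edges G then 1 else 0)"
        proof (cases "\<forall>(i, j)\<in>ordered_edges F. {g i, g j} \<in> edges G")
          case True
          then show ?thesis by (auto intro!: prod.neutral)
        next
          case False
          then obtain i j where "(i, j) \<in> ordered_edges F" "{g i, g j} \<notin> edges G" by auto
          then have "(\<Prod>(i, j)\<in>ordered_edges F. if {g i, g j} \<in> edges G then 1 else 0 :: real) = 0"
            by (intro prod_zero finite_ordered_edges[OF F] bexI[of _ "(i, j)"]) auto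
          then show ?thesis using False by simp
        qed
        finally show ?thesis by (simp add: is_hom_ordered[OF F])
      qed
      finally show ?case ..
    qed
  qed
  also have "\<dots> = (\<Sum>f\<in>homs F G. measure (cube ?V) (Pi\<^sub>E ?V (\<lambda>i. ?A (f i))))"
  proof -
    have "integrable (cube ?V) (indicat_real (Pi\<^sub>E ?V (\<lambda>i. ?A (f i))))" if "f \<in> homs F G" for f
      by (rule P.integrable_const_bound[where B=1]) (use sets[OF that] in \<open>auto split: split_indicator\<close>)
    then have "(LINT x|cube ?V. (\<Sum>f\<in>homs F G. indicat_real (Pi\<^sub>E ?V (\<lambda>i. ?A (f i))) x)) =
        (\<Sum>f\<in>homs F G. (LINT x|cube ?V. indicat_real (Pi\<^sub>E ?V (\<lambda>i. ?A (f i))) x))"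
      by (rule Bochner_Integration.integral_sum)
    also have "\<dots> = (\<Sum>f\<in>homs F G. measure (cube ?V) (Pi\<^sub>E ?V (\<lambda>i. ?A (f i)) \<inter> space (cube ?V)))"
      by (simp only: Bochner_Integration.integral_indicator)
    also have "\<dots> = (\<Sum>f\<in>homs F G. measure (cube ?V) (Pi\<^sub>E ?V (\<lambda>i. ?A (f i))))"
      using sets.sets_into_space[OF sets] by (intro sum.cong refl arg_cong[where f="measure _"] Int_absorb2)
    finally show ?thesis .
  qed
  also have "\<dots> = (\<Sum>f\<in>homs F G. (1 / real n) ^ card ?V)"
    using hA by (intro sum.cong refl) (simp add: P.prob_times)
  also have "\<dots> = hom_density F G"
    by (simp add: hom_density_eq[OF F] card(2) power_divide)
  finally show ?thesis .
qed

section \<open>Uniformly random induced subgraphs\<close>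

definition subset_pmf :: "graph \<Rightarrow> nat \<Rightarrow> graph pmf" where
  "subset_pmf G k = map_pmf (induced G) (pmf_of_set {S. S \<subseteq> verts G \<and> card S = k})"

lemma card_supersets:
  assumes "finite X" "T \<subseteq> X"
  shows "card {S. S \<subseteq> X \<and> card S = k \<and> T \<subseteq> S} = (if card T \<le> k then (card X - card T) choose (k - card T) else 0)"
proof (cases "card T \<le> k")
  case True
  have fT: "finite T" using assms finite_subset by blast
  have "bij_betw (\<lambda>S. S - T) {S. S \<subseteq> X \<and> card S = k \<and> T \<subseteq> S} {B. B \<subseteq> X - T \<and> card B = k - card T}"
  proof (rule bij_betw_byWitness[where f'="\<lambda>B. B \<union> T"])
    show "(\<lambda>B. B \<union> T) ` {B. B \<subseteq> X - T \<and> card B = k - card T} \<subseteq> {S. S \<subseteq> X \<and> card S = k \<and> T \<subseteq> S}"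
    proof
      fix S assume "S \<in> (\<lambda>B. B \<union> T) ` {B. B \<subseteq> X - T \<and> card B = k - card T}"
      then obtain B where B: "S = B \<union> T" "B \<subseteq> X - T" "card B = k - card T" by blast
      then have "card (B \<union> T) = card B + card T"
        using assms(1) fT by (intro card_Un_disjoint) (auto intro: finite_subset)
      then show "S \<in> {S. S \<subseteq> X \<and> card S = k \<and> T \<subseteq> S}" using B True assms(2) by auto
    qed
    show "(\<lambda>S. S - T) ` {S. S \<subseteq> X \<and> card S = k \<and> T \<subseteq> S} \<subseteq> {B. B \<subseteq> X - T \<and> card B = k - card T}"
      using fT by (auto simp: card_Diff_subset)
  qed auto
  then have "card {S. S \<subseteq> X \<and> card S = k \<and> T \<subseteq> S} = card {B. B \<subseteq> X - T \<and> card B = k - card T}"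
    by (rule bij_betw_same_card)
  also have "\<dots> = (card (X - T) choose (k - card T))" using assms(1) by (intro n_subsets) simp
  also have "card (X - T) = card X - card T" using assms fT by (simp add: card_Diff_subset)
  finally show ?thesis using True by simp
next
  case False
  have "\<not> (S \<subseteq> X \<and> card S = k \<and> T \<subseteq> S)" for S
    using False assms(1) by (metis card_mono finite_subset)
  then have "{S. S \<subseteq> X \<and> card S = k \<and> T \<subseteq> S} = {}" by blast
  then show ?thesis using False by (simp only: card.empty if_False)
qed

lemma homs_induced:
  assumes "simple_graph F" "S \<subseteq> verts G"
  shows "homs F (induced G S) = {f \<in> homs F G. f \<in> verts F \<rightarrow>\<^sub>E S}"
proof -
  have "{f u, f v} \<subseteq> S" if "f \<in> verts F \<rightarrow>\<^sub>E S" "{u, v} \<in> edges F" for f u v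
  proof -
    have "u \<in> verts F" "v \<in> verts F" using assms(1) that(2) by (auto simp: simple_graph_def)
    then show ?thesis using that(1) by auto
  qed
  moreover have "f \<in> verts F \<rightarrow>\<^sub>E verts G" if "f \<in> verts F \<rightarrow>\<^sub>E S" for f
    using that assms(2) by (auto simp: PiE_iff)
  ultimately show ?thesis unfolding homs_def induced_def fst_conv snd_conv by blast
qed

text \<open>
  The number of \<open>k\<close>-subsets containing the image of an injective map does not depend on the map. So both the
  density of \<open>F\<close> in \<open>G\<close> and its average over induced subgraphs are within \<open>|V(F)|^2 / k\<close> of the density
  among injective maps.
\<close>

lemma subset_mean:
  assumes F: "simple_graph F" and G: "simple_graph G" and k: "1 \<le> k" "k \<le> card (verts G)"
  shows "\<bar>(LINT H|measure_pmf (subset_pmf G k). hom_density F H) - hom_density F G\<bar> \<le> 2 * real (card (verts F)) ^ 2 / real k"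
proof -
  let ?V = "verts F" and ?X = "verts G"
  define n where "n = card ?X"
  define m where "m = card ?V"
  define SS where "SS = {S. S \<subseteq> ?X \<and> card S = k}"
  have fX: "finite ?X" and fV: "finite ?V" using F G by (auto simp: simple_graph_def)
  have n: "0 < n" "k \<le> n" "?X \<noteq> {}" using k by (auto simp: n_def)
  have fSS: "finite SS" using fX by (auto simp: SS_def)
  have cSS: "0 < real (card SS)" using fX k n_subsets[OF fX, of k] by (simp add: SS_def zero_less_binomial)
  then have SS0: "SS \<noteq> {}" by auto
  define I where "I X = {f \<in> ?V \<rightarrow>\<^sub>E X. inj_on f ?V}" for X :: "nat set"
  \<comment> \<open>The probability that a random \<open>k\<close>-subset contains a given set of
    \<open>m\<close> nodes. For \<open>m > k\<close> it is 0, which the binomial coefficient would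
    miss because natural subtraction truncates.\<close>
  define c where "c = (if m \<le> k then real ((n - m) choose (k - m)) else 0) / real (card SS)"
  have fI: "finite (I ?X)" using fX fV by (simp add: I_def finite_PiE)
  have avg: "(\<Sum>S\<in>SS. real (card (Q \<inter> (?V \<rightarrow>\<^sub>E S)))) / real (card SS) = c * real (card Q)" if Q: "Q \<subseteq> I ?X" for Q
  proof -
    have fQ: "finite Q" using Q fI by (rule finite_subset)
    have "(\<Sum>S\<in>SS. real (card (Q \<inter> (?V \<rightarrow>\<^sub>E S)))) = (\<Sum>S\<in>SS. \<Sum>f\<in>Q. if f ` ?V \<subseteq> S then 1 else 0)"
    proof (rule sum.cong[OF refl])
      fix S
      have "f \<in> ?V \<rightarrow>\<^sub>E S \<longleftrightarrow> f ` ?V \<subseteq> S" if "f \<in> Q" for f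
      proof -
        have "f \<in> extensional ?V" using Q that by (auto simp: I_def PiE_iff)
        then show ?thesis by (simp add: PiE_iff image_subset_iff)
      qed
      then have "Q \<inter> (?V \<rightarrow>\<^sub>E S) = {f \<in> Q. f ` ?V \<subseteq> S}" by blast
      then show "real (card (Q \<inter> (?V \<rightarrow>\<^sub>E S))) = (\<Sum>f\<in>Q. if f ` ?V \<subseteq> S then 1 else 0)"
        using fQ by (simp add: sum.If_cases Int_def)
    qed
    also have "\<dots> = (\<Sum>f\<in>Q. \<Sum>S\<in>SS. if f ` ?V \<subseteq> S then 1 else 0)" by (rule sum.swap)
    also have "\<dots> = (\<Sum>f\<in>Q. c * real (card SS))"
    proof (rule sum.cong[OF refl])
      fix f assume "f \<in> Q"
      then have f: "f ` ?V \<subseteq> ?X" "card (f ` ?V) = m" using Q by (auto simp: I_def m_def card_image)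
      have "(\<Sum>S\<in>SS. if f ` ?V \<subseteq> S then 1 else 0) = real (card {S. S \<subseteq> ?X \<and> card S = k \<and> f ` ?V \<subseteq> S})"
        using fSS by (simp add: sum.If_cases) (simp add: SS_def Int_def conj_assoc)
      also have "\<dots> = c * real (card SS)"
        using cSS by (simp add: card_supersets[OF fX f(1)] f(2) c_def n_def)
      finally show "(\<Sum>S\<in>SS. if f ` ?V \<subseteq> S then 1 else 0) = c * real (card SS)" .
    qed
    finally show ?thesis using cSS by simp
  qed
  have frac: "0 \<le> 1 - real (card (I X)) / real (card X) ^ m \<and> 1 - real (card (I X)) / real (card X) ^ m \<le> real m ^ 2 / real (card X)"
    if X: "finite X" "X \<noteq> {}" for X
  proof -
    have fin: "finite (?V \<rightarrow>\<^sub>E X)" using X fV by (simp add: finite_PiE)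
    have "?V \<rightarrow>\<^sub>E X = I X \<union> {f \<in> ?V \<rightarrow>\<^sub>E X. \<not> inj_on f ?V}" by (auto simp: I_def)
    then have "card (?V \<rightarrow>\<^sub>E X) = card (I X \<union> {f \<in> ?V \<rightarrow>\<^sub>E X. \<not> inj_on f ?V})" by simp
    also have "\<dots> = card (I X) + card {f \<in> ?V \<rightarrow>\<^sub>E X. \<not> inj_on f ?V}"
      using fin by (intro card_Un_disjoint) (auto simp: I_def)
    finally have eq: "real (card X) ^ m = real (card (I X)) + real (card {f \<in> ?V \<rightarrow>\<^sub>E X. \<not> inj_on f ?V})"
      using fV by (simp add: card_PiE m_def flip: of_nat_add of_nat_power)
    have "0 < real (card X) ^ m" using X by (simp add: card_gt_0_iff)
    then have "1 - real (card (I X)) / real (card X) ^ m = real (card {f \<in> ?V \<rightarrow>\<^sub>E X. \<not> inj_on f ?V}) / real (card X) ^ m"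
      using eq by (simp add: field_simps)
    then show ?thesis using non_injective_fraction[OF fV X] by (simp add: m_def)
  qed
  have split: "real (card (homs F G \<inter> I ?X \<inter> (?V \<rightarrow>\<^sub>E S))) / real (card S) ^ m \<le> real (card (homs F (induced G S))) / real (card S) ^ m \<and>
      real (card (homs F (induced G S))) / real (card S) ^ m \<le> real (card (homs F G \<inter> I ?X \<inter> (?V \<rightarrow>\<^sub>E S))) / real (card S) ^ m + real m ^ 2 / real (card S)"
    if S: "S \<subseteq> ?X" "S \<noteq> {}" for S
  proof -
    have fS: "finite S" using S fX finite_subset by blast
    have fin: "finite (?V \<rightarrow>\<^sub>E S)" using fS fV by (simp add: finite_PiE)
    have hom: "homs F (induced G S) = {f \<in> homs F G. f \<in> ?V \<rightarrow>\<^sub>E S}" by (rule homs_induced[OF F S(1)])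
    have fh: "finite (homs F (induced G S))" unfolding hom by (rule finite_subset[OF _ fin]) auto
    have sub: "homs F G \<inter> I ?X \<inter> (?V \<rightarrow>\<^sub>E S) \<subseteq> homs F (induced G S)" unfolding hom by auto
    have "homs F (induced G S) \<subseteq> (homs F G \<inter> I ?X \<inter> (?V \<rightarrow>\<^sub>E S)) \<union> {f \<in> ?V \<rightarrow>\<^sub>E S. \<not> inj_on f ?V}"
      unfolding hom by (auto simp: I_def homs_def)
    then have "card (homs F (induced G S)) \<le> card ((homs F G \<inter> I ?X \<inter> (?V \<rightarrow>\<^sub>E S)) \<union> {f \<in> ?V \<rightarrow>\<^sub>E S. \<not> inj_on f ?V})"
      using fin by (intro card_mono) auto
    also have "\<dots> \<le> card (homs F G \<inter> I ?X \<inter> (?V \<rightarrow>\<^sub>E S)) + card {f \<in> ?V \<rightarrow>\<^sub>E S. \<not> inj_on f ?V}" by (rule card_Un_le)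
    finally have "real (card (homs F (induced G S))) / real (card S) ^ m \<le>
       real (card (homs F G \<inter> I ?X \<inter> (?V \<rightarrow>\<^sub>E S))) / real (card S) ^ m + real (card {f \<in> ?V \<rightarrow>\<^sub>E S. \<not> inj_on f ?V}) / real (card S) ^ m"
      unfolding add_divide_distrib[symmetric] by (intro divide_right_mono) (simp_all flip: of_nat_add)
    moreover have "card (homs F G \<inter> I ?X \<inter> (?V \<rightarrow>\<^sub>E S)) \<le> card (homs F (induced G S))" by (rule card_mono[OF fh sub])
    ultimately show ?thesis
      using non_injective_fraction[OF fV fS S(2)] by (auto simp: m_def intro: divide_right_mono)
  qed
  define E where "E = (\<Sum>S\<in>SS. hom_density F (induced G S)) / real (card SS)"
  have LINT: "(LINT H|measure_pmf (subset_pmf G k). hom_density F H) = E"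
    unfolding subset_pmf_def SS_def[symmetric] E_def using fSS SS0
    by (simp add: integral_pmf_of_set)
  have S_card: "card S = k" "S \<subseteq> ?X" "S \<noteq> {}" if "S \<in> SS" for S using that k by (auto simp: SS_def)
  have hdS: "hom_density F (induced G S) = real (card (homs F (induced G S))) / real k ^ m" if "S \<in> SS" for S
    using S_card[OF that] by (simp add: hom_density_eq[OF F] induced_def m_def)
  \<comment> \<open>\<open>a\<close> and \<open>p\<close> are the averages over \<open>SS\<close> of
    the shares that injective homomorphisms and injective maps have among all maps into
    \<open>S\<close>. Further down, \<open>b\<close> and \<open>r\<close> are these shares for
    \<open>G\<close> itself.\<close>
  define a where "a = c * real (card (homs F G \<inter> I ?X)) / real k ^ m"
  define p where "p = c * real (card (I ?X)) / real k ^ m"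
  have div_swap: "(\<Sum>S\<in>SS. f S / K) / C = ((\<Sum>S\<in>SS. f S) / C) / K" for f and K C :: real
    by (simp add: sum_divide_distrib[symmetric] mult.commute)
  have avg_a: "(\<Sum>S\<in>SS. real (card (homs F G \<inter> I ?X \<inter> (?V \<rightarrow>\<^sub>E S))) / real k ^ m) / real (card SS) = a"
    using avg[of "homs F G \<inter> I ?X"] unfolding div_swap a_def by simp
  have avg_p: "(\<Sum>S\<in>SS. real (card (I S)) / real k ^ m) / real (card SS) = p"
  proof -
    have "I ?X \<inter> (?V \<rightarrow>\<^sub>E S) = I S" if "S \<in> SS" for S
    proof -
      have "?V \<rightarrow>\<^sub>E S \<subseteq> ?V \<rightarrow>\<^sub>E ?X" using S_card(2)[OF that] by (intro PiE_mono) auto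
      then show ?thesis unfolding I_def by blast
    qed
    then have "(\<Sum>S\<in>SS. real (card (I S))) / real (card SS) = c * real (card (I ?X))"
      using avg[of "I ?X"] by simp
    then show ?thesis unfolding div_swap p_def by simp
  qed
  have const: "(\<Sum>S\<in>SS. x) / real (card SS) = x" for x :: real using cSS by simp
  have mono: "(\<Sum>S\<in>SS. f S) / real (card SS) \<le> (\<Sum>S\<in>SS. g S) / real (card SS)" if "\<And>S. S \<in> SS \<Longrightarrow> f S \<le> g S" for f g :: "nat set \<Rightarrow> real"
    using that by (intro divide_right_mono sum_mono) auto
  have splitk: "real (card (homs F G \<inter> I ?X \<inter> (?V \<rightarrow>\<^sub>E S))) / real k ^ m \<le> hom_density F (induced G S)"
    "hom_density F (induced G S) \<le> real (card (homs F G \<inter> I ?X \<inter> (?V \<rightarrow>\<^sub>E S))) / real k ^ m + real m ^ 2 / real k" if S: "S \<in> SS" for S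
    using split[OF S_card(2,3)[OF S]] unfolding hdS[OF S] S_card(1)[OF S] by blast+
  have aE: "a \<le> E" unfolding avg_a[symmetric] E_def
    using splitk(1) by (intro mono)
  have Ea: "E \<le> a + real m ^ 2 / real k"
  proof -
    have "E \<le> (\<Sum>S\<in>SS. real (card (homs F G \<inter> I ?X \<inter> (?V \<rightarrow>\<^sub>E S))) / real k ^ m + real m ^ 2 / real k) / real (card SS)"
      unfolding E_def using splitk(2) by (intro mono)
    also have "\<dots> = a + real m ^ 2 / real k"
      unfolding sum.distrib add_divide_distrib avg_a const ..
    finally show ?thesis .
  qed
  have fracS: "0 \<le> 1 - real (card (I S)) / real k ^ m" "1 - real (card (I S)) / real k ^ m \<le> real m ^ 2 / real k"
    if S: "S \<in> SS" for S
    using frac[OF finite_subset[OF S_card(2)[OF S] fX] S_card(3)[OF S]] unfolding S_card(1)[OF S] by blast+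
  have p1: "p \<le> 1"
  proof -
    have "p \<le> (\<Sum>S\<in>SS. 1) / real (card SS)" unfolding avg_p[symmetric]
    proof (rule mono)
      fix S assume S: "S \<in> SS"
      show "real (card (I S)) / real k ^ m \<le> 1"
        using fracS[OF S] by linarith
    qed
    then show ?thesis unfolding const .
  qed
  have p2: "1 - real m ^ 2 / real k \<le> p"
  proof -
    have "(\<Sum>S\<in>SS. 1 - real m ^ 2 / real k) / real (card SS) \<le> p" unfolding avg_p[symmetric]
    proof (rule mono)
      fix S assume S: "S \<in> SS"
      show "1 - real m ^ 2 / real k \<le> real (card (I S)) / real k ^ m"
        using fracS[OF S] by linarith
    qed
    then show ?thesis unfolding const .
  qed
  define b where "b = real (card (homs F G \<inter> I ?X)) / real n ^ m"
  define r where "r = real (card (I ?X)) / real n ^ m"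
  have mk: "real m ^ 2 / real n \<le> real m ^ 2 / real k" using n k by (intro divide_left_mono) auto
  have r: "r \<le> 1" "1 - real m ^ 2 / real k \<le> r" using frac[OF fX n(3)] mk by (simp_all add: r_def n_def)
  have indX: "induced G ?X = G"
    using G by (cases G) (auto simp: induced_def simple_graph_def)
  have b: "b \<le> hom_density F G" "hom_density F G \<le> b + real m ^ 2 / real k"
  proof -
    have "homs F G \<inter> I ?X \<inter> (?V \<rightarrow>\<^sub>E ?X) = homs F G \<inter> I ?X" by (auto simp: I_def)
    then show "b \<le> hom_density F G" "hom_density F G \<le> b + real m ^ 2 / real k"
      using split[of ?X] n(3) mk by (simp_all add: b_def hom_density_eq[OF F] indX n_def m_def)
  qed
  \<comment> \<open>The density among injective maps. The factor \<open>c\<close> is common to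
    \<open>a\<close> and \<open>p\<close>, so \<open>a = h * p\<close> and \<open>b = h * r\<close>,
    with \<open>p\<close> and \<open>r\<close> within \<open>m ^ 2 / k\<close> of 1. If there are no
    injective maps, division by zero makes \<open>h\<close> zero, and so are \<open>a\<close> and
    \<open>b\<close>.\<close>
  define h where "h = real (card (homs F G \<inter> I ?X)) / real (card (I ?X))"
  have h: "0 \<le> h" "h \<le> 1" "a = h * p" "b = h * r"
  proof -
    have le: "card (homs F G \<inter> I ?X) \<le> card (I ?X)" using fI by (intro card_mono) auto
    then show "0 \<le> h" "h \<le> 1" by (auto simp: h_def divide_le_eq)
    show "a = h * p" "b = h * r" using le by (cases "card (I ?X) = 0"; simp add: a_def p_def b_def r_def h_def)+
  qed
  have "h * p \<le> h * 1" "h * r \<le> h * 1" using h p1 r by (intro mult_left_mono; simp)+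
  moreover have "h * (1 - p) \<le> 1 * (1 - p)" "h * (1 - r) \<le> 1 * (1 - r)" using h p1 r by (intro mult_right_mono; simp)+
  ultimately have "\<bar>E - hom_density F G\<bar> \<le> 2 * (real m ^ 2 / real k)"
    using aE Ea b p2 r h(3,4) by (simp add: algebra_simps abs_le_iff)
  then show ?thesis by (simp add: LINT m_def)
qed

lemma induced_fraction_pmf:
  assumes G: "simple_graph G" and k: "k \<le> card (verts G)"
  shows "induced_fraction k G P = measure (measure_pmf (subset_pmf G k)) P"
    "AE H in measure_pmf (subset_pmf G k). simple_graph H \<and> card (verts H) = k"
proof -
  let ?S = "{S. S \<subseteq> verts G \<and> card S = k}"
  have fin: "finite (verts G)" using G by (simp add: simple_graph_def)
  have fS: "finite ?S" using fin by simp
  have "0 < card ?S" using k n_subsets[OF fin, of k] by (simp add: zero_less_binomial)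
  then have S0: "?S \<noteq> {}" by (metis card.empty less_irrefl)
  have "?S \<inter> induced G -` P = {S. S \<subseteq> verts G \<and> card S = k \<and> induced G S \<in> P}" by auto
  then show "induced_fraction k G P = measure (measure_pmf (subset_pmf G k)) P"
    unfolding subset_pmf_def induced_fraction_def measure_map_pmf measure_pmf_of_set[OF S0 fS] by simp
  show "AE H in measure_pmf (subset_pmf G k). simple_graph H \<and> card (verts H) = k"
    using G fS S0 fin unfolding AE_measure_pmf_iff subset_pmf_def
    by (auto simp: induced_def simple_graph_def intro: finite_subset)
qed

lemma subset_concentration:
  assumes G: "simple_graph G" and k: "1 \<le> k" "k \<le> card (verts G)"
  shows "2 / 3 \<le> measure (measure_pmf (subset_pmf G k)) {H. near (precision k) (\<lambda>F. hom_density F H) (\<lambda>F. hom_density F G)}"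
proof (rule density_concentration[OF measure_pmf.prob_space_axioms _ k(1)])
  show "AE H in measure_pmf (subset_pmf G k). finite (verts H)"
    using induced_fraction_pmf(2)[OF G k(2)] by eventually_elim (simp add: simple_graph_def)
  show "simple_graph F \<Longrightarrow> \<bar>(LINT H|measure_pmf (subset_pmf G k). hom_density F H) - hom_density F G\<bar>
      \<le> 2 * real (card (verts F)) ^ 2 / real k" for F
    by (rule subset_mean[OF _ G k])
qed (use hom_density_01 hom_density_double simple_graph_finite[OF G] in auto)

lemma graph_closure_iso_invariant: "iso_invariant (graph_closure P)"
  unfolding iso_invariant_def
proof (intro conjI ballI impI)
  fix W W' assume W: "W \<in> graph_closure P" and W': "W' \<in> W0"
    and eq: "\<forall>F. simple_graph F \<longrightarrow> fun_density F W' = fun_density F W"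
  then show "W' \<in> graph_closure P" unfolding graph_closure_def mem_Collect_eq by metis
qed (auto simp: graph_closure_def)

theorem testable_graph_robust_flexible:
  assumes P: "graph_property P" "robust P" "flexible_graph P"
  shows "testable_graph P"
proof -
  \<comment> \<open>The target graphs have at least as many nodes as the sample, so that targets of
    growing samples grow too, as the definition of the closure demands. A member of \<open>P\<close>
    that is sampled satisfies this itself.\<close>
  define P' where "P' = density_tester (\<lambda>k. {\<lambda>F. hom_density F G | G. G \<in> P \<and> k \<le> card (verts G)})"
  have PS: "simple_graph G" if "G \<in> P" for G using P(1) that by (auto simp: graph_property_def)
  have accept: "2 / 3 \<le> induced_fraction k G P'" if G: "G \<in> P" and k: "1 \<le> k" "k \<le> card (verts G)" for G k
  proof -
    note sG = PS[OF G]
    have mem: "H \<in> P'" if "simple_graph H" "card (verts H) = k" "near (precision k) (\<lambda>F. hom_density F H) (\<lambda>F. hom_density F G)" for H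
      unfolding P'_def density_tester_def using that G k
      by (intro CollectI conjI bexI[of _ "\<lambda>F. hom_density F G"] exI[of _ G]) auto
    have "measure (measure_pmf (subset_pmf G k)) {H. near (precision k) (\<lambda>F. hom_density F H) (\<lambda>F. hom_density F G)}
        \<le> measure (measure_pmf (subset_pmf G k)) P'"
    proof (rule measure_pmf.finite_measure_mono_AE)
      show "AE H in measure_pmf (subset_pmf G k). H \<in> {H. near (precision k) (\<lambda>F. hom_density F H) (\<lambda>F. hom_density F G)} \<longrightarrow> H \<in> P'"
        using induced_fraction_pmf(2)[OF sG k(2)]
        by eventually_elim (use mem in blast)
    qed simp
    then show ?thesis
      using subset_concentration[OF sG k] unfolding induced_fraction_pmf(1)[OF sG k(2)] by linarith
  qed
  have reject: "\<exists>k0\<ge>1. \<forall>G. simple_graph G \<and> ereal e \<le> graph_dist_set G P \<longrightarrow>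
      (\<forall>k. k0 \<le> k \<and> k \<le> card (verts G) \<longrightarrow> induced_fraction k G P' \<le> 1 / 3)" if e: "0 < e" for e :: real
  proof (rule ccontr)
    assume neg: "\<not> (\<exists>k0\<ge>1. \<forall>G. simple_graph G \<and> ereal e \<le> graph_dist_set G P \<longrightarrow>
      (\<forall>k. k0 \<le> k \<and> k \<le> card (verts G) \<longrightarrow> induced_fraction k G P' \<le> 1 / 3))"
    \<comment> \<open>Robustness is used at \<open>e / 2\<close>, since its conclusion is a weak
      inequality that must contradict a distance of at least \<open>e\<close>.\<close>
    obtain n0 e' where e': "0 < e'" and rob: "\<And>n G. n0 \<le> n \<Longrightarrow> simple_graph G \<Longrightarrow> verts G = {1..n} \<Longrightarrow>
        fun_dist_set (graph_fun G) (graph_closure P) \<le> ereal e' \<Longrightarrow> graph_dist_set G P \<le> ereal (e / 2)"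
      using P(2) e unfolding robust_def by (metis half_gt_zero)
    \<comment> \<open>Taking \<open>k\<close> beyond \<open>n + n0\<close> makes \<open>G\<close>
      large enough for robustness and makes the sizes tend to infinity.\<close>
    have "\<exists>k G G' H. n + n0 < k \<and> simple_graph G \<and> verts G = {1..card (verts G)} \<and> k \<le> card (verts G) \<and>
        ereal e \<le> graph_dist_set G P \<and> G' \<in> P \<and> k \<le> card (verts G') \<and>
        near (precision k) (\<lambda>F. hom_density F H) (\<lambda>F. hom_density F G) \<and>
        near (precision k) (\<lambda>F. hom_density F H) (\<lambda>F. hom_density F G')" for n
    proof -
      have "1 \<le> Suc (n + n0)" by simp
      then obtain G k where G: "simple_graph G" "ereal e \<le> graph_dist_set G P"
        and k: "Suc (n + n0) \<le> k" "k \<le> card (verts G)" and frac: "1 / 3 < induced_fraction k G P'"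
        using neg not_le by blast
      let ?M = "measure_pmf (subset_pmf G k)"
      let ?N = "{H. near (precision k) (\<lambda>F. hom_density F H) (\<lambda>F. hom_density F G)}"
      have "\<exists>H. H \<in> P' \<and> H \<in> ?N \<and> card (verts H) = k"
      proof (rule ccontr)
        assume none: "\<nexists>H. H \<in> P' \<and> H \<in> ?N \<and> card (verts H) = k"
        have "1 < measure ?M P' + measure ?M ?N"
          using frac subset_concentration[OF G(1), of k] k unfolding induced_fraction_pmf(1)[OF G(1) k(2)] by simp
        also have "\<dots> = measure ?M (P' \<union> ?N)"
        proof (rule measure_Un_AE[symmetric])
          show "AE H in ?M. H \<notin> P' \<or> H \<notin> ?N"
            using induced_fraction_pmf(2)[OF G(1) k(2)] by eventually_elim (use none in blast)
        qed (simp_all add: measure_pmf.fmeasurable_eq_sets)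
        also have "\<dots> \<le> 1" by (rule measure_pmf.prob_le_1)
        finally show False by simp
      qed
      then obtain H where H: "H \<in> P'" "H \<in> ?N" "card (verts H) = k" by blast
      then obtain G' where G': "G' \<in> P" "k \<le> card (verts G')" "near (precision k) (\<lambda>F. hom_density F H) (\<lambda>F. hom_density F G')"
        by (auto simp: P'_def density_tester_def)
      obtain G0 where G0: "simple_graph G0" "verts G0 = {1..card (verts G)}" "graph_iso G G0"
          "graph_dist_set G P \<le> graph_dist_set G0 P"
        using normalize_graph[OF G(1) P(1)] by blast
      have "near (precision k) (\<lambda>F. hom_density F H) (\<lambda>F. hom_density F G0)"
        using H(2) hom_density_iso[OF _ simple_graph_finite[OF G(1)] G0(3)] by (simp add: near_def simple_graph_enum)
      moreover have "card (verts G0) = card (verts G)" using G0(2) by simp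
      ultimately show ?thesis
        using k G0 G' order_trans[OF G(2) G0(4)] by (intro exI[of _ k] exI[of _ G0] exI[of _ G'] exI[of _ H]) auto
    qed
    then obtain k G G' H where k: "\<And>n. n + n0 < k n" and G: "\<And>n. simple_graph (G n)" "\<And>n. verts (G n) = {1..card (verts (G n))}"
        "\<And>n. k n \<le> card (verts (G n))" "\<And>n. ereal e \<le> graph_dist_set (G n) P"
      and G': "\<And>n. G' n \<in> P" "\<And>n. k n \<le> card (verts (G' n))"
      and near: "\<And>n. near (precision (k n)) (\<lambda>F. hom_density F (H n)) (\<lambda>F. hom_density F (G n))"
        "\<And>n. near (precision (k n)) (\<lambda>F. hom_density F (H n)) (\<lambda>F. hom_density F (G' n))"
      by metis
    have kn: "n \<le> k n" for n using k[of n] by simp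
    have pos: "0 < card (verts (G n))" for n using k[of n] G(3)[of n] by simp
    note W0 = graph_fun_version(2)[OF pos]
    note dens = fun_density_graph_fun[OF _ G(1,2) pos]
    have "\<exists>n. \<exists>Z\<in>graph_closure P. fun_dist (graph_fun (G n)) Z < e'"
    proof (rule flexible_close[OF graph_closure_iso_invariant _ W0 e'])
      show "flexible_fun (graph_closure P)" using P(3) by (simp add: flexible_graph_def)
      \<comment> \<open>The closure is defined by densities, so the members \<open>G' (r n)\<close>
        of \<open>P\<close>, whose densities have the same limits, are themselves the witnesses that
        \<open>U\<close> belongs to it.\<close>
      fix U r assume U: "U \<in> W0" and r: "strict_mono r"
        and lim: "\<And>F. simple_graph F \<Longrightarrow> (\<lambda>n. fun_density F (graph_fun (G (r n)))) \<longlonglongrightarrow> fun_density F U"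
      have "filterlim (\<lambda>n. card (verts (G' (r n)))) at_top sequentially"
      proof (rule filterlim_at_top_mono[OF filterlim_ident])
        have "n \<le> card (verts (G' (r n)))" for n
          using seq_suble[OF r, of n] kn[of "r n"] G'(2)[of "r n"] by linarith
        then show "\<forall>\<^sub>F n in sequentially. n \<le> card (verts (G' (r n)))" by simp
      qed
      moreover have "(\<lambda>n. hom_density F (G' (r n))) \<longlonglongrightarrow> fun_density F U" if F: "simple_graph F" for F
      proof -
        have "(\<lambda>n. hom_density F (G' n) - hom_density F (G n)) \<longlonglongrightarrow> 0"
          by (rule near_triangle_limit[OF kn near(2,1) F])
        from LIMSEQ_subseq_LIMSEQ[OF this r] have "(\<lambda>n. hom_density F (G' (r n)) - hom_density F (G (r n))) \<longlonglongrightarrow> 0"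
          by (simp add: comp_def)
        moreover have "(\<lambda>n. hom_density F (G (r n))) \<longlonglongrightarrow> fun_density F U" using lim[OF F] by (simp add: dens[OF F])
        ultimately show ?thesis using tendsto_add by fastforce
      qed
      ultimately show "U \<in> graph_closure P"
        using U G'(1) unfolding graph_closure_def by (auto intro!: exI[of _ "\<lambda>n. G' (r n)"])
    qed
    then obtain n Z where Z: "Z \<in> graph_closure P" "fun_dist (graph_fun (G n)) Z < e'" by blast
    have "fun_dist_set (graph_fun (G n)) (graph_closure P) \<le> ereal (fun_dist (graph_fun (G n)) Z)"
      unfolding fun_dist_set_def using Z(1) by (rule INF_lower)
    also have "\<dots> \<le> ereal e'" using Z(2) by simp
    finally have "graph_dist_set (G n) P \<le> ereal (e / 2)"
      using k[of n] G(3)[of n] by (intro rob[OF _ G(1,2)]) simp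
    then have "ereal e \<le> ereal (e / 2)" using G(4)[of n] order_trans by blast
    then show False using e by simp
  qed
  show ?thesis
    unfolding testable_graph_def
  proof (intro exI[of _ P'] conjI)
    show "graph_property P'" unfolding P'_def by (rule density_tester_property)
    show "\<forall>G\<in>P. \<forall>k. 1 \<le> k \<and> k \<le> card (verts G) \<longrightarrow> 2 / 3 \<le> induced_fraction k G P'" using accept by blast
    show "\<forall>\<epsilon>>0. \<exists>k\<^sub>\<epsilon>\<ge>1. \<forall>G. simple_graph G \<and> ereal \<epsilon> \<le> graph_dist_set G P \<longrightarrow>
           (\<forall>k. k\<^sub>\<epsilon> \<le> k \<and> k \<le> card (verts G) \<longrightarrow> induced_fraction k G P' \<le> 1 / 3)" using reject by blast
  qed
qed

theorem theorem3p30: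
  shows "(\<forall>R. graphon_property R \<and> cut_closed R \<and> flexible_fun R \<longrightarrow> testable_fun R) \<and>
         (\<forall>P. graph_property P \<and> robust P \<and> flexible_graph P \<longrightarrow> testable_graph P)"
  using testable_fun_closed_flexible testable_graph_robust_flexible by blast

end
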